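(* Let $\mathcal{T}(t)=e^{\mathcal{A}t}$, $t\ge0$, be the $C_0$-semigroup on $X$ generated by the operator $\mathcal{A}$ defined in the context. Then $\mathcal{T}(t)$ is a compact operator on $X$ whenever $t>2L$.
   Context: Let $0<L<\infty$, $\lambda_1>0$, $\lambda_2>0$. For $i=1,2$ let $\mu_i(x)\ge 0$, $x\in[0,L]$, be repair rates satisfying: $\int_0^l\mu_i(x)\,dx<\infty$ for every $0<l<L$; $\int_0^L\mu_i(x)\,dx=\infty$; and there is a positive integer $N$ such that $\lim_{x\to L}\mu_i(x)(L-x)^N<\infty$ for $i=1,2$. Let $X=\mathbb{R}\times L^1(0,L)\times L^1(0,L)$ with norm $\|(p_0,p_1,p_2)\|_X=|p_0|+\|p_1\|_{L^1(0,L)}+\|p_2\|_{L^1(0,L)}$. The operator $\mathcal{A}:D(\mathcal{A})\subset X\to X$ acts on $\vec p=(p_0,p_1,p_2)^T$ by $$\mathcal{A}\vec p=\begin{pmatrix}-(\lambda_1+\lambda_2)p_0+\int_0^L\mu_1(x)p_1(x)\,dx+\int_0^L\mu_2(x)p_2(x)\,dx\\ -p_1'(x)-(\mu_1(x)+\lambda_2)p_1(x)\\ -p_2'(x)-\mu_2(x)p_2(x)\end{pmatrix},$$ with domain $$D(\mathcal{A})=\Big\{\vec p\in X:\ p_i\in W^{1,1}(0,L),\ \mu_ip_i\in L^1(0,L),\ i=1,2,\ \ p_1(0)=\lambda_1p_0,\ \ p_2(0)=\lambda_2p_0+\lambda_2\int_0^Lp_1(x)\,dx\Big\}.$$ This operator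 generates a positive $C_0$-semigroup of contractions on $X$, denoted $\mathcal{T}(t)$. *)

theory Defs
  imports "HOL-Analysis.Analysis"
begin

section \<open>The Lebesgue space of integrable functions on the line\<close>

quotient_type l1 = "real \<Rightarrow> real" / partial:
  "\<lambda>f g. integrable lebesgue f \<and> integrable lebesgue g \<and> (AE x in lebesgue. f x = g x)"
  morphisms rep_l1 abs_l1
proof (rule part_equivpI)
  show "\<exists>f::real \<Rightarrow> real. integrable lebesgue f \<and> integrable lebesgue f \<and> (AE x in lebesgue. f x = f x)"
    by (intro exI[of _ "\<lambda>_. 0"]) simp
  show "symp (\<lambda>f g :: real \<Rightarrow> real. integrable lebesgue f \<and> integrable lebesgue g \<and>
      (AE x in lebesgue. f x = g x))"
    by (intro sympI) (auto simp: eq_commute)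
  show "transp (\<lambda>f g :: real \<Rightarrow> real. integrable lebesgue f \<and> integrable lebesgue g \<and>
      (AE x in lebesgue. f x = g x))"
    by (intro transpI) (auto elim: AE_mp)
qed

instantiation l1 :: real_normed_vector
begin

lift_definition zero_l1 :: l1 is "\<lambda>_. 0" by simp

lift_definition plus_l1 :: "l1 \<Rightarrow> l1 \<Rightarrow> l1" is "\<lambda>f g x. f x + g x"
  by (auto elim: AE_mp)

lift_definition uminus_l1 :: "l1 \<Rightarrow> l1" is "\<lambda>f x. - f x"
  by (auto elim: AE_mp)

lift_definition minus_l1 :: "l1 \<Rightarrow> l1 \<Rightarrow> l1" is "\<lambda>f g x. f x - g x"
  by (auto elim: AE_mp)

lift_definition scaleR_l1 :: "real \<Rightarrow> l1 \<Rightarrow> l1" is "\<lambda>c f x. c * f x"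
  by (auto elim: AE_mp)

lift_definition norm_l1 :: "l1 \<Rightarrow> real" is "\<lambda>f. \<integral>x. \<bar>f x\<bar> \<partial>lebesgue"
  by (intro integral_cong_AE) auto

definition dist_l1 :: "l1 \<Rightarrow> l1 \<Rightarrow> real" where
  "dist_l1 f g = norm (f - g)"

definition sgn_l1 :: "l1 \<Rightarrow> l1" where
  "sgn_l1 f = inverse (norm f) *\<^sub>R f"

definition uniformity_l1 :: "(l1 \<times> l1) filter" where
  "uniformity_l1 = (INF e\<in>{0<..}. principal {(f, g). dist f g < e})"

definition open_l1 :: "l1 set \<Rightarrow> bool" where
  "open_l1 U = (\<forall>f\<in>U. \<forall>\<^sub>F (f', g) in uniformity. f' = f \<longrightarrow> g \<in> U)"

instance
proof
  fix f g h :: l1 and a b :: real and U :: "l1 set"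
  show "f + g + h = f + (g + h)" by transfer (auto simp: algebra_simps)
  show "f + g = g + f" by transfer (auto simp: algebra_simps)
  show "0 + f = f" by transfer auto
  show "- f + f = 0" by transfer auto
  show "f - g = f + - g" by transfer auto
  show "a *\<^sub>R (f + g) = a *\<^sub>R f + a *\<^sub>R g" by transfer (auto simp: algebra_simps)
  show "(a + b) *\<^sub>R f = a *\<^sub>R f + b *\<^sub>R f" by transfer (auto simp: algebra_simps)
  show "a *\<^sub>R b *\<^sub>R f = (a * b) *\<^sub>R f" by transfer (auto simp: algebra_simps)
  show "1 *\<^sub>R f = f" by transfer auto
  show "dist f g = norm (f - g)" by (rule dist_l1_def)
  show "sgn f = inverse (norm f) *\<^sub>R f" by (rule sgn_l1_def)
  show "uniformity = (INF e\<in>{0<..}. principal {(f :: l1, g). dist f g < e})"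
    by (rule uniformity_l1_def)
  show "open U = (\<forall>f\<in>U. \<forall>\<^sub>F (f', g) in uniformity. f' = f \<longrightarrow> g \<in> U)"
    by (rule open_l1_def)
  show "norm f = 0 \<longleftrightarrow> f = 0"
    by transfer (subst integral_nonneg_eq_0_iff_AE, auto)
  show "norm (f + g) \<le> norm f + norm g"
  proof transfer
    fix f g :: "real \<Rightarrow> real"
    assume *: "integrable lebesgue f \<and> integrable lebesgue f \<and> (AE x in lebesgue. f x = f x)"
      "integrable lebesgue g \<and> integrable lebesgue g \<and> (AE x in lebesgue. g x = g x)"
    have "(\<integral>x. \<bar>f x + g x\<bar> \<partial>lebesgue) \<le> (\<integral>x. \<bar>f x\<bar> + \<bar>g x\<bar> \<partial>lebesgue)"
      using * by (intro integral_mono) auto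
    also have "\<dots> = (\<integral>x. \<bar>f x\<bar> \<partial>lebesgue) + (\<integral>x. \<bar>g x\<bar> \<partial>lebesgue)"
      using * by simp
    finally show "(\<integral>x. \<bar>f x + g x\<bar> \<partial>lebesgue) \<le>
      (\<integral>x. \<bar>f x\<bar> \<partial>lebesgue) + (\<integral>x. \<bar>g x\<bar> \<partial>lebesgue)" .
  qed
  show "norm (a *\<^sub>R f) = \<bar>a\<bar> * norm f"
    by transfer (auto simp: abs_mult)
qed

end

text \<open>
  A type cannot depend on the real parameter \<open>L\<close>, so \<open>L\<^sup>1(0,L)\<close> is the closed subspace of
  \<open>L\<^sup>1(\<real>)\<close> of all classes vanishing almost everywhere outside \<open>(0,L)\<close> (extension by zero is an
  isometric isomorphism).
\<close>

definition L1_space :: "real \<Rightarrow> l1 set" where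
  "L1_space L = {f. AE x in lebesgue. x \<notin> {0<..<L} \<longrightarrow> rep_l1 f x = 0}"

text \<open>Meaningful only if \<open>f\<close> is integrable on \<open>(0,L)\<close>.\<close>

definition L1_class :: "real \<Rightarrow> (real \<Rightarrow> real) \<Rightarrow> l1" where
  "L1_class L f = abs_l1 (\<lambda>x. if x \<in> {0<..<L} then f x else 0)"

section \<open>The Sobolev space \<open>W\<^sup>1\<^sup>,\<^sup>1(0,L)\<close>\<close>

text \<open>
  Weak derivatives are tested against \<open>C\<^sup>1\<close> functions with compact support in \<open>(0,L)\<close>, as in
  Brezis, Functional Analysis, Sobolev Spaces and Partial Differential Equations, Section 8.2.
\<close>

definition test_function :: "real \<Rightarrow> (real \<Rightarrow> real) \<Rightarrow> bool" where
  "test_function L \<phi> \<longleftrightarrow>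
     (\<forall>x. \<phi> differentiable (at x)) \<and> continuous_on UNIV (deriv \<phi>) \<and>
     (\<exists>a b. 0 < a \<and> b < L \<and> (\<forall>x. x \<notin> {a..b} \<longrightarrow> \<phi> x = 0))"

definition has_weak_deriv :: "real \<Rightarrow> l1 \<Rightarrow> l1 \<Rightarrow> bool" where
  "has_weak_deriv L p g \<longleftrightarrow> p \<in> L1_space L \<and> g \<in> L1_space L \<and>
     (\<forall>\<phi>. test_function L \<phi> \<longrightarrow>
        (LINT x:{0<..<L}|lebesgue. rep_l1 p x * deriv \<phi> x) =
        - (LINT x:{0<..<L}|lebesgue. rep_l1 g x * \<phi> x))"

definition W11_space :: "real \<Rightarrow> l1 set" where
  "W11_space L = {p. \<exists>g. has_weak_deriv L p g}"

definition weak_deriv :: "real \<Rightarrow> l1 \<Rightarrow> l1" where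
  "weak_deriv L p = (THE g. has_weak_deriv L p g)"

text \<open>The boundary value \<open>p(0)\<close> of \<open>p \<in> W\<^sup>1\<^sup>,\<^sup>1(0,L)\<close>: the value at \<open>0\<close> of its continuous
  representative on \<open>[0,L]\<close>.\<close>

definition value_at_0 :: "real \<Rightarrow> l1 \<Rightarrow> real" where
  "value_at_0 L p = (THE v. \<exists>f. continuous_on {0..L} f \<and>
     (AE x in lebesgue. x \<in> {0<..<L} \<longrightarrow> f x = rep_l1 p x) \<and> f 0 = v)"

section \<open>The state space\<close>

text \<open>A separate type rather than a product, since the library's product norm is the Euclidean one.\<close>

datatype state = State (st0: real) (st1: l1) (st2: l1)

instantiation state :: real_normed_vector
begin

definition zero_state :: state where
  "zero_state = State 0 0 0"

definition plus_state :: "state \<Rightarrow> state \<Rightarrow> state" where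
  "plus_state p q = State (st0 p + st0 q) (st1 p + st1 q) (st2 p + st2 q)"

definition uminus_state :: "state \<Rightarrow> state" where
  "uminus_state p = State (- st0 p) (- st1 p) (- st2 p)"

definition minus_state :: "state \<Rightarrow> state \<Rightarrow> state" where
  "minus_state p q = State (st0 p - st0 q) (st1 p - st1 q) (st2 p - st2 q)"

definition scaleR_state :: "real \<Rightarrow> state \<Rightarrow> state" where
  "scaleR_state c p = State (c *\<^sub>R st0 p) (c *\<^sub>R st1 p) (c *\<^sub>R st2 p)"

definition norm_state :: "state \<Rightarrow> real" where
  "norm_state p = \<bar>st0 p\<bar> + norm (st1 p) + norm (st2 p)"

definition dist_state :: "state \<Rightarrow> state \<Rightarrow> real" where
  "dist_state p q = norm (p - q)"

definition sgn_state :: "state \<Rightarrow> state" where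
  "sgn_state p = inverse (norm p) *\<^sub>R p"

definition uniformity_state :: "(state \<times> state) filter" where
  "uniformity_state = (INF e\<in>{0<..}. principal {(p, q). dist p q < e})"

definition open_state :: "state set \<Rightarrow> bool" where
  "open_state U = (\<forall>p\<in>U. \<forall>\<^sub>F (p', q) in uniformity. p' = p \<longrightarrow> q \<in> U)"

instance
proof
  fix f g h :: state and a b :: real and U :: "state set"
  note defs = zero_state_def plus_state_def uminus_state_def minus_state_def scaleR_state_def
  show "f + g + h = f + (g + h)" by (simp add: defs add.assoc)
  show "f + g = g + f" by (simp add: defs add.commute)
  show "0 + f = f" by (simp add: defs)
  show "- f + f = 0" by (simp add: defs)
  show "f - g = f + - g" by (simp add: defs)
  show "a *\<^sub>R (f + g) = a *\<^sub>R f + a *\<^sub>R g" by (simp add: defs scaleR_add_right distrib_left)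
  show "(a + b) *\<^sub>R f = a *\<^sub>R f + b *\<^sub>R f" by (simp add: defs scaleR_add_left distrib_right)
  show "a *\<^sub>R b *\<^sub>R f = (a * b) *\<^sub>R f" by (simp add: defs)
  show "1 *\<^sub>R f = f" by (simp add: defs)
  show "dist f g = norm (f - g)" by (rule dist_state_def)
  show "sgn f = inverse (norm f) *\<^sub>R f" by (rule sgn_state_def)
  show "uniformity = (INF e\<in>{0<..}. principal {(f :: state, g). dist f g < e})"
    by (rule uniformity_state_def)
  show "open U = (\<forall>f\<in>U. \<forall>\<^sub>F (f', g) in uniformity. f' = f \<longrightarrow> g \<in> U)"
    by (rule open_state_def)
  show "norm f = 0 \<longleftrightarrow> f = 0"
    by (cases f) (auto simp: norm_state_def defs add_nonneg_eq_0_iff)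
  show "norm (f + g) \<le> norm f + norm g"
    using abs_triangle_ineq[of "st0 f" "st0 g"] norm_triangle_ineq[of "st1 f" "st1 g"]
      norm_triangle_ineq[of "st2 f" "st2 g"]
    by (simp add: norm_state_def defs)
  show "norm (a *\<^sub>R f) = \<bar>a\<bar> * norm f"
    by (simp add: norm_state_def defs abs_mult algebra_simps)
qed

end

definition X_space :: "real \<Rightarrow> state set" where
  "X_space L = {p. st1 p \<in> L1_space L \<and> st2 p \<in> L1_space L}"

section \<open>The operator\<close>

definition A_dom ::
    "real \<Rightarrow> real \<Rightarrow> real \<Rightarrow> (real \<Rightarrow> real) \<Rightarrow> (real \<Rightarrow> real) \<Rightarrow> state set" where
  "A_dom L lam1 lam2 mu1 mu2 = {p \<in> X_space L.
     st1 p \<in> W11_space L \<and> st2 p \<in> W11_space L \<and>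
     set_integrable lebesgue {0<..<L} (\<lambda>x. mu1 x * rep_l1 (st1 p) x) \<and>
     set_integrable lebesgue {0<..<L} (\<lambda>x. mu2 x * rep_l1 (st2 p) x) \<and>
     value_at_0 L (st1 p) = lam1 * st0 p \<and>
     value_at_0 L (st2 p) =
       lam2 * st0 p + lam2 * (LINT x:{0<..<L}|lebesgue. rep_l1 (st1 p) x)}"

definition A_op ::
    "real \<Rightarrow> real \<Rightarrow> real \<Rightarrow> (real \<Rightarrow> real) \<Rightarrow> (real \<Rightarrow> real) \<Rightarrow> state \<Rightarrow> state" where
  "A_op L lam1 lam2 mu1 mu2 p = State
     (- (lam1 + lam2) * st0 p
        + (LINT x:{0<..<L}|lebesgue. mu1 x * rep_l1 (st1 p) x)
        + (LINT x:{0<..<L}|lebesgue. mu2 x * rep_l1 (st2 p) x))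
     (- weak_deriv L (st1 p) - L1_class L (\<lambda>x. (mu1 x + lam2) * rep_l1 (st1 p) x))
     (- weak_deriv L (st2 p) - L1_class L (\<lambda>x. mu2 x * rep_l1 (st2 p) x))"

section \<open>Semigroups and compact operators on a subspace\<close>

definition bounded_operator_on :: "'a::real_normed_vector set \<Rightarrow> ('a \<Rightarrow> 'a) \<Rightarrow> bool" where
  "bounded_operator_on X S \<longleftrightarrow>
     S ` X \<subseteq> X \<and>
     (\<forall>x\<in>X. \<forall>y\<in>X. S (x + y) = S x + S y) \<and>
     (\<forall>c. \<forall>x\<in>X. S (c *\<^sub>R x) = c *\<^sub>R S x) \<and>
     (\<exists>K. \<forall>x\<in>X. norm (S x) \<le> K * norm x)"

definition C0_semigroup_on :: "'a::real_normed_vector set \<Rightarrow> (real \<Rightarrow> 'a \<Rightarrow> 'a) \<Rightarrow> bool" where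
  "C0_semigroup_on X T \<longleftrightarrow>
     (\<forall>t\<ge>0. bounded_operator_on X (T t)) \<and>
     (\<forall>x\<in>X. T 0 x = x) \<and>
     (\<forall>s\<ge>0. \<forall>t\<ge>0. \<forall>x\<in>X. T (s + t) x = T s (T t x)) \<and>
     (\<forall>x\<in>X. ((\<lambda>t. T t x) \<longlongrightarrow> x) (at_right 0))"

text \<open>The graph of the infinitesimal generator.\<close>

definition generator_on ::
    "'a::real_normed_vector set \<Rightarrow> (real \<Rightarrow> 'a \<Rightarrow> 'a) \<Rightarrow> ('a \<times> 'a) set" where
  "generator_on X T =
     {(x, y). x \<in> X \<and> y \<in> X \<and> ((\<lambda>h. (T h x - x) /\<^sub>R h) \<longlongrightarrow> y) (at_right 0)}"

text \<open>Equality of graphs, so that the domains agree as well.\<close>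

definition generates_on ::
    "'a::real_normed_vector set \<Rightarrow> 'a set \<Rightarrow> ('a \<Rightarrow> 'a) \<Rightarrow> (real \<Rightarrow> 'a \<Rightarrow> 'a) \<Rightarrow> bool" where
  "generates_on X D A T \<longleftrightarrow>
     C0_semigroup_on X T \<and> generator_on X T = {(x, A x) | x. x \<in> D}"

text \<open>\<open>X \<inter> closure S\<close> is the closure of \<open>S\<close> relative to \<open>X\<close>.\<close>

definition compact_operator_on :: "'a::real_normed_vector set \<Rightarrow> ('a \<Rightarrow> 'a) \<Rightarrow> bool" where
  "compact_operator_on X S \<longleftrightarrow>
     bounded_operator_on X S \<and>
     (\<forall>B \<subseteq> X. bounded B \<longrightarrow> compact (X \<inter> closure (S ` B)))"

end

theory Submission
  imports Defs "HOL-Complex_Analysis.Great_Picard"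
begin

text \<open>
  Along an orbit \<open>w\<close> that is \<open>C\<^sup>1\<close> and stays in the domain of the generator, each component
  \<open>p\<^sub>i\<close>, multiplied by \<open>exp M\<^sub>i\<close> with \<open>M\<^sub>i\<close> the integrated loss rate, solves the free transport
  equation. Hence for times \<open>t \<ge> L\<close> it is \<open>b\<^sub>i (t - x) * exp (- M\<^sub>i x)\<close>, where \<open>b\<^sub>i\<close> is the
  boundary value. As \<open>exp (- M\<^sub>i)\<close> times the rate has integral at most 1, the time derivatives of \<open>p\<^sub>0\<close>
  and of the mass of \<open>p\<^sub>1\<close>, and so those of \<open>b\<^sub>1\<close> and \<open>b\<^sub>2\<close>, are bounded on \<open>[L, t]\<close> by a multiple of
  the norm of the initial state. For \<open>t > 2 * L\<close> the profiles at time \<open>t\<close> are thus equi-Lipschitz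
  functions times the fixed functions \<open>exp (- M\<^sub>i)\<close>, and the theorem of Arzela and Ascoli applies. The
  averages of an orbit over short time intervals are \<open>C\<^sup>1\<close> orbits, whose initial states are dense.
\<close>

section \<open>The Banach spaces \<open>l1\<close> and \<open>state\<close>\<close>

text \<open>The loss rates have infinite integral up to \<open>L\<close>, so the integral of
  \<open>mu1 * p1\<close> is not a bounded functional of the state, and no bound on the derivative
  of \<open>p0\<close> follows from the norm alone. It follows from the form of the solution after
  time \<open>L\<close>: \<open>exp (- M)\<close> is a survival function, and its product with the
  loss rate is the density \<open>- (exp (- M))'\<close>, of mass at most 1 however fast the rate
  blows up. A second obstacle: at each time an orbit is only a class in \<open>l1\<close>, so its
  point values have no evident time derivative. The equation is therefore integrated in
  \<open>x\<close> from 0. The weighted integrals \<open>\<Phi> x\<close> with \<open>x < L\<close>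
  are bounded functionals, hence differentiable along the orbit, and point values are recovered by a
  final differentiation in \<open>x\<close>. All constants depend on the initial state through its
  norm only. So one compact set receives every approximating orbit and, being closed, the limits
  too.\<close>

lemma integrable_rep_l1: "integrable lebesgue (rep_l1 f)"
  using Quotient3_rel_rep[OF Quotient3_l1, of f f] by simp

lemma rep_abs_l1:
  assumes "integrable lebesgue f"
  shows "AE x in lebesgue. rep_l1 (abs_l1 f) x = f x"
  using Quotient3_rep_abs[OF Quotient3_l1, of f] assms by simp

lemma l1_eq_iff: "f = g \<longleftrightarrow> (AE x in lebesgue. rep_l1 f x = rep_l1 g x)"
  using Quotient3_rel_rep[OF Quotient3_l1, of f g] integrable_rep_l1[of f] integrable_rep_l1[of g]
  by simp

lemma abs_rep_l1 [simp]: "abs_l1 (rep_l1 f) = f"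
  using Quotient3_abs_rep[OF Quotient3_l1] .

lemma rep_plus_l1: "AE x in lebesgue. rep_l1 (f + g) x = rep_l1 f x + rep_l1 g x"
  unfolding plus_l1_def map_fun_def comp_def id_def
  by (rule rep_abs_l1) (simp add: integrable_rep_l1)

lemma rep_uminus_l1: "AE x in lebesgue. rep_l1 (- f) x = - rep_l1 f x"
  unfolding uminus_l1_def map_fun_def comp_def id_def
  by (rule rep_abs_l1) (simp add: integrable_rep_l1)

lemma rep_minus_l1: "AE x in lebesgue. rep_l1 (f - g) x = rep_l1 f x - rep_l1 g x"
  unfolding minus_l1_def map_fun_def comp_def id_def
  by (rule rep_abs_l1) (simp add: integrable_rep_l1)

lemma rep_scaleR_l1: "AE x in lebesgue. rep_l1 (c *\<^sub>R f) x = c * rep_l1 f x"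
  unfolding scaleR_l1_def map_fun_def comp_def id_def
  by (rule rep_abs_l1) (simp add: integrable_rep_l1)

lemma norm_l1_eq: "norm f = (\<integral>x. \<bar>rep_l1 f x\<bar> \<partial>lebesgue)"
  unfolding norm_l1_def by simp

lemma norm_abs_l1:
  assumes "integrable lebesgue f"
  shows "norm (abs_l1 f) = (\<integral>x. \<bar>f x\<bar> \<partial>lebesgue)"
proof -
  have "AE x in lebesgue. \<bar>rep_l1 (abs_l1 f) x\<bar> = \<bar>f x\<bar>"
    using rep_abs_l1[OF assms] by (auto elim: AE_mp)
  then show ?thesis
    unfolding norm_l1_eq using assms integrable_rep_l1[of "abs_l1 f"]
    by (intro integral_cong_AE) auto
qed

lemma abs_l1_minus:
  assumes "integrable lebesgue f" "integrable lebesgue g"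
  shows "abs_l1 f - abs_l1 g = abs_l1 (\<lambda>x. f x - g x)"
proof -
  have "integrable lebesgue (\<lambda>x. f x - g x)" using assms by simp
  from rep_minus_l1[of "abs_l1 f" "abs_l1 g"] rep_abs_l1[OF assms(1)] rep_abs_l1[OF assms(2)]
    rep_abs_l1[OF this]
  show ?thesis unfolding l1_eq_iff by eventually_elim simp
qed

text \<open>Continuous functionals turn a derivative in \<open>l1\<close> into the derivative of a
  real function. The weights used later are \<open>exp M\<close> cut off at \<open>x\<close> and the
  indicator of the interval (0, L).\<close>

lemma bounded_linear_weighted_integral:
  assumes w: "w \<in> borel_measurable lebesgue" "\<And>x. \<bar>w x\<bar> \<le> K"
  shows "bounded_linear (\<lambda>f. \<integral>x. w x * rep_l1 f x \<partial>lebesgue)"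
    and "integrable lebesgue (\<lambda>x. w x * rep_l1 f x)"
    and "\<bar>\<integral>x. w x * rep_l1 f x \<partial>lebesgue\<bar> \<le> K * norm f"
proof -
  have int: "integrable lebesgue (\<lambda>x. w x * rep_l1 f x)" for f
  proof (rule Bochner_Integration.integrable_bound[of _ "\<lambda>x. K * rep_l1 f x"])
    show "AE x in lebesgue. norm (w x * rep_l1 f x) \<le> norm (K * rep_l1 f x)"
      using order_trans[OF w(2) abs_ge_self] by (auto simp: abs_mult intro!: mult_right_mono)
  qed (use w integrable_rep_l1[of f] in auto)
  show "integrable lebesgue (\<lambda>x. w x * rep_l1 f x)" by (rule int)
  have bd: "\<bar>\<integral>x. w x * rep_l1 f x \<partial>lebesgue\<bar> \<le> K * norm f" for f
  proof -
    have "\<bar>\<integral>x. w x * rep_l1 f x \<partial>lebesgue\<bar> \<le> (\<integral>x. \<bar>w x * rep_l1 f x\<bar> \<partial>lebesgue)"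
      by (rule integral_abs_bound)
    also have "\<dots> \<le> (\<integral>x. K * \<bar>rep_l1 f x\<bar> \<partial>lebesgue)"
      using w(2) integrable_rep_l1[of f] integrable_abs[OF int[of f]]
      by (intro integral_mono) (auto simp: abs_mult intro!: mult_right_mono)
    finally show ?thesis by (simp add: norm_l1_eq)
  qed
  then show "\<bar>\<integral>x. w x * rep_l1 f x \<partial>lebesgue\<bar> \<le> K * norm f" .
  have m: "rep_l1 f \<in> borel_measurable lebesgue" for f using integrable_rep_l1 by auto
  note [measurable] = w(1) m
  show "bounded_linear (\<lambda>f. \<integral>x. w x * rep_l1 f x \<partial>lebesgue)"
  proof (rule bounded_linear_intro[of _ K])
    fix f g :: l1 and c :: real
    have "(\<integral>x. w x * rep_l1 (f + g) x \<partial>lebesgue) = (\<integral>x. w x * rep_l1 f x + w x * rep_l1 g x \<partial>lebesgue)"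
      by (rule integral_cong_AE, measurable)
         (use rep_plus_l1[of f g] in \<open>eventually_elim, simp add: algebra_simps\<close>)
    then show "(\<integral>x. w x * rep_l1 (f + g) x \<partial>lebesgue) =
        (\<integral>x. w x * rep_l1 f x \<partial>lebesgue) + (\<integral>x. w x * rep_l1 g x \<partial>lebesgue)"
      using int by simp
    have "(\<integral>x. w x * rep_l1 (c *\<^sub>R f) x \<partial>lebesgue) = (\<integral>x. c * (w x * rep_l1 f x) \<partial>lebesgue)"
      by (rule integral_cong_AE, measurable)
         (use rep_scaleR_l1[of c f] in \<open>eventually_elim, simp add: algebra_simps\<close>)
    then show "(\<integral>x. w x * rep_l1 (c *\<^sub>R f) x \<partial>lebesgue) = c *\<^sub>R (\<integral>x. w x * rep_l1 f x \<partial>lebesgue)"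
      by simp
    show "norm (\<integral>x. w x * rep_l1 f x \<partial>lebesgue) \<le> norm f * K"
      using bd[of f] by (simp add: mult.commute)
  qed
qed

text \<open>Riesz-Fischer: a Cauchy sequence in mean has a subsequence that converges almost
  everywhere, and by Fatou's lemma its pointwise limit is the limit in mean. Completeness enters
  through integrals of \<open>state\<close>-valued functions and through Baire's theorem.\<close>

instance l1 :: banach
proof
  fix X :: "nat \<Rightarrow> l1"
  assume X: "Cauchy X"
  have C: "\<exists>N. \<forall>i\<ge>N. \<forall>j\<ge>N. (LINT x|lebesgue. norm (rep_l1 (X i) x - rep_l1 (X j) x)) < e" if "0 < e" for e
  proof -
    obtain N where N: "\<And>i j. i \<ge> N \<Longrightarrow> j \<ge> N \<Longrightarrow> norm (X i - X j) < e"
      using X \<open>0 < e\<close> unfolding Cauchy_def dist_norm by blast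
    have "norm (X i - X j) = (LINT x|lebesgue. norm (rep_l1 (X i) x - rep_l1 (X j) x))" for i j
      using norm_abs_l1[of "\<lambda>x. rep_l1 (X i) x - rep_l1 (X j) x"]
        abs_l1_minus[OF integrable_rep_l1[of "X i"] integrable_rep_l1[of "X j"]]
      by (simp add: integrable_rep_l1)
    then show ?thesis using N by metis
  qed
  have int: "integrable lebesgue (rep_l1 (X n))" for n by (rule integrable_rep_l1)
  obtain r where r: "strict_mono r" and ae: "AE x in lebesgue. Cauchy (\<lambda>i. rep_l1 (X (r i)) x)"
    using cauchy_L1_AE_cauchy_subseq[OF int C] by blast
  define f where "f = (\<lambda>x. lim (\<lambda>i. rep_l1 (X (r i)) x))"
  have [measurable]: "rep_l1 g \<in> borel_measurable lebesgue" for g using integrable_rep_l1 by auto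
  have [measurable]: "f \<in> borel_measurable lebesgue" unfolding f_def by measurable
  have lim: "AE x in lebesgue. (\<lambda>i. rep_l1 (X (r i)) x) \<longlonglongrightarrow> f x"
    using ae by eventually_elim (auto simp: f_def convergent_LIMSEQ_iff[symmetric] Cauchy_convergent_iff)
  \<comment> \<open>With \<open>i\<close> fixed, Fatou's lemma is applied along \<open>r\<close>:
    the Cauchy bound on the distance from \<open>X i\<close> to \<open>X (r j)\<close> passes to the
    limit \<open>f\<close>.\<close>
  have fatou: "\<exists>N. \<forall>i\<ge>N. (\<integral>\<^sup>+x. ennreal \<bar>rep_l1 (X i) x - f x\<bar> \<partial>lebesgue) \<le> ennreal e" if "0 < e" for e
  proof -
    obtain N where N: "\<And>i j. i \<ge> N \<Longrightarrow> j \<ge> N \<Longrightarrow> (LINT x|lebesgue. norm (rep_l1 (X i) x - rep_l1 (X j) x)) < e"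
      using C[OF \<open>0 < e\<close>] by blast
    have "(\<integral>\<^sup>+x. ennreal \<bar>rep_l1 (X i) x - f x\<bar> \<partial>lebesgue) \<le> ennreal e" if "i \<ge> N" for i
    proof -
      have "(\<integral>\<^sup>+x. ennreal \<bar>rep_l1 (X i) x - f x\<bar> \<partial>lebesgue) =
        (\<integral>\<^sup>+x. liminf (\<lambda>j. ennreal \<bar>rep_l1 (X i) x - rep_l1 (X (r j)) x\<bar>) \<partial>lebesgue)"
        using lim
        by (intro nn_integral_cong_AE, eventually_elim)
           (auto intro!: lim_imp_Liminf[symmetric] tendsto_intros)
      also have "\<dots> \<le> liminf (\<lambda>j. (\<integral>\<^sup>+x. ennreal \<bar>rep_l1 (X i) x - rep_l1 (X (r j)) x\<bar> \<partial>lebesgue))"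
        by (rule nn_integral_liminf) measurable
      also have "\<dots> \<le> ennreal e"
      proof (rule Liminf_le)
        show "\<forall>\<^sub>F j in sequentially. (\<integral>\<^sup>+x. ennreal \<bar>rep_l1 (X i) x - rep_l1 (X (r j)) x\<bar> \<partial>lebesgue) \<le> ennreal e"
          unfolding eventually_sequentially
        proof (intro exI allI impI)
          fix j assume "N \<le> j"
          then have "N \<le> r j" using seq_suble[OF r, of j] by simp
          have "(\<integral>\<^sup>+x. ennreal \<bar>rep_l1 (X i) x - rep_l1 (X (r j)) x\<bar> \<partial>lebesgue) =
            ennreal (LINT x|lebesgue. \<bar>rep_l1 (X i) x - rep_l1 (X (r j)) x\<bar>)"
            by (rule nn_integral_eq_integral) (auto simp: int)
          also have "\<dots> \<le> ennreal e" using N[OF \<open>i \<ge> N\<close> \<open>N \<le> r j\<close>] by (simp add: ennreal_leI)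
          finally show "(\<integral>\<^sup>+x. ennreal \<bar>rep_l1 (X i) x - rep_l1 (X (r j)) x\<bar> \<partial>lebesgue) \<le> ennreal e" .
        qed
      qed simp
      finally show ?thesis .
    qed
    then show ?thesis by blast
  qed
  obtain N where N: "\<And>i. i \<ge> N \<Longrightarrow> (\<integral>\<^sup>+x. ennreal \<bar>rep_l1 (X i) x - f x\<bar> \<partial>lebesgue) \<le> ennreal 1"
    using fatou[of 1] by auto
  have "integrable lebesgue (\<lambda>x. rep_l1 (X N) x - f x)"
    using le_less_trans[OF N[of N] ennreal_less_top] by (intro integrableI_bounded) auto
  from Bochner_Integration.integrable_diff[OF int[of N] this] have f: "integrable lebesgue f" by simp
  have "X \<longlonglongrightarrow> abs_l1 f"
  proof (rule LIMSEQ_I)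
    fix e :: real assume "0 < e"
    obtain N where N: "\<And>i. i \<ge> N \<Longrightarrow> (\<integral>\<^sup>+x. ennreal \<bar>rep_l1 (X i) x - f x\<bar> \<partial>lebesgue) \<le> ennreal (e/2)"
      using fatou[of "e/2"] \<open>0 < e\<close> by auto
    have "norm (X i - abs_l1 f) < e" if "i \<ge> N" for i
    proof -
      have "norm (X i - abs_l1 f) = (\<integral>x. \<bar>rep_l1 (X i) x - f x\<bar> \<partial>lebesgue)"
        using norm_abs_l1[of "\<lambda>x. rep_l1 (X i) x - f x"] abs_l1_minus[OF int[of i] f] f
        by (simp add: int)
      moreover have "ennreal (\<integral>x. \<bar>rep_l1 (X i) x - f x\<bar> \<partial>lebesgue) =
          (\<integral>\<^sup>+x. ennreal \<bar>rep_l1 (X i) x - f x\<bar> \<partial>lebesgue)"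
        by (rule nn_integral_eq_integral[symmetric]) (auto simp: int f)
      ultimately show ?thesis using N[OF that] \<open>0 < e\<close>
        by (metis ennreal_le_iff field_sum_of_halves less_add_same_cancel1 half_gt_zero le_less_trans less_imp_le)
    qed
    then show "\<exists>N. \<forall>i\<ge>N. norm (X i - abs_l1 f) < e" by blast
  qed
  then show "convergent X" by (auto simp: convergent_def)
qed

lemma st_simps [simp]:
  "st0 (p + q) = st0 p + st0 q" "st1 (p + q) = st1 p + st1 q" "st2 (p + q) = st2 p + st2 q"
  "st0 (p - q) = st0 p - st0 q" "st1 (p - q) = st1 p - st1 q" "st2 (p - q) = st2 p - st2 q"
  "st0 (c *\<^sub>R p) = c * st0 p" "st1 (c *\<^sub>R p) = c *\<^sub>R st1 p" "st2 (c *\<^sub>R p) = c *\<^sub>R st2 p"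
  by (simp_all add: plus_state_def minus_state_def scaleR_state_def)

lemma norm_st_le: "\<bar>st0 p\<bar> \<le> norm p" "norm (st1 p) \<le> norm p" "norm (st2 p) \<le> norm p"
  by (simp_all add: norm_state_def)

lemma bounded_linear_st:
  shows bounded_linear_st0: "bounded_linear st0"
    and bounded_linear_st1: "bounded_linear st1"
    and bounded_linear_st2: "bounded_linear st2"
  by (rule bounded_linear_intro[of _ 1]; simp add: norm_st_le)+

lemma tendsto_State:
  assumes "(a \<longlongrightarrow> a0) F" "(f \<longlongrightarrow> f0) F" "(g \<longlongrightarrow> g0) F"
  shows "((\<lambda>x. State (a x) (f x) (g x)) \<longlongrightarrow> State a0 f0 g0) F"
proof -
  have "((\<lambda>x. \<bar>a x - a0\<bar> + norm (f x - f0) + norm (g x - g0)) \<longlongrightarrow> \<bar>a0 - a0\<bar> + norm (f0 - f0) + norm (g0 - g0)) F"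
    by (intro tendsto_intros assms)
  then have "((\<lambda>x. norm (State (a x) (f x) (g x) - State a0 f0 g0)) \<longlongrightarrow> 0) F"
    by (simp add: norm_state_def)
  then show ?thesis using Lim_null tendsto_norm_zero_iff by blast
qed

instance state :: banach
proof
  fix X :: "nat \<Rightarrow> state"
  assume X: "Cauchy X"
  have "Cauchy (\<lambda>n. st0 (X n))" "Cauchy (\<lambda>n. st1 (X n))" "Cauchy (\<lambda>n. st2 (X n))"
    using X bounded_linear.Cauchy[OF bounded_linear_st0] bounded_linear.Cauchy[OF bounded_linear_st1]
      bounded_linear.Cauchy[OF bounded_linear_st2] by blast+
  then obtain a f g where "(\<lambda>n. st0 (X n)) \<longlonglongrightarrow> a" "(\<lambda>n. st1 (X n)) \<longlonglongrightarrow> f" "(\<lambda>n. st2 (X n)) \<longlonglongrightarrow> g"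
    unfolding Cauchy_convergent_iff convergent_def by blast
  from tendsto_State[OF this] show "convergent X" by (auto simp: convergent_def)
qed

section \<open>Product and chain rules for indefinite Lebesgue integrals\<close>

text \<open>Replaces the almost everywhere differentiability of absolutely continuous functions in the
  product and chain rules below.\<close>

lemma constant_if_small_relative_increments:
  fixes H V :: "real \<Rightarrow> real"
  assumes "0 \<le> a"
    and inc: "\<And>e. 0 < e \<Longrightarrow> \<exists>d>0. \<forall>x y. 0 \<le> x \<longrightarrow> x \<le> y \<longrightarrow> y \<le> a \<longrightarrow> y - x < d \<longrightarrow>
          \<bar>H y - H x\<bar> \<le> e * (V y - V x)"
  shows "H a = H 0"
proof -
  have "\<bar>H a - H 0\<bar> \<le> e * (V a - V 0)" if e: "0 < e" for e
  proof -
    obtain d where d: "d > 0" "\<And>x y. 0 \<le> x \<Longrightarrow> x \<le> y \<Longrightarrow> y \<le> a \<Longrightarrow> y - x < d \<Longrightarrow>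
          \<bar>H y - H x\<bar> \<le> e * (V y - V x)"
      using inc[OF e] by blast
    \<comment> \<open>Subdivision into \<open>n\<close> equal pieces of length \<open>h < d\<close>;
      the increments of \<open>V\<close> telescope.\<close>
    obtain n :: nat where n: "a / d < n" using reals_Archimedean2 by blast
    then have "n > 0" using \<open>0 \<le> a\<close> \<open>d > 0\<close> by (intro gr0I) (auto simp: divide_less_0_iff)
    define h where "h = a / n"
    have h: "0 \<le> h" "h < d" "n * h = a"
      using n \<open>n > 0\<close> \<open>d > 0\<close> \<open>0 \<le> a\<close> by (auto simp: h_def field_simps)
    have "\<bar>H (k * h) - H 0\<bar> \<le> e * (V (k * h) - V 0)" if "k \<le> n" for k :: nat
      using that
    proof (induction k)
      case (Suc k)
      have "Suc k * h \<le> n * h" using Suc.prems h(1) by (intro mult_right_mono) simp_all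
      then have "\<bar>H (Suc k * h) - H (k * h)\<bar> \<le> e * (V (Suc k * h) - V (k * h))"
        using h by (intro d(2)) (auto simp: algebra_simps)
      with Suc.IH Suc.prems show ?case by (simp add: algebra_simps)
    qed simp
    from this[of n] show ?thesis by (simp add: h)
  qed
  then have *: "\<bar>H a - H 0\<bar> \<le> e * \<bar>V a - V 0\<bar>" if "0 < e" for e
    using that by (meson abs_ge_self dual_order.trans less_imp_le mult_left_mono)
  have "\<bar>H a - H 0\<bar> \<le> 0 + e" if "0 < e" for e
  proof -
    have "\<bar>H a - H 0\<bar> \<le> e / (\<bar>V a - V 0\<bar> + 1) * \<bar>V a - V 0\<bar>"
      using that by (intro *) (auto intro!: divide_pos_pos)
    also have "\<dots> \<le> e" using that by (simp add: field_simps)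
    finally show ?thesis by simp
  qed
  then have "\<bar>H a - H 0\<bar> \<le> 0" by (rule field_le_epsilon)
  then show ?thesis by simp
qed

lemma absolutely_integrable_mult_continuous:
  fixes f g :: "real \<Rightarrow> real"
  assumes "f absolutely_integrable_on {a..b}" "continuous_on {a..b} g"
  shows "(\<lambda>x. g x * f x) absolutely_integrable_on {a..b}"
proof (rule absolutely_integrable_bounded_measurable_product_real)
  show "g \<in> borel_measurable (lebesgue_on {a..b})"
    using assms(2) by (intro continuous_imp_measurable_on_sets_lebesgue) auto
  show "bounded (g ` {a..b})"
    using compact_continuous_image[OF assms(2)] compact_imp_bounded by blast
qed (use assms in auto)

lemma absolutely_integrable_subinterval:
  fixes f :: "real \<Rightarrow> real"
  assumes "f absolutely_integrable_on {a..b}" "{c..d} \<subseteq> {a..b}"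
  shows "f absolutely_integrable_on {c..d}" "f integrable_on {c..d}"
    "(\<lambda>x. \<bar>f x\<bar>) integrable_on {c..d}"
proof -
  show *: "f absolutely_integrable_on {c..d}"
    using assms by (meson absolutely_integrable_on_subinterval cbox_interval set_integrable_subset lmeasurable_interval(1) fmeasurableD)
  show "f integrable_on {c..d}" "(\<lambda>x. \<bar>f x\<bar>) integrable_on {c..d}"
    using * unfolding absolutely_integrable_on_def by auto
qed

lemma integral_increment:
  fixes f :: "real \<Rightarrow> real"
  assumes "f absolutely_integrable_on {0..a}" "0 \<le> x" "x \<le> y" "y \<le> a"
  shows "integral {0..y} f - integral {0..x} f = integral {x..y} f"
  using Henstock_Kurzweil_Integration.integral_combine[of 0 x y f]
    absolutely_integrable_subinterval(2)[OF assms(1), of 0 y] assms by auto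

lemma continuous_on_indefinite_integral:
  fixes f :: "real \<Rightarrow> real"
  assumes "f absolutely_integrable_on {0..a}"
  shows "continuous_on {0..a} (\<lambda>x. integral {0..x} f)"
  using absolutely_integrable_subinterval(2)[OF assms, of 0 a] indefinite_integral_continuous_1 by blast

lemma small_weighted_integral:
  fixes f k :: "real \<Rightarrow> real"
  assumes f: "f absolutely_integrable_on {x..y}" and kf: "(\<lambda>s. k s * f s) absolutely_integrable_on {x..y}"
    and k: "\<And>s. s \<in> {x..y} \<Longrightarrow> \<bar>k s\<bar> \<le> e"
  shows "\<bar>integral {x..y} (\<lambda>s. k s * f s)\<bar> \<le> e * integral {x..y} (\<lambda>s. \<bar>f s\<bar>)"
proof -
  have "norm (integral {x..y} (\<lambda>s. k s * f s)) \<le> integral {x..y} (\<lambda>s. e * \<bar>f s\<bar>)"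
    using f kf k unfolding absolutely_integrable_on_def
    by (intro integral_norm_bound_integral) (auto simp: abs_mult intro!: mult_right_mono integrable_on_mult_right)
  then show ?thesis by simp
qed

lemma integral_scaled_diff:
  fixes f k :: "real \<Rightarrow> real"
  assumes "f integrable_on S" "k integrable_on S"
  shows "integral S (\<lambda>s. c * f s - k s) = c * integral S f - integral S k"
  by (rule integral_unique has_integral_diff has_integral_mult_right integrable_integral assms)+

text \<open>Product rule for absolutely continuous functions. On a short interval the increment of
  \<open>F * G\<close> is \<open>G y\<close> times that of \<open>F\<close> plus \<open>F x\<close>
  times that of \<open>G\<close>. Freezing these factors costs at most their oscillation, which is
  uniformly small, times the integrals of \<open>|f|\<close> and \<open>|g|\<close>, whose sum is
  the increment of \<open>V\<close>.\<close>

lemma indefinite_integral_mult: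
 fixes f g :: "real \<Rightarrow> real" and c d :: real
  assumes a: "0 \<le> a" and f: "f absolutely_integrable_on {0..a}" and g: "g absolutely_integrable_on {0..a}"
  defines "F \<equiv> \<lambda>x. c + integral {0..x} f" and "G \<equiv> \<lambda>x. d + integral {0..x} g"
  shows "integral {0..a} (\<lambda>x. G x * f x + F x * g x) = F a * G a - c * d"
proof -
  let ?k = "\<lambda>x. G x * f x + F x * g x"
  have cont: "continuous_on {0..a} F" "continuous_on {0..a} G"
    unfolding F_def G_def using f g by (intro continuous_intros continuous_on_indefinite_integral; simp)+
  have Gf: "(\<lambda>x. G x * f x) absolutely_integrable_on {0..a}"
    and Fg: "(\<lambda>x. F x * g x) absolutely_integrable_on {0..a}"
    using cont f g absolutely_integrable_mult_continuous by blast+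
  have k: "?k absolutely_integrable_on {0..a}" using Gf Fg by (rule set_integral_add(1))
  define V where "V = (\<lambda>x. integral {0..x} (\<lambda>s. \<bar>f s\<bar>) + integral {0..x} (\<lambda>s. \<bar>g s\<bar>))"
  define H where "H = (\<lambda>x. F x * G x - integral {0..x} ?k)"
  have "H a = H 0"
  proof (rule constant_if_small_relative_increments[OF a, where V=V])
    fix e :: real assume "0 < e"
    have "uniformly_continuous_on {0..a} F" "uniformly_continuous_on {0..a} G"
      using cont by (auto intro: compact_uniformly_continuous)
    then obtain d1 d2 where d: "d1 > 0" "d2 > 0"
      "\<And>x y. x \<in> {0..a} \<Longrightarrow> y \<in> {0..a} \<Longrightarrow> \<bar>y - x\<bar> < d1 \<Longrightarrow> \<bar>F y - F x\<bar> < e"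
      "\<And>x y. x \<in> {0..a} \<Longrightarrow> y \<in> {0..a} \<Longrightarrow> \<bar>y - x\<bar> < d2 \<Longrightarrow> \<bar>G y - G x\<bar> < e"
      using \<open>0 < e\<close> unfolding uniformly_continuous_on_def dist_real_def by metis
    have "\<bar>H y - H x\<bar> \<le> e * (V y - V x)" if xy: "0 \<le> x" "x \<le> y" "y \<le> a" "y - x < min d1 d2" for x y
    proof -
      have sub: "{x..y} \<subseteq> {0..a}" using xy by auto
      note ai = absolutely_integrable_subinterval[OF _ sub]
      have FG: "F y = F x + integral {x..y} f" "G y = G x + integral {x..y} g"
        using integral_increment[OF f xy(1-3)] integral_increment[OF g xy(1-3)] by (auto simp: F_def G_def)
      have "H y - H x = F y * G y - F x * G x - integral {x..y} ?k"
        using integral_increment[OF k xy(1-3)] by (simp add: H_def)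
      also have "F y * G y - F x * G x = G y * integral {x..y} f + F x * integral {x..y} g"
        using FG by (simp add: algebra_simps)
      also have "\<dots> - integral {x..y} ?k = integral {x..y} (\<lambda>s. (G y - G s) * f s) + integral {x..y} (\<lambda>s. (F x - F s) * g s)"
        using integral_scaled_diff[OF ai(2)[OF f] ai(2)[OF Gf], of "G y"]
          integral_scaled_diff[OF ai(2)[OF g] ai(2)[OF Fg], of "F x"]
          Henstock_Kurzweil_Integration.integral_add[OF ai(2)[OF Gf] ai(2)[OF Fg]]
        by (simp add: left_diff_distrib)
      also have "\<bar>\<dots>\<bar> \<le> e * integral {x..y} (\<lambda>s. \<bar>f s\<bar>) + e * integral {x..y} (\<lambda>s. \<bar>g s\<bar>)"
      proof (rule order_trans[OF abs_triangle_ineq add_mono])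
        have "(\<lambda>s. (G y - G s) * f s) absolutely_integrable_on {x..y}" "(\<lambda>s. (F x - F s) * g s) absolutely_integrable_on {x..y}"
          using cont continuous_on_subset[OF _ sub] ai(1)[OF f] ai(1)[OF g]
          by (auto intro!: absolutely_integrable_mult_continuous continuous_intros)
        moreover have "\<bar>G y - G s\<bar> \<le> e" "\<bar>F x - F s\<bar> \<le> e" if "s \<in> {x..y}" for s
          using d(3)[of s x] d(4)[of s y] that xy by auto
        ultimately show "\<bar>integral {x..y} (\<lambda>s. (G y - G s) * f s)\<bar> \<le> e * integral {x..y} (\<lambda>s. \<bar>f s\<bar>)"
          "\<bar>integral {x..y} (\<lambda>s. (F x - F s) * g s)\<bar> \<le> e * integral {x..y} (\<lambda>s. \<bar>g s\<bar>)"
          using ai(1)[OF f] ai(1)[OF g] by (auto intro!: small_weighted_integral)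
      qed
      also have "\<dots> = e * (V y - V x)"
        unfolding V_def
          integral_increment[OF set_integrable_abs[OF f] xy(1-3), symmetric]
          integral_increment[OF set_integrable_abs[OF g] xy(1-3), symmetric]
        by (simp add: algebra_simps)
      finally show ?thesis .
    qed
    then show "\<exists>d>0. \<forall>x y. 0 \<le> x \<longrightarrow> x \<le> y \<longrightarrow> y \<le> a \<longrightarrow> y - x < d \<longrightarrow> \<bar>H y - H x\<bar> \<le> e * (V y - V x)"
      using d(1,2) by (intro exI[of _ "min d1 d2"]) auto
  qed
  then show ?thesis by (simp add: H_def F_def G_def)
qed

text \<open>Chain rule, by the scheme of the product rule. It is applied to \<open>mu + k\<close>
  for the integrating factor and to \<open>- (mu + k)\<close> for the total loss.\<close>

lemma indefinite_integral_exp: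
  fixes m :: "real \<Rightarrow> real"
  assumes a: "0 \<le> a" and m: "m absolutely_integrable_on {0..a}"
  defines "M \<equiv> \<lambda>x. integral {0..x} m"
  shows "integral {0..a} (\<lambda>x. exp (M x) * m x) = exp (M a) - 1"
proof -
  let ?k = "\<lambda>x. exp (M x) * m x"
  have contM: "continuous_on {0..a} M"
    unfolding M_def using m by (rule continuous_on_indefinite_integral)
  then have cont: "continuous_on {0..a} (\<lambda>x. exp (M x))" by (intro continuous_intros)
  have k: "?k absolutely_integrable_on {0..a}" using m cont by (rule absolutely_integrable_mult_continuous)
  define V where "V = (\<lambda>x. integral {0..x} (\<lambda>s. \<bar>m s\<bar>))"
  define H where "H = (\<lambda>x. exp (M x) - integral {0..x} ?k)"
  have "H a = H 0"
  proof (rule constant_if_small_relative_increments[OF a, where V=V])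
    fix e :: real assume "0 < e"
    have "uniformly_continuous_on {0..a} (\<lambda>x. exp (M x))"
      using cont by (auto intro: compact_uniformly_continuous)
    then obtain d where d: "d > 0"
      "\<And>x y. x \<in> {0..a} \<Longrightarrow> y \<in> {0..a} \<Longrightarrow> \<bar>y - x\<bar> < d \<Longrightarrow> \<bar>exp (M y) - exp (M x)\<bar> < e"
      using \<open>0 < e\<close> unfolding uniformly_continuous_on_def dist_real_def by metis
    have "\<bar>H y - H x\<bar> \<le> e * (V y - V x)" if xy: "0 \<le> x" "x \<le> y" "y \<le> a" "y - x < d" for x y
    proof -
      have sub: "{x..y} \<subseteq> {0..a}" using xy by auto
      note ai = absolutely_integrable_subinterval[OF _ sub]
      \<comment> \<open>The mean value theorem for \<open>exp\<close> gives a point between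
        \<open>M x\<close> and \<open>M y\<close>, and by continuity of \<open>M\<close> this point
        is some \<open>M z\<close>. As \<open>m\<close> has no fixed sign, both orders of
        \<open>M x\<close> and \<open>M y\<close> occur.\<close>
      have "\<exists>z\<in>{x..y}. exp (M y) - exp (M x) = exp (M z) * (M y - M x)"
      proof -
        have "\<exists>w. (w \<in> {M x..M y} \<or> w \<in> {M y..M x}) \<and> exp (M y) - exp (M x) = exp w * (M y - M x)"
        proof (cases "M x = M y")
          case False
          then consider "M x < M y" | "M y < M x" by linarith
          then show ?thesis
          proof cases
            case 1
            from MVT2[OF 1, of exp exp] obtain w where "M x < w" "w < M y" "exp (M y) - exp (M x) = (M y - M x) * exp w"
              using DERIV_exp by blast
            then show ?thesis by (intro exI[of _ w]) (auto simp: mult.commute)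
          next
            case 2
            from MVT2[OF 2, of exp exp] obtain w where "M y < w" "w < M x" "exp (M x) - exp (M y) = (M x - M y) * exp w"
              using DERIV_exp by blast
            then show ?thesis by (intro exI[of _ w]) (auto simp: algebra_simps)
          qed
        qed auto
        then obtain w where w: "w \<in> {M x..M y} \<or> w \<in> {M y..M x}" "exp (M y) - exp (M x) = exp w * (M y - M x)"
          by blast
        have "\<exists>z. x \<le> z \<and> z \<le> y \<and> M z = w"
          using w(1) IVT'[of M x w y] IVT2'[of M y w x] xy continuous_on_subset[OF contM sub] by auto
        with w(2) show ?thesis by auto
      qed
      then obtain z where z: "z \<in> {x..y}" "exp (M y) - exp (M x) = exp (M z) * (M y - M x)" by blast
      have "H y - H x = exp (M z) * integral {x..y} m - integral {x..y} ?k"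
        using integral_increment[OF k xy(1-3)] integral_increment[OF m xy(1-3)] z(2) by (simp add: H_def M_def)
      also have "\<dots> = integral {x..y} (\<lambda>s. (exp (M z) - exp (M s)) * m s)"
        using integral_scaled_diff[OF ai(2)[OF m] ai(2)[OF k], of "exp (M z)"]
        by (simp add: left_diff_distrib)
      also have "\<bar>\<dots>\<bar> \<le> e * integral {x..y} (\<lambda>s. \<bar>m s\<bar>)"
      proof (rule small_weighted_integral)
        show "(\<lambda>s. (exp (M z) - exp (M s)) * m s) absolutely_integrable_on {x..y}"
          using continuous_on_subset[OF cont sub] ai(1)[OF m]
          by (auto intro!: absolutely_integrable_mult_continuous continuous_on_diff)
        show "\<bar>exp (M z) - exp (M s)\<bar> \<le> e" if "s \<in> {x..y}" for s
          using that z(1) xy by (intro less_imp_le[OF d(2)]) (auto simp: abs_if)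
      qed (rule ai(1)[OF m])
      also have "\<dots> = e * (V y - V x)"
        using integral_increment[where f="\<lambda>s. \<bar>m s\<bar>" and a=a and x=x and y=y] m xy by (simp add: V_def set_integrable_abs)
      finally show ?thesis .
    qed
    then show "\<exists>d>0. \<forall>x y. 0 \<le> x \<longrightarrow> x \<le> y \<longrightarrow> y \<le> a \<longrightarrow> y - x < d \<longrightarrow> \<bar>H y - H x\<bar> \<le> e * (V y - V x)"
      using d(1) by blast
  qed
  then show ?thesis by (simp add: H_def M_def)
qed

text \<open>In terms of derivatives, \<open>(exp M * f)' = exp M * (f' + m * f)\<close>: the product
  rule for \<open>f\<close> and \<open>exp M\<close>, the latter written as 1 plus an indefinite
  integral by the chain rule. This is what removes the loss term from the transport
  equation.\<close>

lemma integral_integrating_factor: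
  fixes m g :: "real \<Rightarrow> real" and c :: real
  assumes a: "0 \<le> a" and m: "m absolutely_integrable_on {0..a}" and g: "g absolutely_integrable_on {0..a}"
  defines "M \<equiv> \<lambda>x. integral {0..x} m" and "f \<equiv> \<lambda>x. c + integral {0..x} g"
  shows "integral {0..a} (\<lambda>x. exp (M x) * (g x + m x * f x)) = exp (M a) * f a - c"
proof -
  have E: "exp (M x) = 1 + integral {0..x} (\<lambda>x. exp (M x) * m x)" if "x \<in> {0..a}" for x
    using indefinite_integral_exp[of x m] that absolutely_integrable_subinterval(1)[OF m, of 0 x]
    by (simp add: M_def)
  have "(\<lambda>x. exp (M x) * m x) absolutely_integrable_on {0..a}"
    unfolding M_def using m
    by (intro absolutely_integrable_mult_continuous continuous_on_exp continuous_on_indefinite_integral)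
  from indefinite_integral_mult[OF a this g, where c=1 and d=c]
  have "integral {0..a} (\<lambda>x. f x * (exp (M x) * m x) + (1 + integral {0..x} (\<lambda>x. exp (M x) * m x)) * g x) =
      (1 + integral {0..a} (\<lambda>x. exp (M x) * m x)) * f a - c"
    by (simp add: f_def)
  also have "(1 + integral {0..a} (\<lambda>x. exp (M x) * m x)) * f a = exp (M a) * f a"
    using E[of a] a by simp
  also have "integral {0..a} (\<lambda>x. f x * (exp (M x) * m x) + (1 + integral {0..x} (\<lambda>x. exp (M x) * m x)) * g x) =
      integral {0..a} (\<lambda>x. exp (M x) * (g x + m x * f x))"
    using E by (intro integral_cong) (simp add: algebra_simps)
  finally show ?thesis .
qed

section \<open>Representation of \<open>W\<^sup>1\<^sup>,\<^sup>1\<close> functions\<close>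

lemma DERIV_positive_part_square:
  "((\<lambda>x::real. (max 0 x)\<^sup>2) has_real_derivative 2 * max 0 x) (at x)"
proof -
  consider "x < 0" | "x = 0" | "x > 0" by linarith
  then show ?thesis
  proof cases
    case 1
    have "((\<lambda>x::real. 0) has_real_derivative 2 * max 0 x) (at x)" using 1 by simp
    then show ?thesis
      by (rule has_field_derivative_transform_within_open[of _ _ _ "{..<0}"]) (use 1 in auto)
  next
    case 2
    have "((\<lambda>h::real. max 0 h) \<longlongrightarrow> max 0 0) (at 0)" by (intro tendsto_intros)
    moreover have "\<forall>\<^sub>F h::real in at 0. max 0 h = (max 0 (0 + h))\<^sup>2 / h"
      by (auto simp: eventually_at_filter max_def power2_eq_square)
    ultimately have "((\<lambda>h::real. (max 0 (0 + h))\<^sup>2 / h) \<longlongrightarrow> max 0 0) (at 0)"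
      by (rule Lim_transform_eventually)
    then show ?thesis using 2 by (simp add: DERIV_def)
  next
    case 3
    have "((\<lambda>x::real. x\<^sup>2) has_real_derivative 2 * max 0 x) (at x)"
      using 3 by (auto intro!: derivative_eq_intros)
    then show ?thesis
      by (rule has_field_derivative_transform_within_open[of _ _ _ "{0<..}"]) (use 3 in auto)
  qed
qed

text \<open>A continuously differentiable version of the positive part: zero up to 0, a parabola on
  \<open>[0, d]\<close>, then the line \<open>x - d / 2\<close>. A difference of two squared
  positive parts expresses this without a case distinction.\<close>

definition smooth_ramp :: "real \<Rightarrow> real \<Rightarrow> real" where
  "smooth_ramp d x = ((max 0 x)\<^sup>2 - (max 0 (x - d))\<^sup>2) / (2 * d)"

definition smooth_step :: "real \<Rightarrow> real \<Rightarrow> real" where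
  "smooth_step d x = (max 0 x - max 0 (x - d)) / d"

lemma DERIV_smooth_ramp:
  assumes "d > 0"
  shows "(smooth_ramp d has_real_derivative smooth_step d x) (at x)"
proof -
  have "((\<lambda>x. (max 0 (x - d))\<^sup>2) has_real_derivative 2 * max 0 (x - d)) (at x)"
    using DERIV_positive_part_square[of "x - d"] DERIV_shift[of "\<lambda>x. (max 0 x)\<^sup>2" _ x "- d"] by simp
  with DERIV_positive_part_square[of x] show ?thesis
    unfolding smooth_ramp_def[abs_def] smooth_step_def using assms
    by (auto intro!: DERIV_cong[OF DERIV_cdivide[OF DERIV_diff]] simp: field_simps)
qed

lemma smooth_ramp_eq:
  assumes "d > 0"
  shows "x \<le> 0 \<Longrightarrow> smooth_ramp d x = 0" "x \<ge> d \<Longrightarrow> smooth_ramp d x = x - d / 2"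
    "x \<le> 0 \<Longrightarrow> smooth_step d x = 0" "x \<ge> d \<Longrightarrow> smooth_step d x = 1"
    "\<bar>smooth_step d x\<bar> \<le> 1"
  using assms by (auto simp: smooth_ramp_def smooth_step_def max_def field_simps power2_eq_square)

text \<open>The bound does not depend on \<open>d\<close>, so it dominates the test functions as
  \<open>d\<close> tends to 0.\<close>

lemma smooth_ramp_lipschitz:
  assumes "d > 0"
  shows "\<bar>smooth_ramp d x - smooth_ramp d y\<bar> \<le> \<bar>x - y\<bar>"
proof -
  have "norm (smooth_ramp d x - smooth_ramp d y) \<le> 1 * norm (x - y)"
    by (rule field_differentiable_bound[of UNIV "smooth_ramp d" "smooth_step d"])
       (use DERIV_smooth_ramp[OF assms] smooth_ramp_eq(5)[OF assms] in auto)
  then show ?thesis by simp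
qed

text \<open>At 0 the limit of the steps is 0; differences of two shifted steps therefore tend to
  indicators of intervals open on the left and closed on the right.\<close>

lemma smooth_ramp_tendsto:
  assumes d: "d \<longlonglongrightarrow> 0" "\<And>n. d n > 0"
  shows "(\<lambda>n. smooth_ramp (d n) x) \<longlonglongrightarrow> max 0 x"
    and "(\<lambda>n. smooth_step (d n) x) \<longlonglongrightarrow> (if x > 0 then 1 else 0)"
proof -
  show "(\<lambda>n. smooth_ramp (d n) x) \<longlonglongrightarrow> max 0 x"
  proof (cases "x > 0")
    case True
    then have "\<forall>\<^sub>F n in sequentially. d n < x" using d order_tendstoD(2) by blast
    then have "\<forall>\<^sub>F n in sequentially. x - d n / 2 = smooth_ramp (d n) x"
      by eventually_elim (simp add: smooth_ramp_eq d)
    moreover have "(\<lambda>n. x - d n / 2) \<longlonglongrightarrow> x - 0 / 2" by (intro tendsto_intros d) simp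
    ultimately show ?thesis using True Lim_transform_eventually by fastforce
  qed (simp add: smooth_ramp_eq d)
  show "(\<lambda>n. smooth_step (d n) x) \<longlonglongrightarrow> (if x > 0 then 1 else 0)"
  proof (cases "x > 0")
    case True
    then have "\<forall>\<^sub>F n in sequentially. d n < x" using d order_tendstoD(2) by blast
    then have "\<forall>\<^sub>F n in sequentially. smooth_step (d n) x = 1"
      by eventually_elim (simp add: smooth_ramp_eq d)
    then show ?thesis using True by (simp add: tendsto_eventually)
  qed (simp add: smooth_ramp_eq d)
qed

lemma continuous_imp_borel_measurable_lebesgue:
  "continuous_on UNIV (f :: real \<Rightarrow> real) \<Longrightarrow> f \<in> borel_measurable lebesgue"
  by (intro measurable_completion) (simp add: borel_measurable_continuous_onI)

lemma borel_measurable_rep_l1 [measurable]: "rep_l1 f \<in> borel_measurable lebesgue"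
  using integrable_rep_l1 by auto

lemma norm_indicator_scaleR_mult_le:
  fixes r k :: real
  assumes "\<bar>k\<bar> \<le> K"
  shows "norm (indicat_real S x *\<^sub>R (r * k)) \<le> K * \<bar>r\<bar>"
  using mult_right_mono[OF assms, of "\<bar>r\<bar>"] order_trans[OF abs_ge_zero assms]
  by (auto simp: indicator_def abs_mult mult.commute)

lemma borel_measurable_indicator_rep_mult:
  assumes "f \<in> borel_measurable lebesgue"
  shows "(\<lambda>x. indicat_real {a<..<b} x *\<^sub>R (rep_l1 p x * f x)) \<in> borel_measurable lebesgue"
  by (intro borel_measurable_scaleR borel_measurable_indicator borel_measurable_times
      borel_measurable_rep_l1 assms) simp

text \<open>Test functions whose derivatives are smoothed differences of two indicator functions.\<close>

lemma weak_deriv_trapezoid: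
  assumes wd: "has_weak_deriv L p g" and ab: "0 < a" "a < b" "0 < h" "b + h < L"
  defines "\<psi> \<equiv> \<lambda>x. (if x > a then 1 else 0) - (if x > a + h then 1 else 0)
      - (if x > b then 1 else 0) + (if x > b + h then 1 else 0) :: real"
    and "\<phi> \<equiv> \<lambda>x. max 0 (x - a) - max 0 (x - (a + h)) - max 0 (x - b) + max 0 (x - (b + h))"
  shows "(LINT x:{0<..<L}|lebesgue. rep_l1 p x * \<psi> x) = - (LINT x:{0<..<L}|lebesgue. rep_l1 g x * \<phi> x)"
proof -
  \<comment> \<open>The support of the test function ends at \<open>b + h + d n\<close>; the factor
    \<open>(L - b - h) / 2\<close> keeps this below \<open>L\<close>.\<close>
  define d where "d = (\<lambda>n. (L - b - h) / 2 * inverse (real (Suc n)))"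
  have "d \<longlonglongrightarrow> (L - b - h) / 2 * 0"
    unfolding d_def by (intro tendsto_mult tendsto_const LIMSEQ_inverse_real_of_nat)
  then have d: "d \<longlonglongrightarrow> 0" "\<And>n. d n > 0" using ab by (simp_all add: d_def)
  have dle: "b + h + d n < L" for n
  proof -
    have "d n \<le> (L - b - h) / 2 * 1"
      unfolding d_def using ab by (intro mult_left_mono) (auto simp: field_simps)
    then show ?thesis using ab by (simp add: field_simps)
  qed
  define f where "f = (\<lambda>n x. smooth_ramp (d n) (x - a) - smooth_ramp (d n) (x - (a + h))
     - smooth_ramp (d n) (x - b) + smooth_ramp (d n) (x - (b + h)))"
  define f' where "f' = (\<lambda>n x. smooth_step (d n) (x - a) - smooth_step (d n) (x - (a + h))
     - smooth_step (d n) (x - b) + smooth_step (d n) (x - (b + h)))"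
  have shift: "((\<lambda>x. smooth_ramp (d n) (x - c)) has_real_derivative smooth_step (d n) (x - c)) (at x)" for n x c
    using DERIV_smooth_ramp[OF d(2), of n "x - c"] DERIV_shift[of "smooth_ramp (d n)" _ x "- c"] by simp
  have der: "(f n has_real_derivative f' n x) (at x)" for n x
    unfolding f_def f'_def by (intro derivative_intros shift)
  have f'_cont: "continuous_on UNIV (f' n)" for n
    unfolding f'_def smooth_step_def using d(2)[of n] by (intro continuous_intros) auto
  have deriv: "deriv (f n) = f' n" for n using der DERIV_imp_deriv by blast
  have supp: "f n x = 0" if "x \<notin> {a..b + h + d n}" for n x
  proof (cases "x < a")
    case True
    then show ?thesis using d(2)[of n] ab by (simp add: f_def smooth_ramp_eq)
  next
    case False
    then show ?thesis using that d(2)[of n] ab by (simp add: f_def smooth_ramp_eq)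
  qed
  have test: "test_function L (f n)" for n
    unfolding test_function_def deriv
  proof (intro conjI allI exI)
    show "f n differentiable at x" for x using der real_differentiable_def by blast
    show "x \<notin> {a..b + h + d n} \<longrightarrow> f n x = 0" for x using supp by blast
  qed (use f'_cont ab(1) dle in auto)
  have eq: "(LINT x:{0<..<L}|lebesgue. rep_l1 p x * f' n x) = - (LINT x:{0<..<L}|lebesgue. rep_l1 g x * f n x)" for n
  proof -
    have "(LINT x:{0<..<L}|lebesgue. rep_l1 p x * deriv (f n) x) = - (LINT x:{0<..<L}|lebesgue. rep_l1 g x * f n x)"
      using wd test[of n] unfolding has_weak_deriv_def by blast
    then show ?thesis by (simp only: deriv)
  qed
  have m1: "f' n \<in> borel_measurable lebesgue" for n
    using f'_cont by (rule continuous_imp_borel_measurable_lebesgue)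
  have "continuous_on UNIV (f n)" for n
    using der DERIV_continuous_on has_field_derivative_at_within by blast
  then have m2: "f n \<in> borel_measurable lebesgue" for n
    using continuous_imp_borel_measurable_lebesgue by blast
  have \<psi>\<phi>: "\<psi> \<in> borel_measurable lebesgue" "\<phi> \<in> borel_measurable lebesgue"
    unfolding \<psi>_def \<phi>_def by (rule measurable_completion, measurable)+
  have "(\<lambda>n. LINT x:{0<..<L}|lebesgue. rep_l1 p x * f' n x) \<longlonglongrightarrow> (LINT x:{0<..<L}|lebesgue. rep_l1 p x * \<psi> x)"
    unfolding set_lebesgue_integral_def
  proof (rule integral_dominated_convergence[where w="\<lambda>x. 4 * \<bar>rep_l1 p x\<bar>"])
    show "AE x in lebesgue. (\<lambda>i. indicat_real {0<..<L} x *\<^sub>R (rep_l1 p x * f' i x))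
        \<longlonglongrightarrow> indicat_real {0<..<L} x *\<^sub>R (rep_l1 p x * \<psi> x)"
    proof (intro AE_I2 tendsto_intros)
      fix x
      have "(\<lambda>n. f' n x) \<longlonglongrightarrow> (if x - a > 0 then 1 else 0) - (if x - (a + h) > 0 then 1 else 0)
        - (if x - b > 0 then 1 else 0) + (if x - (b + h) > 0 then 1 else 0)"
        unfolding f'_def by (intro tendsto_intros smooth_ramp_tendsto d)
      then show "(\<lambda>n. f' n x) \<longlonglongrightarrow> \<psi> x" by (simp add: \<psi>_def)
    qed
    fix n
    have "\<bar>f' n x\<bar> \<le> 4" for x
      unfolding f'_def using smooth_ramp_eq(5)[OF d(2)[of n], of "x - a"] smooth_ramp_eq(5)[OF d(2)[of n], of "x - (a + h)"]
        smooth_ramp_eq(5)[OF d(2)[of n], of "x - b"] smooth_ramp_eq(5)[OF d(2)[of n], of "x - (b + h)"] by linarith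
    then show "AE x in lebesgue. norm (indicat_real {0<..<L} x *\<^sub>R (rep_l1 p x * f' n x)) \<le> 4 * \<bar>rep_l1 p x\<bar>"
      by (intro AE_I2 norm_indicator_scaleR_mult_le) blast
  qed (auto intro!: borel_measurable_indicator_rep_mult m1 \<psi>\<phi>(1) simp: integrable_rep_l1 simp del: real_scaleR_def)
  moreover have "(\<lambda>n. - (LINT x:{0<..<L}|lebesgue. rep_l1 g x * f n x)) \<longlonglongrightarrow> - (LINT x:{0<..<L}|lebesgue. rep_l1 g x * \<phi> x)"
    unfolding set_lebesgue_integral_def
  proof (rule tendsto_minus, rule integral_dominated_convergence[where w="\<lambda>x. 2 * h * \<bar>rep_l1 g x\<bar>"])
    show "AE x in lebesgue. (\<lambda>i. indicat_real {0<..<L} x *\<^sub>R (rep_l1 g x * f i x))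
        \<longlonglongrightarrow> indicat_real {0<..<L} x *\<^sub>R (rep_l1 g x * \<phi> x)"
      unfolding f_def \<phi>_def by (intro AE_I2 tendsto_intros smooth_ramp_tendsto d)
    fix n
    \<comment> \<open>The ramps at \<open>a\<close> and \<open>a + h\<close> differ by at most
      \<open>h\<close>, and so do those at \<open>b\<close> and \<open>b + h\<close>.\<close>
    have "\<bar>f n x\<bar> \<le> 2 * h" for x
      unfolding f_def using smooth_ramp_lipschitz[OF d(2)[of n], of "x - a" "x - (a + h)"]
       smooth_ramp_lipschitz[OF d(2)[of n], of "x - b" "x - (b + h)"] ab(3) by linarith
    then show "AE x in lebesgue. norm (indicat_real {0<..<L} x *\<^sub>R (rep_l1 g x * f n x)) \<le> 2 * h * \<bar>rep_l1 g x\<bar>"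
      by (intro AE_I2 norm_indicator_scaleR_mult_le) blast
  qed (auto intro!: borel_measurable_indicator_rep_mult m2 \<psi>\<phi>(2) simp: integrable_rep_l1 simp del: real_scaleR_def)
  ultimately show ?thesis unfolding eq by (rule LIMSEQ_unique)
qed

lemma absolutely_integrable_rep_l1: "rep_l1 f absolutely_integrable_on {a..b}"
  using integrable_rep_l1[of f] integrable_mult_indicator[of "{a..b}" lebesgue "rep_l1 f"]
  by (simp add: set_integrable_def)

text \<open>One exceptional set serves all sequences of step sizes, so that the sequence can be
  fitted to the points afterwards.\<close>

lemma lebesgue_point_right:
  fixes f :: "real \<Rightarrow> real"
  assumes "\<And>a b. f integrable_on {a..b}"
  obtains N where "negligible N"
    "\<And>x h. x \<notin> N \<Longrightarrow> h \<longlonglongrightarrow> 0 \<Longrightarrow> (\<And>n. h n > 0) \<Longrightarrow>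
       (\<lambda>n. integral {x..x + h n} f / h n) \<longlonglongrightarrow> f x"
proof -
  obtain N where N: "negligible N"
    "\<And>x e. \<lbrakk>x \<notin> N; 0 < e\<rbrakk> \<Longrightarrow> \<exists>d>0. \<forall>h. 0 < h \<and> h < d \<longrightarrow>
        norm (integral (cbox x (x + h *\<^sub>R One)) f /\<^sub>R h ^ DIM(real) - f x) < e"
    using integrable_ccontinuous_explicit[of f] assms by (metis cbox_interval)
  have "(\<lambda>n. integral {x..x + h n} f / h n) \<longlonglongrightarrow> f x"
    if x: "x \<notin> N" and h: "h \<longlonglongrightarrow> 0" "\<And>n. h n > 0" for x h
  proof (rule LIMSEQ_I)
    fix e :: real assume "0 < e"
    then obtain d where d: "d > 0" "\<And>h. 0 < h \<Longrightarrow> h < d \<Longrightarrow>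
        norm (integral (cbox x (x + h *\<^sub>R One)) f /\<^sub>R h ^ DIM(real) - f x) < e"
      using N(2)[OF x] by blast
    have "\<forall>\<^sub>F n in sequentially. h n < d" using h d order_tendstoD(2) by blast
    then have "\<forall>\<^sub>F n in sequentially. norm (integral {x..x + h n} f / h n - f x) < e"
      by eventually_elim (use d(2)[OF h(2)] in \<open>simp add: divide_inverse_commute\<close>)
    then show "\<exists>N. \<forall>n\<ge>N. norm (integral {x..x + h n} f / h n - f x) < e"
      by (simp add: eventually_sequentially)
  qed
  with N(1) show ?thesis using that by blast
qed

lemma LINT_rep_l1_box: "(LINT x:{a<..b}|lebesgue. rep_l1 f x) = integral {a..b} (rep_l1 f)"
proof -
  have "(LINT x:{a<..b}|lebesgue. rep_l1 f x) = integral {a<..b} (rep_l1 f)"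
    using integrable_mult_indicator[of "{a<..b}" lebesgue "rep_l1 f"] integrable_rep_l1[of f]
    by (intro set_lebesgue_integral_eq_integral) (simp add: set_integrable_def)
  also have "\<dots> = integral {a..b} (rep_l1 f)"
    by (rule integral_spike_set; rule negligible_subset[of "{a}"]) auto
  finally show ?thesis .
qed

text \<open>A trapezoid rising on \<open>[a, a + h]\<close> and falling on \<open>[b, b + h]\<close>
  tests \<open>p\<close> against the difference of two short intervals. After division by
  \<open>h\<close>, the averages of \<open>p\<close> tend to its values at the Lebesgue points
  \<open>a\<close> and \<open>b\<close>, while the trapezoid tends to the indicator of
  \<open>(a, b]\<close>.\<close>

lemma weak_deriv_increment:
  assumes wd: "has_weak_deriv L p g"
  obtains N where "negligible N"
    "\<And>a b. 0 < a \<Longrightarrow> a < b \<Longrightarrow> b < L \<Longrightarrow> a \<notin> N \<Longrightarrow> b \<notin> N \<Longrightarrow>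
       rep_l1 p b - rep_l1 p a = integral {a..b} (rep_l1 g)"
proof -
  have pint: "rep_l1 p integrable_on {a..b}" for a b
    using absolutely_integrable_rep_l1 absolutely_integrable_on_def by blast
  obtain N where N: "negligible N"
    "\<And>x h. x \<notin> N \<Longrightarrow> h \<longlonglongrightarrow> 0 \<Longrightarrow> (\<And>n. h n > 0) \<Longrightarrow>
       (\<lambda>n. integral {x..x + h n} (rep_l1 p) / h n) \<longlonglongrightarrow> rep_l1 p x"
    using lebesgue_point_right[OF pint] by blast
  have "rep_l1 p b - rep_l1 p a = integral {a..b} (rep_l1 g)"
    if ab: "0 < a" "a < b" "b < L" "a \<notin> N" "b \<notin> N" for a b
  proof -
    \<comment> \<open>The bound by \<open>b - a\<close> keeps the two flanks of the trapezoid apart,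
      the bound by \<open>L - b\<close> keeps its support below \<open>L\<close>.\<close>
    define h where "h = (\<lambda>n. min (b - a) (L - b) / 2 * inverse (real (Suc n)))"
    have "h \<longlonglongrightarrow> min (b - a) (L - b) / 2 * 0"
      unfolding h_def by (intro tendsto_mult tendsto_const LIMSEQ_inverse_real_of_nat)
    then have h: "h \<longlonglongrightarrow> 0" "\<And>n. h n > 0" using ab by (simp_all add: h_def)
    have hle: "b + h n < L" "a + h n \<le> b" for n
    proof -
      have "h n \<le> min (b - a) (L - b) / 2 * 1"
        unfolding h_def using ab by (intro mult_left_mono) (auto simp: field_simps)
      then show "b + h n < L" "a + h n \<le> b" using ab by (auto simp: min_def split: if_splits)
    qed
    define \<phi> where "\<phi> = (\<lambda>n x. max 0 (x - a) - max 0 (x - (a + h n)) - max 0 (x - b) + max 0 (x - (b + h n)))"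
    have eq: "integral {a..a + h n} (rep_l1 p) - integral {b..b + h n} (rep_l1 p) =
        - (LINT x:{0<..<L}|lebesgue. rep_l1 g x * \<phi> n x)" for n
    proof -
      let ?\<psi> = "\<lambda>x. (if x > a then 1 else 0) - (if x > a + h n then 1 else 0)
        - (if x > b then 1 else 0) + (if x > b + h n then 1 else 0) :: real"
      have "(LINT x:{0<..<L}|lebesgue. rep_l1 p x * ?\<psi> x) =
        (LINT x|lebesgue. indicator {a<..a + h n} x *\<^sub>R rep_l1 p x - indicator {b<..b + h n} x *\<^sub>R rep_l1 p x)"
        unfolding set_lebesgue_integral_def
      proof (rule Bochner_Integration.integral_cong[OF refl])
        fix x
        consider "x \<le> a" | "a < x" "x \<le> a + h n" | "a + h n < x" "x \<le> b"
          | "b < x" "x \<le> b + h n" | "b + h n < x" by linarith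
        then show "indicat_real {0<..<L} x *\<^sub>R (rep_l1 p x * ?\<psi> x) =
            indicat_real {a<..a + h n} x *\<^sub>R rep_l1 p x - indicat_real {b<..b + h n} x *\<^sub>R rep_l1 p x"
          by cases (use ab h(2)[of n] hle[of n] in simp_all)
      qed
      also have "\<dots> = (LINT x:{a<..a + h n}|lebesgue. rep_l1 p x) - (LINT x:{b<..b + h n}|lebesgue. rep_l1 p x)"
        unfolding set_lebesgue_integral_def
        by (intro Bochner_Integration.integral_diff integrable_mult_indicator integrable_rep_l1) auto
      finally show ?thesis
        unfolding weak_deriv_trapezoid[OF wd ab(1,2) h(2)[of n] hle(1)] LINT_rep_l1_box \<phi>_def by (rule sym)
    qed
    have l1: "(\<lambda>n. integral {a..a + h n} (rep_l1 p) / h n - integral {b..b + h n} (rep_l1 p) / h n)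
        \<longlonglongrightarrow> rep_l1 p a - rep_l1 p b"
      using ab h by (intro tendsto_diff N(2)) auto
    have l2: "(\<lambda>n. integral {a..a + h n} (rep_l1 p) / h n - integral {b..b + h n} (rep_l1 p) / h n)
        = (\<lambda>n. - (LINT x:{0<..<L}|lebesgue. rep_l1 g x * (\<phi> n x / h n)))"
      using eq by (simp flip: diff_divide_distrib)
    have l3: "(\<lambda>n. - (LINT x:{0<..<L}|lebesgue. rep_l1 g x * (\<phi> n x / h n))) \<longlonglongrightarrow>
        - (LINT x:{a<..b}|lebesgue. rep_l1 g x)"
      unfolding set_lebesgue_integral_def
    proof (rule tendsto_minus, rule integral_dominated_convergence[where w="\<lambda>x. 1 * \<bar>rep_l1 g x\<bar>"])
      have \<phi>_meas: "(\<lambda>x. \<phi> n x) \<in> borel_measurable lebesgue" for n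
        unfolding \<phi>_def by (intro continuous_imp_borel_measurable_lebesgue continuous_intros)
      show "(\<lambda>x. indicat_real {0<..<L} x *\<^sub>R (rep_l1 g x * (\<phi> n x / h n))) \<in> borel_measurable lebesgue" for n
        by (intro borel_measurable_indicator_rep_mult borel_measurable_divide \<phi>_meas borel_measurable_const)
      show "(\<lambda>x. indicat_real {a<..b} x *\<^sub>R rep_l1 g x) \<in> borel_measurable lebesgue"
        by (intro borel_measurable_scaleR borel_measurable_indicator borel_measurable_rep_l1) simp
      show "AE x in lebesgue. (\<lambda>n. indicat_real {0<..<L} x *\<^sub>R (rep_l1 g x * (\<phi> n x / h n)))
          \<longlonglongrightarrow> indicat_real {a<..b} x *\<^sub>R rep_l1 g x"
      proof (intro AE_I2 tendsto_eventually)
        fix x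
        have "\<forall>\<^sub>F n in sequentially. x > a \<longrightarrow> h n < x - a" "\<forall>\<^sub>F n in sequentially. x > b \<longrightarrow> h n < x - b"
          using h order_tendstoD(2)[OF h(1), of "x - a"] order_tendstoD(2)[OF h(1), of "x - b"] by auto
        then show "\<forall>\<^sub>F n in sequentially. indicat_real {0<..<L} x *\<^sub>R (rep_l1 g x * (\<phi> n x / h n)) =
            indicat_real {a<..b} x *\<^sub>R rep_l1 g x"
        proof eventually_elim
          case (elim n)
          consider "x \<le> a" | "a < x" "x \<le> b" | "b < x" by linarith
          then have "\<phi> n x = h n * indicat_real {a<..b} x"
          proof cases
            case 1
            then show ?thesis using ab h(2)[of n] by (simp add: \<phi>_def)
          next
            case 2
            then show ?thesis using ab h(2)[of n] elim by (simp add: \<phi>_def)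
          next
            case 3
            then have "h n < x - a" "h n < x - b" using elim ab by auto
            then show ?thesis using 3 ab h(2)[of n] by (simp add: \<phi>_def)
          qed
          then show ?case using ab h(2)[of n] by (auto simp: indicator_def)
        qed
      qed
      fix n
      \<comment> \<open>\<open>\<phi> n x\<close> is a difference of two numbers in
        \<open>[0, h n]\<close>, hence at most \<open>h n\<close> in modulus.\<close>
      have clamp: "0 \<le> max 0 (x - c) - max 0 (x - (c + h n))" "max 0 (x - c) - max 0 (x - (c + h n)) \<le> h n" for x c
        using h(2)[of n] by auto
      have diff: "\<bar>p - q\<bar> \<le> r" if "0 \<le> p" "p \<le> r" "0 \<le> q" "q \<le> r" for p q r :: real
        using that by auto
      have "\<bar>\<phi> n x\<bar> \<le> h n" for x
      proof -
        have "\<phi> n x = (max 0 (x - a) - max 0 (x - (a + h n))) - (max 0 (x - b) - max 0 (x - (b + h n)))"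
          by (simp add: \<phi>_def)
        then show ?thesis by (simp only: diff[OF clamp clamp])
      qed
      then have "\<bar>\<phi> n x / h n\<bar> \<le> 1" for x
        using h(2)[of n] by simp
      then show "AE x in lebesgue. norm (indicat_real {0<..<L} x *\<^sub>R (rep_l1 g x * (\<phi> n x / h n))) \<le> 1 * \<bar>rep_l1 g x\<bar>"
        by (intro AE_I2 norm_indicator_scaleR_mult_le) blast
    qed (simp add: integrable_rep_l1)
    have "rep_l1 p a - rep_l1 p b = - (LINT x:{a<..b}|lebesgue. rep_l1 g x)"
      using l1 l3 unfolding l2 by (rule LIMSEQ_unique)
    then show ?thesis by (simp add: LINT_rep_l1_box)
  qed
  with N(1) show ?thesis using that by blast
qed

section \<open>Continuous representatives and uniqueness of weak derivatives\<close>

lemma not_negligible_interval: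
  fixes N :: "real set"
  assumes "negligible N" "a < b"
  obtains x where "a < x" "x < b" "x \<notin> N"
proof -
  have "\<not> {a<..<b} \<subseteq> N"
    using negligible_subset[OF assms(1)] open_not_negligible[of "{a<..<b}"] assms(2) by auto
  then obtain x where "x \<in> {a<..<b}" "x \<notin> N" by blast
  then show ?thesis by (intro that) auto
qed

text \<open>The points of agreement form a closed set, which is dense because a null set contains no
  interval. The endpoints are included, and this makes the value at 0 well defined.\<close>

lemma continuous_AE_eq:
  fixes f g :: "real \<Rightarrow> real"
  assumes "0 < L" "continuous_on {0..L} f" "continuous_on {0..L} g"
    and ae: "AE x in lebesgue. x \<in> {0<..<L} \<longrightarrow> f x = g x" and x: "x \<in> {0..L}"
  shows "f x = g x"
proof -
  obtain N where N: "N \<in> null_sets lebesgue" "{x. \<not> (x \<in> {0<..<L} \<longrightarrow> f x = g x)} \<subseteq> N"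
    using ae by (auto simp: eventually_ae_filter)
  have "negligible N" using N(1) negligible_iff_null_sets by blast
  have closed: "closed {x \<in> {0..L}. f x - g x = 0}"
    using assms(2,3) by (intro continuous_closed_preimage_constant continuous_on_diff) auto
  have dense: "{0..L} \<subseteq> closure {x \<in> {0..L}. f x - g x = 0}"
  proof
    fix y assume y: "y \<in> {0..L}"
    show "y \<in> closure {x \<in> {0..L}. f x - g x = 0}"
      unfolding closure_approachable
    proof (intro allI impI)
      fix e :: real assume "0 < e"
      have "max 0 (y - e) < min L (y + e)" using y \<open>0 < e\<close> \<open>0 < L\<close> by auto
      from not_negligible_interval[OF \<open>negligible N\<close> this]
      obtain z where z: "max 0 (y - e) < z" "z < min L (y + e)" "z \<notin> N" by blast
      then have "f z = g z" "z \<in> {0..L}" "dist z y < e" using N(2) by (auto simp: dist_real_def)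
      then show "\<exists>z\<in>{x \<in> {0..L}. f x - g x = 0}. dist z y < e" by auto
    qed
  qed
  then show ?thesis using x closed by (auto simp: closure_closed)
qed

lemma AE_not_in_negligible:
  fixes N :: "real set"
  assumes "negligible N"
  shows "AE x in lebesgue. x \<notin> N"
  using assms AE_not_in negligible_iff_null_sets by blast

lemma weak_deriv_representation:
  assumes L: "0 < L" and wd: "has_weak_deriv L p g"
  obtains c where "AE x in lebesgue. x \<in> {0<..<L} \<longrightarrow> rep_l1 p x = c + integral {0..x} (rep_l1 g)"
proof -
  obtain N where N: "negligible N"
    "\<And>a b. 0 < a \<Longrightarrow> a < b \<Longrightarrow> b < L \<Longrightarrow> a \<notin> N \<Longrightarrow> b \<notin> N \<Longrightarrow>
       rep_l1 p b - rep_l1 p a = integral {a..b} (rep_l1 g)"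
    using weak_deriv_increment[OF wd] by blast
  \<comment> \<open>Any point outside the exceptional set can be the base point; \<open>c\<close>
    makes the formula exact there.\<close>
  obtain y where y: "0 < y" "y < L" "y \<notin> N" using not_negligible_interval[OF N(1) L] by blast
  define c where "c = rep_l1 p y - integral {0..y} (rep_l1 g)"
  note inc = integral_increment[OF absolutely_integrable_rep_l1[where f=g and a=0 and b=L]]
  have "rep_l1 p x = c + integral {0..x} (rep_l1 g)" if x: "x \<in> {0<..<L}" "x \<notin> N" for x
  proof -
    consider "x < y" | "x = y" | "y < x" by linarith
    then show ?thesis
    proof cases
      case 1
      then show ?thesis using N(2)[of x y] inc[of x y] x y by (simp add: c_def)
    next
      case 3
      then show ?thesis using N(2)[of y x] inc[of y x] x y by (simp add: c_def)
    qed (simp add: c_def)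
  qed
  then have "AE x in lebesgue. x \<in> {0<..<L} \<longrightarrow> rep_l1 p x = c + integral {0..x} (rep_l1 g)"
    using AE_not_in_negligible[OF N(1)] by (auto elim: AE_mp)
  then show ?thesis by (rule that)
qed

lemma value_at_0_eq:
  assumes L: "0 < L"
    and ae: "AE x in lebesgue. x \<in> {0<..<L} \<longrightarrow> rep_l1 p x = c + integral {0..x} (rep_l1 g)"
  shows "value_at_0 L p = c"
  unfolding value_at_0_def
proof (rule the_equality)
  let ?f = "\<lambda>x. c + integral {0..x} (rep_l1 g)"
  have cont: "continuous_on {0..L} ?f"
    by (intro continuous_intros continuous_on_indefinite_integral absolutely_integrable_rep_l1)
  have "AE x in lebesgue. x \<in> {0<..<L} \<longrightarrow> ?f x = rep_l1 p x"
    using ae by eventually_elim simp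
  then show "\<exists>f. continuous_on {0..L} f \<and> (AE x in lebesgue. x \<in> {0<..<L} \<longrightarrow> f x = rep_l1 p x) \<and> f 0 = c"
    using cont by (intro exI[of _ ?f]) auto
  fix v assume "\<exists>f. continuous_on {0..L} f \<and> (AE x in lebesgue. x \<in> {0<..<L} \<longrightarrow> f x = rep_l1 p x) \<and> f 0 = v"
  then obtain f where f: "continuous_on {0..L} f" "AE x in lebesgue. x \<in> {0<..<L} \<longrightarrow> f x = rep_l1 p x" "f 0 = v"
    by blast
  have "AE x in lebesgue. x \<in> {0<..<L} \<longrightarrow> f x = ?f x"
    using f(2) ae by eventually_elim simp
  from continuous_AE_eq[OF L f(1) cont this, of 0] L f(3) show "v = c" by simp
qed

text \<open>Two weak derivatives have the same indefinite integral, because both constants of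
  integration equal \<open>value_at_0 L p\<close>. Lebesgue's differentiation theorem then
  identifies them almost everywhere on (0, L), and both vanish outside. Hence the definite
  description in \<open>weak_deriv\<close> denotes.\<close>

lemma has_weak_deriv_unique:
  assumes L: "0 < L" and wd: "has_weak_deriv L p g" "has_weak_deriv L p g'"
  shows "g = g'"
proof -
  obtain c where c: "AE x in lebesgue. x \<in> {0<..<L} \<longrightarrow> rep_l1 p x = c + integral {0..x} (rep_l1 g)"
    using weak_deriv_representation[OF L wd(1)] by blast
  obtain c' where c': "AE x in lebesgue. x \<in> {0<..<L} \<longrightarrow> rep_l1 p x = c' + integral {0..x} (rep_l1 g')"
    using weak_deriv_representation[OF L wd(2)] by blast
  have "c = c'" using value_at_0_eq[OF L c] value_at_0_eq[OF L c'] by simp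
  have cont: "continuous_on {0..L} (\<lambda>x. c + integral {0..x} (rep_l1 h))" for h
    by (intro continuous_intros continuous_on_indefinite_integral absolutely_integrable_rep_l1)
  have "AE x in lebesgue. x \<in> {0<..<L} \<longrightarrow> c + integral {0..x} (rep_l1 g) = c + integral {0..x} (rep_l1 g')"
    using c c' by eventually_elim (simp add: \<open>c = c'\<close>)
  from continuous_AE_eq[OF L cont cont this]
  have eq: "integral {0..x} (rep_l1 g) = integral {0..x} (rep_l1 g')" if "x \<in> {0..L}" for x
    using that by simp
  have eq2: "integral {x..y} (rep_l1 g) = integral {x..y} (rep_l1 g')" if "0 \<le> x" "x \<le> y" "y \<le> L" for x y
    using integral_increment[OF absolutely_integrable_rep_l1[where f=g and a=0 and b=L] that]
      integral_increment[OF absolutely_integrable_rep_l1[where f=g' and a=0 and b=L] that] eq[of x] eq[of y] that by simp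
  have int: "rep_l1 h integrable_on {a..b}" for h a b
    using absolutely_integrable_rep_l1 absolutely_integrable_on_def by blast
  obtain N where N: "negligible N" "\<And>x h. x \<notin> N \<Longrightarrow> h \<longlonglongrightarrow> 0 \<Longrightarrow> (\<And>n. h n > 0) \<Longrightarrow>
       (\<lambda>n. integral {x..x + h n} (rep_l1 g) / h n) \<longlonglongrightarrow> rep_l1 g x"
    using lebesgue_point_right[OF int] by blast
  obtain N' where N': "negligible N'" "\<And>x h. x \<notin> N' \<Longrightarrow> h \<longlonglongrightarrow> 0 \<Longrightarrow> (\<And>n. h n > 0) \<Longrightarrow>
       (\<lambda>n. integral {x..x + h n} (rep_l1 g') / h n) \<longlonglongrightarrow> rep_l1 g' x"
    using lebesgue_point_right[OF int] by blast
  have in_int: "rep_l1 g x = rep_l1 g' x" if x: "x \<in> {0<..<L}" "x \<notin> N" "x \<notin> N'" for x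
  proof -
    \<comment> \<open>The steps stay within \<open>L - x\<close>, since the integrals are known to
      agree only on subintervals of \<open>[0, L]\<close>.\<close>
    define h where "h = (\<lambda>n. (L - x) * inverse (real (Suc n)))"
    have "h \<longlonglongrightarrow> (L - x) * 0"
      unfolding h_def by (intro tendsto_mult tendsto_const LIMSEQ_inverse_real_of_nat)
    then have h: "h \<longlonglongrightarrow> 0" "\<And>n. h n > 0" using x by (simp_all add: h_def)
    have "h n \<le> (L - x) * 1" for n
      unfolding h_def using x by (intro mult_left_mono) (auto simp: field_simps)
    then have "x + h n \<le> L" for n by (simp add: algebra_simps)
    then have "integral {x..x + h n} (rep_l1 g) = integral {x..x + h n} (rep_l1 g')" for n
      using x h(2)[of n] by (intro eq2) auto
    then show ?thesis
      using N(2)[OF x(2) h] N'(2)[OF x(3) h] LIMSEQ_unique by simp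
  qed
  have "AE x in lebesgue. x \<notin> {0<..<L} \<longrightarrow> rep_l1 g x = 0" "AE x in lebesgue. x \<notin> {0<..<L} \<longrightarrow> rep_l1 g' x = 0"
    using wd by (auto simp: has_weak_deriv_def L1_space_def)
  with AE_not_in_negligible[OF N(1)] AE_not_in_negligible[OF N'(1)]
  have "AE x in lebesgue. rep_l1 g x = rep_l1 g' x"
    by eventually_elim (auto simp: in_int simp del: greaterThanLessThan_iff)
  then show ?thesis by (simp add: l1_eq_iff)
qed

lemma has_weak_deriv_weak_deriv:
  assumes "0 < L" "p \<in> W11_space L"
  shows "has_weak_deriv L p (weak_deriv L p)"
proof -
  obtain g where g: "has_weak_deriv L p g" using assms(2) by (auto simp: W11_space_def)
  have "weak_deriv L p = g"
    unfolding weak_deriv_def using g has_weak_deriv_unique[OF assms(1)] by blast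
  with g show ?thesis by simp
qed

lemma W11_representation:
  assumes "0 < L" "p \<in> W11_space L"
  shows "AE x in lebesgue. x \<in> {0<..<L} \<longrightarrow>
    rep_l1 p x = value_at_0 L p + integral {0..x} (rep_l1 (weak_deriv L p))"
proof -
  obtain c where c: "AE x in lebesgue. x \<in> {0<..<L} \<longrightarrow>
      rep_l1 p x = c + integral {0..x} (rep_l1 (weak_deriv L p))"
    using weak_deriv_representation[OF assms(1) has_weak_deriv_weak_deriv[OF assms]] by blast
  show ?thesis using c unfolding value_at_0_eq[OF assms(1) c] .
qed

section \<open>Transport along characteristics\<close>

lemma integral_cong_AE_interval:
  fixes f g :: "real \<Rightarrow> real"
  assumes "AE x in lebesgue. x \<in> {a<..<b} \<longrightarrow> f x = g x" "a \<le> c" "d \<le> b"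
  shows "integral {c..d} f = integral {c..d} g"
proof -
  obtain N where N: "N \<in> null_sets lebesgue" "{x. \<not> (x \<in> {a<..<b} \<longrightarrow> f x = g x)} \<subseteq> N"
    using assms(1) by (auto simp: eventually_ae_filter)
  have "negligible (N \<union> {a, b})" using N(1) by (simp add: negligible_iff_null_sets[symmetric])
  moreover have "g x = f x" if "x \<in> {c..d} - (N \<union> {a, b})" for x
  proof -
    have "x \<in> {a<..<b}" using that assms(2,3) by auto
    then show ?thesis using that N(2) by force
  qed
  ultimately show ?thesis by (rule integral_spike)
qed

lemma set_integral_open_eq_integral:
  fixes f :: "real \<Rightarrow> real"
  assumes "set_integrable lebesgue {a<..<b} f"
  shows "f absolutely_integrable_on {a..b}" "(LINT x:{a<..<b}|lebesgue. f x) = integral {a..b} f"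
proof -
  have "negligible (sym_diff {a<..<b} {a..b})"
    by (rule negligible_subset[of "{a, b}"]) auto
  then show "f absolutely_integrable_on {a..b}"
    using absolutely_integrable_spike_set[OF assms, of "{a..b}"]
    by (metis (no_types, lifting) Un_subset_iff mem_Collect_eq negligible_subset subsetI)
  show "(LINT x:{a<..<b}|lebesgue. f x) = integral {a..b} f"
    using set_lebesgue_integral_eq_integral(2)[OF assms] integral_open_interval_real by metis
qed

lemma L1_class_integrable:
  "set_integrable lebesgue {0<..<L} h \<Longrightarrow> integrable lebesgue (\<lambda>x. if x \<in> {0<..<L} then h x else 0)"
proof -
  assume "set_integrable lebesgue {0<..<L} h"
  moreover have "(\<lambda>x. indicat_real {0<..<L} x *\<^sub>R h x) = (\<lambda>x. if x \<in> {0<..<L} then h x else 0)"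
    by (auto simp: indicator_def)
  ultimately show ?thesis by (simp add: set_integrable_def)
qed

lemma rep_L1_class:
  assumes "set_integrable lebesgue {0<..<L} f"
  shows "AE x in lebesgue. x \<in> {0<..<L} \<longrightarrow> rep_l1 (L1_class L f) x = f x"
proof -
  from rep_abs_l1[OF L1_class_integrable[OF assms]] show ?thesis unfolding L1_class_def by eventually_elim simp
qed

text \<open>For passing to the full age interval: rates are assumed integrable only on
  \<open>[0, l]\<close> with \<open>l < L\<close>, so bounds are proved there and extended to
  \<open>L\<close> by continuity.\<close>

lemma le_at_endpoint:
  fixes F :: "real \<Rightarrow> real"
  assumes "a < b" "continuous_on {a..b} F" "\<And>x. a < x \<Longrightarrow> x < b \<Longrightarrow> \<bar>F x\<bar> \<le> B"
  shows "\<bar>F b\<bar> \<le> B"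
proof -
  have "(F \<longlongrightarrow> F b) (at b within {a..b})" using assms(1,2) by (auto simp: continuous_on_def)
  then have "(F \<longlongrightarrow> F b) (at_left b)" using assms(1) by (simp add: at_within_Icc_at_left)
  then have "((\<lambda>x. \<bar>F x\<bar>) \<longlongrightarrow> \<bar>F b\<bar>) (at_left b)" by (rule tendsto_rabs)
  moreover have "\<forall>\<^sub>F x in at_left b. \<bar>F x\<bar> \<le> B"
    using assms(1,3) by (auto simp: eventually_at_left_field)
  ultimately show ?thesis by (intro tendsto_upperbound) auto
qed

text \<open>One age-dependent component of a smooth orbit. Besides \<open>mu\<close> there is a
  constant rate \<open>k\<close> of leaving the component, \<open>lam2\<close> for the first
  component and 0 for the second. \<open>b\<close> is the boundary value at age 0. Continuity of
  \<open>u'\<close> in \<open>l1\<close> is what will make point values jointly continuous.\<close>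

locale age_flow =
  fixes L k :: real and mu :: "real \<Rightarrow> real" and u u' :: "real \<Rightarrow> l1" and b :: "real \<Rightarrow> real"
  assumes L: "0 < L" and k: "0 \<le> k"
    and mu_nonneg: "\<And>x. x \<in> {0..L} \<Longrightarrow> 0 \<le> mu x"
    and mu_int: "\<And>l. 0 < l \<Longrightarrow> l < L \<Longrightarrow> mu absolutely_integrable_on {0..l}"
    and u_W11: "\<And>t. 0 \<le> t \<Longrightarrow> u t \<in> W11_space L"
    and mu_u: "\<And>t. 0 \<le> t \<Longrightarrow> set_integrable lebesgue {0<..<L} (\<lambda>x. mu x * rep_l1 (u t) x)"
    and u_deriv: "\<And>t. 0 \<le> t \<Longrightarrow> (u has_vector_derivative u' t) (at t within {0..})"
    and u'_eq: "\<And>t. 0 \<le> t \<Longrightarrow>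
        u' t = - weak_deriv L (u t) - L1_class L (\<lambda>x. (mu x + k) * rep_l1 (u t) x)"
    and u'_cont: "continuous_on {0..} u'"
    and b_cont: "continuous_on {0..} b"
    and u_0: "\<And>t. 0 \<le> t \<Longrightarrow> value_at_0 L (u t) = b t"
begin

definition M :: "real \<Rightarrow> real" where "M x = integral {0..x} (\<lambda>y. mu y + k)"

definition g :: "real \<Rightarrow> real \<Rightarrow> real" where "g t = rep_l1 (weak_deriv L (u t))"

text \<open>The absolutely continuous representative of \<open>u t\<close>.\<close>

definition f :: "real \<Rightarrow> real \<Rightarrow> real" where "f t x = b t + integral {0..x} (g t)"

text \<open>The antiderivative in \<open>x\<close> of \<open>exp M * p\<close>, written as an
  integral over the line with a weight. For \<open>0 \<le> x < L\<close> the weight is bounded, so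
  this is a continuous functional on \<open>l1\<close>, which evaluation at a point is not.\<close>

definition \<Phi> :: "real \<Rightarrow> l1 \<Rightarrow> real" where
  "\<Phi> x p = (\<integral>y. (indicator {0..x} y * exp (M y)) * rep_l1 p y \<partial>lebesgue)"

lemma rate_int: "0 \<le> l \<Longrightarrow> l < L \<Longrightarrow> (\<lambda>y. mu y + k) absolutely_integrable_on {0..l}"
proof -
  assume l: "0 \<le> l" "l < L"
  define l' where "l' = (l + L) / 2"
  have "(\<lambda>y. mu y + k) absolutely_integrable_on {0..l'}"
    using l L by (intro set_integral_add(1) mu_int) (auto simp: l'_def)
  then show ?thesis using l by (auto simp: l'_def intro: absolutely_integrable_subinterval(1))
qed

lemma M_cont: "0 \<le> l \<Longrightarrow> l < L \<Longrightarrow> continuous_on {0..l} M"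
  unfolding M_def[abs_def] by (intro continuous_on_indefinite_integral rate_int)

lemma M_0 [simp]: "M 0 = 0"
  by (simp add: M_def)

lemma M_nonneg: "0 \<le> x \<Longrightarrow> x < L \<Longrightarrow> 0 \<le> M x"
  unfolding M_def by (intro integral_nonneg)
    (use rate_int[of x] mu_nonneg k in \<open>auto simp: absolutely_integrable_on_def intro!: add_nonneg_nonneg\<close>)

lemma g_int: "g t absolutely_integrable_on {a..c}"
  unfolding g_def by (rule absolutely_integrable_rep_l1)

lemma f_cont: "continuous_on {0..l} (f t)"
  unfolding f_def[abs_def] by (intro continuous_intros continuous_on_indefinite_integral g_int)

lemma rep_u: "0 \<le> t \<Longrightarrow> AE x in lebesgue. x \<in> {0<..<L} \<longrightarrow> rep_l1 (u t) x = f t x"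
  using W11_representation[OF L u_W11] u_0 by (simp add: f_def g_def)

lemma rate_u: "0 \<le> t \<Longrightarrow> set_integrable lebesgue {0<..<L} (\<lambda>x. (mu x + k) * rep_l1 (u t) x)"
proof -
  assume "0 \<le> t"
  have "set_integrable lebesgue {0<..<L} (\<lambda>x. k * rep_l1 (u t) x)"
    using integrable_mult_indicator[of "{0<..<L}" lebesgue "\<lambda>x. k * rep_l1 (u t) x"] integrable_rep_l1[of "u t"]
    by (simp add: set_integrable_def)
  from set_integral_add(1)[OF mu_u[OF \<open>0 \<le> t\<close>] this] show ?thesis
    by (simp only: distrib_right)
qed

lemma rep_u': "0 \<le> t \<Longrightarrow> AE x in lebesgue. x \<in> {0<..<L} \<longrightarrow>
    rep_l1 (u' t) x = - (g t x + (mu x + k) * f t x)"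
proof -
  assume t: "0 \<le> t"
  let ?c = "L1_class L (\<lambda>x. (mu x + k) * rep_l1 (u t) x)"
  have "AE x in lebesgue. rep_l1 (u' t) x = rep_l1 (- weak_deriv L (u t)) x - rep_l1 ?c x"
    unfolding u'_eq[OF t] by (rule rep_minus_l1)
  then show ?thesis
    using rep_uminus_l1[of "weak_deriv L (u t)"] rep_L1_class[OF rate_u[OF t]] rep_u[OF t]
    by eventually_elim (simp add: g_def)
qed

text \<open>\<open>exp M\<close> is bounded on \<open>[0, l]\<close>, though possibly not on
  \<open>[0, L)\<close>. The constant is the same for all \<open>x\<close> in \<open>[0, l]\<close>,
  as joint continuity requires.\<close>

lemma \<Phi>:
  assumes l: "0 \<le> l" "l < L"
  obtains K where "\<And>x p. x \<in> {0..l} \<Longrightarrow> \<bar>\<Phi> x p\<bar> \<le> K * norm p"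
    "\<And>x. x \<in> {0..l} \<Longrightarrow> bounded_linear (\<Phi> x)"
    "\<And>x p. x \<in> {0..l} \<Longrightarrow> \<Phi> x p = integral {0..x} (\<lambda>y. exp (M y) * rep_l1 p y)"
proof -
  have "compact ((\<lambda>y. exp (M y)) ` {0..l})"
    using M_cont[OF l] by (intro compact_continuous_image continuous_intros) auto
  then obtain K where K: "\<And>y. y \<in> {0..l} \<Longrightarrow> \<bar>exp (M y)\<bar> \<le> K"
    using compact_imp_bounded bounded_real by (metis imageI)
  have bd: "\<bar>indicator {0..x} y * exp (M y)\<bar> \<le> K" if "x \<in> {0..l}" for x y
    using K[of y] K[of 0] that by (auto simp: indicator_def)
  have meas: "(\<lambda>y. indicat_real {0..x} y * exp (M y)) \<in> borel_measurable lebesgue" if "x \<in> {0..l}" for x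
  proof -
    have "continuous_on {0..x} (\<lambda>y. exp (M y))"
      using continuous_on_subset[OF M_cont[OF l]] that by (intro continuous_intros) auto
    then have "set_borel_measurable lebesgue {0..x} (\<lambda>y. exp (M y))"
      unfolding set_borel_measurable_def
      by (intro measurable_completion) (use borel_measurable_continuous_on_indicator[of "{0..x}" "\<lambda>y. exp (M y)"] in simp)
    then show ?thesis by (simp add: set_borel_measurable_def)
  qed
  show ?thesis
  proof (rule that)
    fix x p assume x: "x \<in> {0..l}"
    note w = bounded_linear_weighted_integral[OF meas[OF x] bd[OF x]]
    show "\<bar>\<Phi> x p\<bar> \<le> K * norm p" "bounded_linear (\<Phi> x)"
      unfolding \<Phi>_def[abs_def] using w(1,3) by auto
    have "\<Phi> x p = (LINT y:{0..x}|lebesgue. exp (M y) * rep_l1 p y)"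
      by (simp add: \<Phi>_def set_lebesgue_integral_def mult.assoc)
    also have "\<dots> = integral {0..x} (\<lambda>y. exp (M y) * rep_l1 p y)"
      using w(2)[of p] by (intro set_lebesgue_integral_eq_integral) (simp add: set_integrable_def mult.assoc)
    finally show "\<Phi> x p = integral {0..x} (\<lambda>y. exp (M y) * rep_l1 p y)" .
  qed
qed

lemma \<Phi>_eq: "0 \<le> x \<Longrightarrow> x < L \<Longrightarrow> \<Phi> x p = integral {0..x} (\<lambda>y. exp (M y) * rep_l1 p y)"
  using \<Phi>[of x] by (metis atLeastAtMost_iff order_refl)

text \<open>By the integrating factor, the integrand is minus the derivative of
  \<open>exp M * f t\<close>. This is the transport equation integrated in \<open>x\<close>: for
  \<open>W t x = \<Phi> x (u t)\<close> it says that the two partial derivatives of \<open>W\<close>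
  add up to \<open>b t\<close>.\<close>

lemma \<Phi>_u': "0 \<le> t \<Longrightarrow> 0 \<le> x \<Longrightarrow> x < L \<Longrightarrow> \<Phi> x (u' t) = b t - exp (M x) * f t x"
proof -
  assume t: "0 \<le> t" and x: "0 \<le> x" "x < L"
  have "\<Phi> x (u' t) = integral {0..x} (\<lambda>y. - (exp (M y) * (g t y + (mu y + k) * f t y)))"
    unfolding \<Phi>_eq[OF x]
    by (rule integral_cong_AE_interval[of 0 L], use rep_u'[OF t] in eventually_elim) (use x in \<open>auto simp: distrib_left right_diff_distrib\<close>)
  also have "\<dots> = - (exp (M x) * f t x - b t)"
    using integral_integrating_factor[OF x(1) rate_int[OF x] g_int[where t=t], where c="b t"]
    unfolding M_def[symmetric] f_def[symmetric] by simp
  finally show ?thesis by simp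
qed

lemma \<Phi>_u: "0 \<le> t \<Longrightarrow> 0 \<le> x \<Longrightarrow> x < L \<Longrightarrow> \<Phi> x (u t) = integral {0..x} (\<lambda>y. exp (M y) * f t y)"
proof -
  assume t: "0 \<le> t" and x: "0 \<le> x" "x < L"
  show ?thesis
    unfolding \<Phi>_eq[OF x]
    by (rule integral_cong_AE_interval[of 0 L], use rep_u[OF t] in eventually_elim) (use x in auto)
qed

text \<open>A change of state is controlled by the constant \<open>K\<close>, uniform in
  \<open>x\<close>; a change of \<open>x\<close> at a fixed state by continuity of the indefinite
  integral.\<close>

lemma \<Phi>_jointly_continuous:
  assumes l: "0 \<le> l" "l < L" and v: "continuous_on {0::real..} v"
  shows "continuous_on ({0..} \<times> {0..l}) (\<lambda>(t, x). \<Phi> x (v t))"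
proof -
  obtain K where K: "\<And>x p. x \<in> {0..l} \<Longrightarrow> \<bar>\<Phi> x p\<bar> \<le> K * norm p"
    "\<And>x. x \<in> {0..l} \<Longrightarrow> bounded_linear (\<Phi> x)"
    "\<And>x p. x \<in> {0..l} \<Longrightarrow> \<Phi> x p = integral {0..x} (\<lambda>y. exp (M y) * rep_l1 p y)"
    using \<Phi>[OF l] by blast
  let ?S = "{0::real..} \<times> {0..l}"
  have "((\<lambda>z. \<Phi> (snd z) (v (fst z))) \<longlongrightarrow> \<Phi> (snd z0) (v (fst z0))) (at z0 within ?S)"
    if z0: "z0 \<in> ?S" for z0
  proof -
    define J where "J = (\<lambda>x. \<Phi> x (v (fst z0)))"
    have "continuous_on {0..l} (\<lambda>x. integral {0..x} (\<lambda>y. exp (M y) * rep_l1 (v (fst z0)) y))"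
      using M_cont[OF l]
      by (intro continuous_on_indefinite_integral absolutely_integrable_mult_continuous
          absolutely_integrable_rep_l1 continuous_intros)
    then have J: "continuous_on {0..l} J"
      by (rule continuous_on_eq) (simp add: J_def K(3))
    have "continuous_on ?S (\<lambda>z. v (fst z))"
      by (rule continuous_on_compose2[OF v continuous_on_fst[OF continuous_on_id]]) auto
    then have "((\<lambda>z. v (fst z)) \<longlongrightarrow> v (fst z0)) (at z0 within ?S)"
      using z0 unfolding continuous_on_def by blast
    moreover have "continuous_on ?S (\<lambda>z. J (snd z))"
      by (rule continuous_on_compose2[OF J continuous_on_snd[OF continuous_on_id]]) auto
    then have "((\<lambda>z. J (snd z)) \<longlongrightarrow> J (snd z0)) (at z0 within ?S)"
      using z0 unfolding continuous_on_def by blast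
    ultimately have "((\<lambda>z. K * norm (v (fst z) - v (fst z0)) + \<bar>J (snd z) - J (snd z0)\<bar>) \<longlongrightarrow>
        K * norm (v (fst z0) - v (fst z0)) + \<bar>J (snd z0) - J (snd z0)\<bar>) (at z0 within ?S)"
      by (intro tendsto_intros)
    then have lim: "((\<lambda>z. K * norm (v (fst z) - v (fst z0)) + \<bar>J (snd z) - J (snd z0)\<bar>) \<longlongrightarrow> 0) (at z0 within ?S)"
      by simp
    have "\<forall>\<^sub>F z in at z0 within ?S. norm (\<Phi> (snd z) (v (fst z)) - \<Phi> (snd z0) (v (fst z0))) \<le>
        K * norm (v (fst z) - v (fst z0)) + \<bar>J (snd z) - J (snd z0)\<bar>"
      unfolding eventually_at_filter
    proof (intro always_eventually allI impI)
      fix z assume "z \<in> ?S"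
      then have z: "snd z \<in> {0..l}" by auto
      have "\<Phi> (snd z) (v (fst z)) - \<Phi> (snd z0) (v (fst z0)) =
          \<Phi> (snd z) (v (fst z) - v (fst z0)) + (J (snd z) - J (snd z0))"
        using linear_diff[OF bounded_linear.linear[OF K(2)[OF z]]] by (simp add: J_def)
      then show "norm (\<Phi> (snd z) (v (fst z)) - \<Phi> (snd z0) (v (fst z0))) \<le>
          K * norm (v (fst z) - v (fst z0)) + \<bar>J (snd z) - J (snd z0)\<bar>"
        using K(1)[OF z, of "v (fst z) - v (fst z0)"] by simp
    qed
    from Lim_null_comparison[OF this lim] show ?thesis using Lim_null by blast
  qed
  then show ?thesis by (auto simp: continuous_on_def case_prod_unfold)
qed

text \<open>Continuity of \<open>u\<close> in \<open>l1\<close> says nothing about point values.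
  They equal \<open>b t - \<Phi> x (u' t)\<close>, and here \<open>b\<close> and \<open>u'\<close>
  are continuous.\<close>

lemma e_jointly_continuous:
  assumes l: "0 \<le> l" "l < L"
  shows "continuous_on ({0..} \<times> {0..l}) (\<lambda>(t, x). exp (M x) * f t x)"
proof -
  have "continuous_on ({0..} \<times> {0..l}) (\<lambda>(t, x). b t - \<Phi> x (u' t))"
    using continuous_on_compose2[OF b_cont continuous_on_fst[OF continuous_on_id], of "{0..} \<times> {0..l}"]
      \<Phi>_jointly_continuous[OF l u'_cont]
    by (auto simp: case_prod_unfold intro!: continuous_on_diff)
  then show ?thesis by (rule continuous_on_eq) (use l \<Phi>_u' in auto)
qed

section \<open>Differentiation of the spatial antiderivative and its values along
  characteristics\<close>

lemma W_deriv_x: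
  assumes "0 \<le> t" and l: "0 \<le> l" "l < L" and x: "x \<in> {0..l}"
  shows "((\<lambda>x. \<Phi> x (u t)) has_real_derivative exp (M x) * f t x) (at x within {0..l})"
proof -
  have "((\<lambda>x. integral {0..x} (\<lambda>y. exp (M y) * f t y)) has_real_derivative exp (M x) * f t x) (at x within {0..l})"
    using M_cont[OF l] x by (intro integral_has_real_derivative continuous_intros f_cont)
  then show ?thesis
    by (rule has_field_derivative_transform_within[OF _ zero_less_one x]) (use assms \<Phi>_u in auto)
qed

lemma W_deriv_t:
  assumes "0 \<le> t" "0 \<le> x" "x < L"
  shows "((\<lambda>t. \<Phi> x (u t)) has_real_derivative \<Phi> x (u' t)) (at t within {0..})"
proof -
  have "bounded_linear (\<Phi> x)" using \<Phi>[OF assms(2,3)] assms by (metis atLeastAtMost_iff order_refl)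
  from bounded_linear.has_vector_derivative[OF this u_deriv[OF assms(1)]] show ?thesis
    by (simp add: has_real_derivative_iff_has_vector_derivative)
qed

text \<open>\<open>exp M * f\<close> solves the free transport equation with boundary value \<open>b\<close>, so the derivative of its
  spatial antiderivative \<open>\<Phi> x (u t)\<close> along a characteristic involves the boundary value only.\<close>

lemma W_deriv_characteristic:
  assumes t: "0 \<le> t" and l: "0 \<le> l" "l < L" and s: "s \<in> {0..l}"
  shows "((\<lambda>s. \<Phi> s (u (t + s))) has_vector_derivative b (t + s)) (at s within {0..l})"
proof -
  let ?S = "{0::real..} \<times> {0..l}"
  define e where "e = (\<lambda>t x. exp (M x) * f t x)"
  have e: "continuous_on ?S (\<lambda>(t, x). e t x)"
    unfolding e_def by (rule e_jointly_continuous[OF l])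
  have "((\<lambda>(t, x). \<Phi> x (u t)) has_derivative
      (\<lambda>(ty, tx). \<Phi> s (u' (t + s)) * ty + blinfun_mult_right (e (t + s) s) tx)) (at (t + s, s) within ?S)"
  \<comment> \<open>The criterion asks for joint continuity of one partial derivative only. The
    derivative in \<open>x\<close>, \<open>exp M * f\<close>, has it; the derivative in
    \<open>t\<close> need only exist. The former is wrapped as a bounded linear map to fit the
    criterion.\<close>
  proof (rule has_derivative_partialsI[where fy="\<lambda>t x. blinfun_mult_right (e t x)"])
    show "((\<lambda>t. \<Phi> s (u t)) has_derivative (\<lambda>h. \<Phi> s (u' (t + s)) * h)) (at (t + s) within {0..})"
      using W_deriv_t[of "t + s" s] t l s by (simp add: has_field_derivative_def)
    show "((\<lambda>x. \<Phi> x (u t)) has_derivative blinfun_apply (blinfun_mult_right (e t x))) (at x within {0..l})"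
      if "t \<in> {0..}" "x \<in> {0..l}" for t x
      using W_deriv_x[of t l x] l that by (simp add: has_field_derivative_def e_def blinfun_mult_right.rep_eq)
    have "continuous_on ?S (\<lambda>z. blinfun_mult_right (e (fst z) (snd z)))"
      using e by (intro bounded_linear.continuous_on[OF bounded_linear_blinfun_mult_right]) (simp add: case_prod_unfold)
    then show "continuous (at (t + s, s) within ?S) (\<lambda>(t, x). blinfun_mult_right (e t x))"
      using t s by (simp add: case_prod_unfold continuous_on_eq_continuous_within)
  qed (use s in auto)
  then have W: "((\<lambda>(t, x). \<Phi> x (u t)) has_derivative
      (\<lambda>(ty, tx). \<Phi> s (u' (t + s)) * ty + e (t + s) s * tx)) (at (t + s, s) within ?S)"
    by (simp add: blinfun_mult_right.rep_eq)
  have path: "((\<lambda>s. (t + s, s)) has_derivative (\<lambda>h. (h, h))) (at s within {0..l})"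
    by (auto intro!: derivative_eq_intros)
  have "((\<lambda>s. (\<lambda>(t, x). \<Phi> x (u t)) (t + s, s)) has_derivative
      (\<lambda>h. (\<lambda>(ty, tx). \<Phi> s (u' (t + s)) * ty + e (t + s) s * tx) (h, h))) (at s within {0..l})"
    by (rule has_derivative_in_compose[OF path has_derivative_subset[OF W]]) (use t in auto)
  moreover have "(\<lambda>h. (\<lambda>(ty, tx). \<Phi> s (u' (t + s)) * ty + e (t + s) s * tx) (h, h)) = (\<lambda>h. h * b (t + s))"
  proof
    have "b (t + s) = \<Phi> s (u' (t + s)) + e (t + s) s"
      using \<Phi>_u'[of "t + s" s] t l s by (simp add: e_def)
    then show "(\<lambda>(ty, tx). \<Phi> s (u' (t + s)) * ty + e (t + s) s * tx) (h, h) = h * b (t + s)" for h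
      by (simp add: algebra_simps)
  qed
  ultimately have "((\<lambda>s. \<Phi> s (u (t + s))) has_derivative (\<lambda>h. h * b (t + s))) (at s within {0..l})"
    by simp
  then show ?thesis by (simp add: has_vector_derivative_def)
qed

text \<open>Integration along the characteristic from \<open>(t - x, 0)\<close> to
  \<open>(t, x)\<close>, at whose foot \<open>\<Phi> 0\<close> vanishes. The condition
  \<open>x \<le> t\<close> says that it starts on the boundary and not in the initial state.\<close>

lemma W_eq:
  assumes "0 \<le> x" "x < L" "x \<le> t"
  shows "\<Phi> x (u t) = integral {0..t} b - integral {0..t - x} b"
proof -
  have t: "0 \<le> t - x" using assms by simp
  have "((\<lambda>s. b (t - x + s)) has_integral (\<Phi> x (u (t - x + x)) - \<Phi> 0 (u (t - x + 0)))) {0..x}"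
    using assms W_deriv_characteristic[OF t] by (intro fundamental_theorem_of_calculus) auto
  moreover have "((\<lambda>s. b (t - x + s)) has_integral (integral {0..t - x + x} b - integral {0..t - x + 0} b)) {0..x}"
  proof (rule fundamental_theorem_of_calculus)
    fix s assume s: "s \<in> {0..x}"
    have "continuous_on {0..t} b" using b_cont by (rule continuous_on_subset) auto
    then have "((\<lambda>r. integral {0..r} b) has_vector_derivative b (t - x + s)) (at (t - x + s) within {0..t})"
      using t s by (intro integral_has_vector_derivative) auto
    then have "((\<lambda>r. integral {0..r} b) has_vector_derivative b (t - x + s)) (at (t - x + s) within (\<lambda>s. t - x + s) ` {0..x})"
      by (rule has_vector_derivative_within_subset) (use t in auto)
    then have "((\<lambda>r. integral {0..r} b) \<circ> (\<lambda>s. t - x + s) has_vector_derivative 1 *\<^sub>R b (t - x + s)) (at s within {0..x})"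
      by (intro vector_diff_chain_within) (auto intro!: derivative_eq_intros)
    then show "((\<lambda>s. integral {0..t - x + s} b) has_vector_derivative b (t - x + s)) (at s within {0..x})"
      by (simp add: o_def)
  qed (use assms in simp)
  ultimately have "\<Phi> x (u (t - x + x)) - \<Phi> 0 (u (t - x + 0)) = integral {0..t - x + x} b - integral {0..t - x + 0} b"
    by (rule has_integral_unique)
  moreover have "\<Phi> 0 p = 0" for p using \<Phi>_eq[of 0 p] L by simp
  ultimately show ?thesis by simp
qed

text \<open>Both sides of \<open>W_eq\<close> are differentiated in \<open>x\<close>. For
  \<open>t \<ge> L\<close> every characteristic that arrives at an age below \<open>L\<close> starts
  on the boundary, so the initial state no longer appears.\<close>

lemma f_eq:
  assumes "L \<le> t" "0 < x" "x < L"
  shows "f t x = b (t - x) * exp (- M x)"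
proof -
  \<comment> \<open>Halfway between \<open>x\<close> and \<open>L\<close>, so that \<open>x\<close>
    is interior to \<open>[0, l]\<close> and the derivative within \<open>[0, l]\<close> is a full
    one.\<close>
  define l where "l = (x + L) / 2"
  have l: "0 \<le> l" "x < l" "l < L" using assms by (auto simp: l_def)
  have "((\<lambda>x. \<Phi> x (u t)) has_real_derivative exp (M x) * f t x) (at x within {0..l})"
    using W_deriv_x[of t l x] assms l by simp
  moreover have "at x within {0..l} = at x" using assms l by (intro at_within_interior) auto
  ultimately have 1: "((\<lambda>x. \<Phi> x (u t)) has_real_derivative exp (M x) * f t x) (at x)" by simp
  have "continuous_on {0..t} b" using b_cont by (rule continuous_on_subset) auto
  then have "((\<lambda>r. integral {0..r} b) has_real_derivative b (t - x)) (at (t - x) within {0..t})"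
    using assms by (intro integral_has_real_derivative) auto
  moreover have "at (t - x) within {0..t} = at (t - x)" using assms by (intro at_within_interior) auto
  ultimately have "((\<lambda>r. integral {0..r} b) has_real_derivative b (t - x)) (at (t - x))" by simp
  then have "((\<lambda>x. integral {0..t - x} b) has_real_derivative b (t - x) * (- 1)) (at x)"
    by (rule DERIV_chain2) (auto intro!: derivative_eq_intros)
  then have "((\<lambda>x. integral {0..t} b - integral {0..t - x} b) has_real_derivative 0 - b (t - x) * (- 1)) (at x)"
    by (intro DERIV_diff DERIV_const)
  then have "((\<lambda>x. \<Phi> x (u t)) has_real_derivative 0 - b (t - x) * (- 1)) (at x)"
    by (rule has_field_derivative_transform_within_open[of _ _ _ "{0<..<L}"])
       (use assms W_eq in auto)
  with 1 have "exp (M x) * f t x = b (t - x)" using DERIV_unique by fastforce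
  then show ?thesis by (simp add: exp_minus field_simps)
qed

section \<open>Bounds after time \<open>L\<close> in terms of the boundary value\<close>

lemma rep_u_eq:
  assumes "L \<le> t"
  shows "AE x in lebesgue. x \<in> {0<..<L} \<longrightarrow> rep_l1 (u t) x = b (t - x) * exp (- M x)"
proof -
  have "AE x in lebesgue. x \<in> {0<..<L} \<longrightarrow> rep_l1 (u t) x = f t x"
    using rep_u[of t] assms L by simp
  then show ?thesis by eventually_elim (simp add: f_eq[OF assms])
qed

text \<open>The profile is at most \<open>B * exp (- M)\<close> in modulus, and
  \<open>exp (- M) * (mu + k)\<close> is the derivative of \<open>- exp (- M)\<close>, with integral
  \<open>1 - exp (- M l) \<le> 1\<close>. The weight \<open>r\<close> stands for the repair rate
  alone or for the full loss rate.\<close>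

lemma integral_rate_u_bound:
  assumes t: "L \<le> t" and B: "\<And>s. 0 \<le> s \<Longrightarrow> s \<le> t \<Longrightarrow> \<bar>b s\<bar> \<le> B" and l: "0 \<le> l" "l < L"
    and r: "r absolutely_integrable_on {0..l}" "\<And>x. x \<in> {0..l} \<Longrightarrow> \<bar>r x\<bar> \<le> mu x + k"
  shows "\<bar>integral {0..l} (\<lambda>x. r x * rep_l1 (u t) x)\<bar> \<le> B"
proof -
  have "0 \<le> B" using B[of 0] t L abs_ge_zero[of "b 0"] by linarith
  have cont: "continuous_on {0..l} (\<lambda>x. exp (- M x))" using M_cont[OF l] by (intro continuous_intros)
  have cb: "continuous_on {0..l} (\<lambda>x. b (t - x) * exp (- M x))"
    by (intro continuous_on_mult cont continuous_on_compose2[OF b_cont, of _ "\<lambda>x. t - x"] continuous_intros)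
       (use t l in auto)
  have int1: "(\<lambda>x. exp (- M x) * (mu x + k)) absolutely_integrable_on {0..l}"
    by (rule absolutely_integrable_mult_continuous[OF rate_int[OF l] cont])
  have int2: "(\<lambda>x. b (t - x) * exp (- M x) * r x) absolutely_integrable_on {0..l}"
    by (rule absolutely_integrable_mult_continuous[OF r(1) cb])
  have "integral {0..l} (\<lambda>x. r x * rep_l1 (u t) x) = integral {0..l} (\<lambda>x. b (t - x) * exp (- M x) * r x)"
    by (rule integral_cong_AE_interval[of 0 L], use rep_u_eq[OF t] in eventually_elim) (use l in auto)
  also have "norm \<dots> \<le> integral {0..l} (\<lambda>x. B * (exp (- M x) * (mu x + k)))"
  proof (rule integral_norm_bound_integral)
    show "(\<lambda>x. b (t - x) * exp (- M x) * r x) integrable_on {0..l}"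
      using int2 absolutely_integrable_on_def by blast
    show "(\<lambda>x. B * (exp (- M x) * (mu x + k))) integrable_on {0..l}"
      using int1 absolutely_integrable_on_def integrable_on_mult_right by blast
    fix x assume x: "x \<in> {0..l}"
    have "\<bar>b (t - x)\<bar> * (exp (- M x) * \<bar>r x\<bar>) \<le> B * (exp (- M x) * (mu x + k))"
      using B[of "t - x"] r(2)[OF x] x l t \<open>0 \<le> B\<close> by (intro mult_mono) auto
    then show "norm (b (t - x) * exp (- M x) * r x) \<le> B * (exp (- M x) * (mu x + k))"
      by (simp add: abs_mult mult.assoc)
  qed
  also have "\<dots> = B * (1 - exp (- M l))"
  proof -
    \<comment> \<open>The chain rule is used for the negated rate, whose indefinite integral is
      \<open>- M\<close>.\<close>
    have "(\<lambda>x. - (mu x + k)) absolutely_integrable_on {0..l}"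
      using absolutely_integrable_mult_continuous[OF rate_int[OF l], of "\<lambda>_. - 1"]
      by (simp only: mult_minus_left mult_1 continuous_on_const)
    from indefinite_integral_exp[OF l(1) this]
    have "integral {0..l} (\<lambda>x. exp (- M x) * - (mu x + k)) = exp (- M l) - 1"
      by (simp only: integral_neg M_def)
    then show ?thesis by (simp only: mult_minus_right integral_neg integral_mult_right) simp
  qed
  also have "\<dots> \<le> B * 1" using \<open>0 \<le> B\<close> by (intro mult_left_mono) auto
  finally show ?thesis by simp
qed

lemma LINT_bound_if_integral_bound:
  fixes q :: "real \<Rightarrow> real"
  assumes q: "set_integrable lebesgue {0<..<L} q"
    and B: "\<And>l. 0 < l \<Longrightarrow> l < L \<Longrightarrow> \<bar>integral {0..l} q\<bar> \<le> B"
  shows "\<bar>LINT x:{0<..<L}|lebesgue. q x\<bar> \<le> B"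
  unfolding set_integral_open_eq_integral(2)[OF q]
  by (rule le_at_endpoint[OF L continuous_on_indefinite_integral[OF set_integral_open_eq_integral(1)[OF q]] B])

lemma LINT_mu_u_bound:
  assumes t: "L \<le> t" and B: "\<And>s. 0 \<le> s \<Longrightarrow> s \<le> t \<Longrightarrow> \<bar>b s\<bar> \<le> B"
  shows "\<bar>LINT x:{0<..<L}|lebesgue. mu x * rep_l1 (u t) x\<bar> \<le> B"
  using t L k mu_nonneg
  by (intro LINT_bound_if_integral_bound mu_u integral_rate_u_bound[OF t B] mu_int) auto

text \<open>Integrating the equation over \<open>[0, l]\<close> leaves the outflow
  \<open>f t l\<close>, the inflow \<open>b t\<close> and the total loss. Each is at most
  \<open>B\<close> in modulus, whence the factor 3.\<close>

lemma LINT_u'_bound: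
  assumes t: "L \<le> t" and B: "\<And>s. 0 \<le> s \<Longrightarrow> s \<le> t \<Longrightarrow> \<bar>b s\<bar> \<le> B"
  shows "\<bar>LINT x:{0<..<L}|lebesgue. rep_l1 (u' t) x\<bar> \<le> 3 * B"
proof (rule LINT_bound_if_integral_bound)
  show "set_integrable lebesgue {0<..<L} (rep_l1 (u' t))"
    using integrable_mult_indicator[of "{0<..<L}" lebesgue "rep_l1 (u' t)"] integrable_rep_l1[of "u' t"]
    by (simp add: set_integrable_def)
  fix l assume l: "0 < l" "l < L"
  have t0: "0 \<le> t" using t L by simp
  have int: "(\<lambda>x. (mu x + k) * rep_l1 (u t) x) absolutely_integrable_on {0..l}"
    using l by (intro absolutely_integrable_subinterval(1)[OF set_integral_open_eq_integral(1)[OF rate_u[OF t0]]]) auto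
  have ints: "g t integrable_on {0..l}" "(\<lambda>x. (mu x + k) * rep_l1 (u t) x) integrable_on {0..l}"
    using int g_int absolutely_integrable_on_def by blast+
  have "AE x in lebesgue. x \<in> {0<..<L} \<longrightarrow> rep_l1 (u' t) x = - (g t x + (mu x + k) * rep_l1 (u t) x)"
    using rep_u'[OF t0] rep_u[OF t0] by eventually_elim simp
  then have "integral {0..l} (rep_l1 (u' t)) = integral {0..l} (\<lambda>x. - (g t x + (mu x + k) * rep_l1 (u t) x))"
    using l by (intro integral_cong_AE_interval[of 0 L]) auto
  also have "\<dots> = - (integral {0..l} (g t) + integral {0..l} (\<lambda>x. (mu x + k) * rep_l1 (u t) x))"
    using Henstock_Kurzweil_Integration.integral_add[OF ints] by (simp only: integral_neg)
  also have "integral {0..l} (g t) = f t l - b t" by (simp add: f_def)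
  finally have eq: "integral {0..l} (rep_l1 (u' t)) =
      - (f t l - b t + integral {0..l} (\<lambda>x. (mu x + k) * rep_l1 (u t) x))" .
  have "\<bar>b (t - l)\<bar> * exp (- M l) \<le> B * 1"
    using B[of "t - l"] B[of 0] t l t0 M_nonneg[of l] by (intro mult_mono) (auto intro: order_trans[OF abs_ge_zero])
  then have "\<bar>f t l\<bar> \<le> B" using f_eq[OF t l] by (simp add: abs_mult)
  moreover have "\<bar>b t\<bar> \<le> B" using B[of t] t0 by simp
  moreover have "\<bar>integral {0..l} (\<lambda>x. (mu x + k) * rep_l1 (u t) x)\<bar> \<le> B"
    using l k mu_nonneg by (intro integral_rate_u_bound[OF t B] rate_int) auto
  ultimately show "\<bar>integral {0..l} (rep_l1 (u' t))\<bar> \<le> 3 * B" unfolding eq by linarith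
qed

end

section \<open>Smooth orbits of \<open>C\<^sub>0\<close>-semigroups\<close>

text \<open>Banach-Steinhaus for sequences, by Baire: the closed sets \<open>F k\<close>, on which
  all \<open>A n\<close> are bounded by \<open>k\<close>, cover the space, so one of them contains a
  ball.\<close>

lemma uniform_boundedness:
  fixes A :: "nat \<Rightarrow> 'a::banach \<Rightarrow> 'b::real_normed_vector"
  assumes lin: "\<And>n. bounded_linear (A n)" and pw: "\<And>x. \<exists>C. \<forall>n. norm (A n x) \<le> C"
  obtains K where "\<And>n x. norm (A n x) \<le> K * norm x"
proof -
  define F where "F = (\<lambda>k::nat. {x. \<forall>n. norm (A n x) \<le> real k})"
  have closed: "closed (F k)" for k
  proof -
    have "F k = (\<Inter>n. {x. norm (A n x) \<le> real k})" by (auto simp: F_def)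
    moreover have "closed {x. norm (A n x) \<le> real k}" for n
      using lin by (intro closed_Collect_le continuous_intros linear_continuous_on) auto
    ultimately show ?thesis by auto
  qed
  have cover: "(\<Union>k. F k) = UNIV"
  proof -
    have "\<exists>k. x \<in> F k" for x
    proof -
      obtain C where C: "\<And>n. norm (A n x) \<le> C" using pw by blast
      obtain k :: nat where "C \<le> k" using real_arch_simple by blast
      then have "x \<in> F k" using C order_trans unfolding F_def by blast
      then show ?thesis by blast
    qed
    then show ?thesis by auto
  qed
  have "\<exists>k. interior (F k) \<noteq> {}"
  proof (rule ccontr)
    assume "\<not> ?thesis"
    then have "(euclidean :: 'a topology) interior_of \<Union>(range F) = {}"
      using closed by (intro Baire_category_alt) (auto simp: completely_metrizable_space_euclidean)
    then show False using cover by simp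
  qed
  then obtain k x0 where "x0 \<in> interior (F k)" by blast
  then obtain r where r: "r > 0" "ball x0 r \<subseteq> F k" by (auto simp: mem_interior)
  \<comment> \<open>Rescaling \<open>x\<close> to norm \<open>r / 2\<close> keeps
    \<open>x0 + y\<close> in the ball. \<open>A n y\<close> is then a difference of two values
    bounded by \<open>k\<close>, and undoing the scaling gives
    \<open>2 * k * (2 / r)\<close>.\<close>
  have "norm (A n x) \<le> (4 * k / r) * norm x" for n x
  proof (cases "x = 0")
    case True
    then show ?thesis using linear_0[OF bounded_linear.linear[OF lin]] by simp
  next
    case False
    define y where "y = (r / (2 * norm x)) *\<^sub>R x"
    have "norm y = r / 2" using False r by (simp add: y_def)
    then have "x0 + y \<in> F k" "x0 \<in> F k" using r by (auto simp: subset_iff dist_norm)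
    then have "norm (A n (x0 + y)) \<le> k" "norm (A n x0) \<le> k" by (auto simp: F_def)
    moreover have "A n y = A n (x0 + y) - A n x0"
      using linear_add[OF bounded_linear.linear[OF lin]] by simp
    ultimately have "norm (A n y) \<le> 2 * k"
      using norm_triangle_ineq4[of "A n (x0 + y)" "A n x0"] by simp
    moreover have "A n y = (r / (2 * norm x)) *\<^sub>R A n x"
      unfolding y_def by (rule linear_cmul[OF bounded_linear.linear[OF lin]])
    ultimately have "r / (2 * norm x) * norm (A n x) \<le> 2 * k" using r by simp
    then show ?thesis using False r by (simp add: field_simps)
  qed
  then show ?thesis by (rule that)
qed

text \<open>The retraction \<open>P\<close> turns operators on the subspace \<open>X\<close> into operators on the whole type, to
  which the library results on bounded linear maps apply.\<close>

locale C0_semigroup_retract =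
  fixes X :: "'a::banach set" and P :: "'a \<Rightarrow> 'a" and T :: "real \<Rightarrow> 'a \<Rightarrow> 'a"
  assumes P: "bounded_linear P" and P_in: "\<And>x. P x \<in> X" and P_fix: "\<And>x. x \<in> X \<Longrightarrow> P x = x"
    and C0: "C0_semigroup_on X T"
begin

lemma X_closed [simp]: "x \<in> X \<Longrightarrow> y \<in> X \<Longrightarrow> x + y \<in> X" "x \<in> X \<Longrightarrow> y \<in> X \<Longrightarrow> x - y \<in> X"
  "x \<in> X \<Longrightarrow> c *\<^sub>R x \<in> X"
proof -
  interpret P: bounded_linear P by (rule P)
  show "x \<in> X \<Longrightarrow> y \<in> X \<Longrightarrow> x + y \<in> X" using P.add P_fix P_in by metis
  show "x \<in> X \<Longrightarrow> y \<in> X \<Longrightarrow> x - y \<in> X" using P.diff P_fix P_in by metis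
  show "x \<in> X \<Longrightarrow> c *\<^sub>R x \<in> X" using P.scaleR P_fix P_in by metis
qed

lemma T_bounded: "0 \<le> t \<Longrightarrow> bounded_operator_on X (T t)"
  using C0 by (simp add: C0_semigroup_on_def)

lemma T_in [simp]: "0 \<le> t \<Longrightarrow> x \<in> X \<Longrightarrow> T t x \<in> X"
  using T_bounded[of t] by (auto simp: bounded_operator_on_def)

lemma T_0 [simp]: "x \<in> X \<Longrightarrow> T 0 x = x"
  using C0 by (simp add: C0_semigroup_on_def)

lemma T_add: "0 \<le> s \<Longrightarrow> 0 \<le> t \<Longrightarrow> x \<in> X \<Longrightarrow> T (s + t) x = T s (T t x)"
  using C0 by (simp add: C0_semigroup_on_def)

lemma bounded_linear_T: "0 \<le> t \<Longrightarrow> bounded_linear (\<lambda>x. T t (P x))"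
proof -
  assume t: "0 \<le> t"
  interpret P: bounded_linear P by (rule P)
  obtain K where K: "\<And>x. x \<in> X \<Longrightarrow> norm (T t x) \<le> K * norm x"
    using T_bounded[OF t] unfolding bounded_operator_on_def by blast
  obtain K' where K': "\<And>x. norm (P x) \<le> norm x * K'" using P.bounded by blast
  show ?thesis
  proof (rule bounded_linear_intro[of _ "\<bar>K\<bar> * K'"])
    show "T t (P (x + y)) = T t (P x) + T t (P y)" for x y
      using T_bounded[OF t] P_in by (simp add: bounded_operator_on_def P.add)
    show "T t (P (c *\<^sub>R x)) = c *\<^sub>R T t (P x)" for c x
      using T_bounded[OF t] P_in by (simp add: bounded_operator_on_def P.scaleR)
    show "norm (T t (P x)) \<le> norm x * (\<bar>K\<bar> * K')" for x
    proof -
      have "norm (T t (P x)) \<le> K * norm (P x)" by (rule K[OF P_in])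
      also have "\<dots> \<le> \<bar>K\<bar> * (norm x * K')"
        using K'[of x] by (intro mult_mono) auto
      finally show ?thesis by (simp add: algebra_simps)
    qed
  qed
qed

lemma T_diff: "0 \<le> t \<Longrightarrow> x \<in> X \<Longrightarrow> y \<in> X \<Longrightarrow> T t (x - y) = T t x - T t y"
  using linear_diff[OF bounded_linear.linear[OF bounded_linear_T], of t x y] P_fix by simp

lemma right_continuous_0:
  assumes "x \<in> X" "0 < e"
  obtains d where "0 < d" "\<And>t. 0 \<le> t \<Longrightarrow> t < d \<Longrightarrow> norm (T t x - x) < e"
proof -
  have "((\<lambda>t. T t x) \<longlongrightarrow> x) (at_right 0)" using C0 assms by (simp add: C0_semigroup_on_def)
  then have "\<forall>\<^sub>F t in at_right 0. dist (T t x) x < e" using assms(2) by (rule tendstoD)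
  then obtain d where d: "0 < d" "\<And>t. 0 < t \<Longrightarrow> t < d \<Longrightarrow> norm (T t x - x) < e"
    by (auto simp: eventually_at_right_field dist_norm)
  have "norm (T t x - x) < e" if "0 \<le> t" "t < d" for t
    using d(2)[of t] that assms by (cases "t = 0") auto
  then show ?thesis using d(1) that by blast
qed

text \<open>Otherwise there are times \<open>s n\<close> tending to 0 with unbounded operator norms.
  But \<open>T (s n)\<close>, composed with \<open>P\<close>, converges pointwise by strong
  continuity, which contradicts uniform boundedness.\<close>

lemma bounded_near_0:
  obtains d K where "0 < d" "\<And>t x. 0 \<le> t \<Longrightarrow> t \<le> d \<Longrightarrow> x \<in> X \<Longrightarrow> norm (T t x) \<le> K * norm x"
proof (rule ccontr)
  assume neg: "\<not> thesis"
  have "\<exists>t x. 0 \<le> t \<and> t \<le> inverse (real (Suc n)) \<and> x \<in> X \<and> norm (T t x) > real n * norm x" for n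
  proof (rule ccontr)
    assume "\<not> ?thesis"
    then have "\<And>t x. 0 \<le> t \<Longrightarrow> t \<le> inverse (real (Suc n)) \<Longrightarrow> x \<in> X \<Longrightarrow> norm (T t x) \<le> real n * norm x"
      by (meson not_le)
    then show False using neg that[of "inverse (real (Suc n))" "real n"] by simp
  qed
  then obtain s z where s: "\<And>n. 0 \<le> s n" "\<And>n. s n \<le> inverse (real (Suc n))"
    and z: "\<And>n. z n \<in> X" "\<And>n. norm (T (s n) (z n)) > real n * norm (z n)"
    by metis
  have s0: "s \<longlonglongrightarrow> 0"
    by (rule tendsto_sandwich[OF _ _ tendsto_const LIMSEQ_inverse_real_of_nat]) (use s in auto)
  have "\<exists>C. \<forall>n. norm (T (s n) (P x)) \<le> C" for x
  proof -
    have "(\<lambda>n. T (s n) (P x)) \<longlonglongrightarrow> P x"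
    proof (rule LIMSEQ_I)
      fix e :: real assume "0 < e"
      obtain d where d: "0 < d" "\<And>t. 0 \<le> t \<Longrightarrow> t < d \<Longrightarrow> norm (T t (P x) - P x) < e"
        using right_continuous_0[OF P_in \<open>0 < e\<close>] by blast
      have "\<forall>\<^sub>F n in sequentially. s n < d" using s0 d(1) order_tendstoD(2) by blast
      then show "\<exists>N. \<forall>n\<ge>N. norm (T (s n) (P x) - P x) < e"
        using d(2) s(1) by (auto simp: eventually_sequentially)
    qed
    then have "Bseq (\<lambda>n. T (s n) (P x))" using convergentI convergent_imp_Bseq by blast
    then show ?thesis by (auto simp: Bseq_def)
  qed
  then obtain K where K: "\<And>n x. norm (T (s n) (P x)) \<le> K * norm x"
    using uniform_boundedness[of "\<lambda>n x. T (s n) (P x)"] bounded_linear_T s(1) by metis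
  obtain n :: nat where "K \<le> n" using real_arch_simple by blast
  then have "K * norm (z n) \<le> n * norm (z n)" by (intro mult_right_mono) auto
  then show False using K[of n "z n"] z(2)[of n] P_fix[OF z(1)[of n]] by simp
qed

lemma locally_bounded:
  assumes "0 \<le> \<tau>"
  obtains K where "0 \<le> K" "\<And>t x. 0 \<le> t \<Longrightarrow> t \<le> \<tau> \<Longrightarrow> x \<in> X \<Longrightarrow> norm (T t x) \<le> K * norm x"
proof -
  obtain d K0 where d: "0 < d" and K0: "\<And>t x. 0 \<le> t \<Longrightarrow> t \<le> d \<Longrightarrow> x \<in> X \<Longrightarrow> norm (T t x) \<le> K0 * norm x"
    using bounded_near_0 by blast
  \<comment> \<open>At least 1, so that the powers of \<open>K\<close> do not decrease.\<close>
  define K where "K = max 1 K0"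
  have K: "1 \<le> K" "\<And>t x. 0 \<le> t \<Longrightarrow> t \<le> d \<Longrightarrow> x \<in> X \<Longrightarrow> norm (T t x) \<le> K * norm x"
    using K0 order_trans[OF K0 mult_right_mono[of K0 "max 1 K0"]] by (auto simp: K_def)
  have iter: "norm (T t x) \<le> K ^ n * norm x" if "0 \<le> t" "t \<le> n * d" "x \<in> X" for n t x
    using that
  proof (induction n arbitrary: t)
    case (Suc n)
    show ?case
    proof (cases "t \<le> d")
      case True
      have "norm (T t x) \<le> K * norm x" using K(2) Suc.prems True by blast
      also have "\<dots> \<le> K ^ Suc n * norm x"
        using K(1) self_le_power[of K "Suc n"] by (intro mult_right_mono) auto
      finally show ?thesis .
    next
      case False
      then have IH: "norm (T (t - d) x) \<le> K ^ n * norm x"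
        using Suc by (intro Suc.IH) (auto simp: algebra_simps)
      have "T t x = T d (T (t - d) x)" using T_add[of d "t - d" x] False d Suc.prems by simp
      also have "norm \<dots> \<le> K * norm (T (t - d) x)" using K(2) d False Suc.prems by simp
      also have "\<dots> \<le> K * (K ^ n * norm x)" using IH K(1) by (intro mult_left_mono) auto
      finally show ?thesis by (simp add: mult.assoc)
    qed
  qed simp
  obtain n :: nat where "\<tau> / d \<le> n" using real_arch_simple by blast
  then have "\<tau> \<le> n * d" using d by (simp add: field_simps)
  then have "norm (T t x) \<le> K ^ n * norm x" if "0 \<le> t" "t \<le> \<tau>" "x \<in> X" for t x
    using iter that by auto
  then show ?thesis using that[of "K ^ n"] K(1) by simp
qed

lemma orbit_continuous:
  assumes x: "x \<in> X"
  shows "continuous_on {0..} (\<lambda>t. T t x)"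
  unfolding continuous_on_iff
proof (intro ballI allI impI)
  fix t0 e :: real assume t0: "t0 \<in> {0..}" and e: "0 < e"
  obtain K where K: "0 \<le> K" "\<And>t x. 0 \<le> t \<Longrightarrow> t \<le> t0 \<Longrightarrow> x \<in> X \<Longrightarrow> norm (T t x) \<le> K * norm x"
    using locally_bounded[of t0] t0 by auto
  obtain d where d: "0 < d" "\<And>t. 0 \<le> t \<Longrightarrow> t < d \<Longrightarrow> norm (T t x - x) < e / (K + 1)"
    using right_continuous_0[OF x, of "e / (K + 1)"] e K(1) by auto
  have "dist (T t x) (T t0 x) < e" if t: "t \<in> {0..}" "dist t t0 < d" for t
  proof -
    \<comment> \<open>With the earlier of the two times factored out, continuity from the left and
      from the right become one case, and the local bound handles \<open>T m\<close>.\<close>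
    define m h where "m = min t t0" and "h = \<bar>t - t0\<bar>"
    have mh: "0 \<le> m" "m \<le> t0" "0 \<le> h" "h < d" "max t t0 = m + h"
      using t t0 by (auto simp: m_def h_def dist_real_def)
    have "dist (T t x) (T t0 x) = norm (T (m + h) x - T m x)"
      by (auto simp: m_def h_def dist_norm min_def norm_minus_commute)
    also have "T (m + h) x - T m x = T m (T h x - x)" using mh x by (simp add: T_add T_diff)
    also have "norm \<dots> \<le> K * norm (T h x - x)" using mh x by (intro K(2)) auto
    also have "\<dots> \<le> K * (e / (K + 1))"
      using d(2)[of h] mh K(1) by (intro mult_left_mono) auto
    also have "\<dots> < e" using e K(1) by (simp add: field_simps)
    finally show ?thesis .
  qed
  then show "\<exists>d>0. \<forall>t\<in>{0..}. dist t t0 < d \<longrightarrow> dist (T t x) (T t0 x) < e" using d(1) by blast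
qed

section \<open>Averaged orbits and the generator\<close>

lemma at_within_Icc_0_eq_Ici:
  fixes t :: real
  assumes "0 \<le> t" "t < c"
  shows "at t within {0..c} = at t within {0..}"
  by (rule at_within_nhd[of _ "{..<c}"]) (use assms in auto)

lemma integral_orbit_deriv:
  assumes q: "q \<in> X" and t: "0 \<le> t"
  shows "((\<lambda>t. integral {0..t} (\<lambda>s. T s q)) has_vector_derivative T t q) (at t within {0..})"
proof -
  have "continuous_on {0..t + 1} (\<lambda>s. T s q)"
    by (rule continuous_on_subset[OF orbit_continuous[OF q]]) auto
  then have "((\<lambda>t. integral {0..t} (\<lambda>s. T s q)) has_vector_derivative T t q) (at t within {0..t + 1})"
    using t by (intro integral_has_vector_derivative) auto
  then show ?thesis using at_within_Icc_0_eq_Ici[of t "t + 1"] t by simp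
qed

lemma right_difference_quotient:
  fixes w :: "real \<Rightarrow> 'a"
  assumes "(w has_vector_derivative D) (at t within {0..})" "0 \<le> t"
  shows "((\<lambda>h. (w (t + h) - w t) /\<^sub>R h) \<longlongrightarrow> D) (at_right 0)"
proof -
  have "((\<lambda>y. (w y - w t - (y - t) *\<^sub>R D) /\<^sub>R norm (y - t)) \<longlongrightarrow> 0) (at t within {0..})"
    using assms(1) by (simp add: has_vector_derivative_def has_derivative_within divide_inverse diff_diff_eq)
  then have "((\<lambda>y. (w y - w t - (y - t) *\<^sub>R D) /\<^sub>R norm (y - t)) \<longlongrightarrow> 0) (at_right t)"
    by (rule tendsto_within_subset) (use assms(2) in auto)
  moreover have "\<forall>\<^sub>F y in at_right t. (w y - w t - (y - t) *\<^sub>R D) /\<^sub>R norm (y - t) = (w y - w t) /\<^sub>R (y - t) - D"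
    by (auto simp: eventually_at_filter scaleR_diff_right)
  ultimately have "((\<lambda>y. (w y - w t) /\<^sub>R (y - t) - D) \<longlongrightarrow> 0) (at_right t)"
    by (rule Lim_transform_eventually)
  then have "((\<lambda>y. (w y - w t) /\<^sub>R (y - t)) \<longlongrightarrow> D) (at_right t)"
    by (simp add: Lim_null[symmetric])
  then show ?thesis
    unfolding filterlim_at_right_to_0[of _ _ t] by (simp add: add.commute)
qed

text \<open>\<open>w t\<close> is the mean of \<open>T s q\<close> over \<open>[t, t + h]\<close>.
  Bounded operators commute with the integral, so \<open>w\<close> is again an orbit; its derivative
  is the difference quotient of the original orbit with step \<open>h\<close>, which is continuous
  in \<open>t\<close>.\<close>

lemma smooth_orbit:
  assumes q: "q \<in> X" and e: "0 < e"
  obtains w w' where "w 0 \<in> X" "norm (w 0 - q) < e" "\<And>t. 0 \<le> t \<Longrightarrow> w t = T t (w 0)"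
    "\<And>t. 0 \<le> t \<Longrightarrow> (w t, w' t) \<in> generator_on X T"
    "\<And>t. 0 \<le> t \<Longrightarrow> (w has_vector_derivative w' t) (at t within {0..})"
    "continuous_on {0..} w'"
proof -
  define W where "W = (\<lambda>t. integral {0..t} (\<lambda>s. T s q))"
  note W_deriv = integral_orbit_deriv[OF q, folded W_def]
  have cont: "continuous_on {a..c} (\<lambda>s. T s q)" if "0 \<le> a" for a c
    by (rule continuous_on_subset[OF orbit_continuous[OF q]]) (use that in auto)
  have "((\<lambda>h. (W (0 + h) - W 0) /\<^sub>R h) \<longlongrightarrow> T 0 q) (at_right 0)"
    by (intro right_difference_quotient W_deriv) auto
  then have "((\<lambda>h. W h /\<^sub>R h) \<longlongrightarrow> q) (at_right 0)" using q by (simp add: W_def)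
  then have "\<forall>\<^sub>F h in at_right 0. dist (W h /\<^sub>R h) q < e" using e by (rule tendstoD)
  then obtain d where d: "0 < d" "\<And>h. 0 < h \<Longrightarrow> h < d \<Longrightarrow> dist (W h /\<^sub>R h) q < e"
    by (auto simp: eventually_at_right_field)
  define h where "h = d / 2"
  have h: "0 < h" "dist (W h /\<^sub>R h) q < e" using d(1) d(2)[of "d / 2"] by (simp_all add: h_def)
  define w where "w = (\<lambda>t. integral {t..t + h} (\<lambda>s. T s q) /\<^sub>R h)"
  define w' where "w' = (\<lambda>t. (T (t + h) q - T t q) /\<^sub>R h)"
  have int: "(\<lambda>s. T s q) integrable_on {a..c}" if "0 \<le> a" for a c
    using cont[OF that] by (rule integrable_continuous_interval)
  have w_eq: "w t = (W (t + h) - W t) /\<^sub>R h" if "0 \<le> t" for t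
    using Henstock_Kurzweil_Integration.integral_combine[of 0 t "t + h" "\<lambda>s. T s q"] int[of 0 "t + h"] that h
    by (simp add: w_def W_def flip: scaleR_add_right) (metis add_diff_cancel_left')
  \<comment> \<open>\<open>P\<close> commutes with the integral and fixes the integrand, so the mean
    stays in \<open>X\<close>.\<close>
  have w_in: "w t \<in> X" if "0 \<le> t" for t
  proof -
    have "P (integral {t..t + h} (\<lambda>s. T s q)) = integral {t..t + h} (P \<circ> (\<lambda>s. T s q))"
      by (rule integral_linear[OF int[OF that] P, symmetric])
    also have "\<dots> = integral {t..t + h} (\<lambda>s. T s q)"
      using that q by (intro integral_cong) (simp add: P_fix)
    finally show ?thesis unfolding w_def using P_in by (metis X_closed(3))
  qed
  have w_T: "w (t + r) = T r (w t)" if "0 \<le> t" "0 \<le> r" for t r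
  proof -
    interpret S: bounded_linear "\<lambda>x. T r (P x)" using bounded_linear_T[OF that(2)] .
    have "T r (w t) = T r (P (w t))" using w_in[OF that(1)] by (simp add: P_fix)
    also have "\<dots> = T r (P (integral {t..t + h} (\<lambda>s. T s q))) /\<^sub>R h" by (simp add: w_def S.scaleR)
    also have "T r (P (integral {t..t + h} (\<lambda>s. T s q))) = integral {t..t + h} ((\<lambda>x. T r (P x)) \<circ> (\<lambda>s. T s q))"
      by (rule integral_linear[OF int[OF that(1)] bounded_linear_T[OF that(2)], symmetric])
    also have "\<dots> = integral {t..t + h} ((\<lambda>s. T s q) \<circ> (+) r)"
      using that q by (intro integral_cong) (simp add: P_fix T_add)
    also have "\<dots> = integral {t + r..t + h + r} (\<lambda>s. T s q)" by (rule integral_shift_Icc_real)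
    finally show ?thesis by (simp add: w_def algebra_simps)
  qed
  have w_deriv: "(w has_vector_derivative w' t) (at t within {0..})" if "0 \<le> t" for t
  proof -
    have "(W has_vector_derivative T (t + h) q) (at (t + h) within (\<lambda>t. t + h) ` {0..})"
      by (rule has_vector_derivative_within_subset[OF W_deriv]) (use that h in auto)
    then have "(W \<circ> (\<lambda>t. t + h) has_vector_derivative 1 *\<^sub>R T (t + h) q) (at t within {0..})"
      by (intro vector_diff_chain_within) (auto intro!: derivative_eq_intros)
    then have "((\<lambda>t. (W (t + h) - W t) /\<^sub>R h) has_vector_derivative w' t) (at t within {0..})"
      unfolding w'_def using W_deriv[OF that]
      by (intro bounded_linear.has_vector_derivative[OF bounded_linear_scaleR_right] has_vector_derivative_diff)
         (simp_all add: o_def)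
    then show ?thesis
      by (rule has_vector_derivative_transform[rotated 2]) (use that w_eq in auto)
  qed
  show ?thesis
  proof (rule that[of w w'])
    show "w 0 \<in> X" using w_in by simp
    show "norm (w 0 - q) < e" using h(2) w_eq[of 0] by (simp add: dist_norm W_def)
    show "w t = T t (w 0)" if "0 \<le> t" for t using w_T[of 0 t] that by simp
    show "(w has_vector_derivative w' t) (at t within {0..})" if "0 \<le> t" for t using w_deriv that .
    show "continuous_on {0..} w'"
      unfolding w'_def using h(1)
      by (intro continuous_intros continuous_on_compose2[OF orbit_continuous[OF q], of _ "\<lambda>t. t + h"] orbit_continuous q) auto
    show "(w t, w' t) \<in> generator_on X T" if t: "0 \<le> t" for t
    proof -
      have "((\<lambda>r. (w (t + r) - w t) /\<^sub>R r) \<longlongrightarrow> w' t) (at_right 0)"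
        by (intro right_difference_quotient w_deriv t)
      moreover have "\<forall>\<^sub>F r in at_right 0. (w (t + r) - w t) /\<^sub>R r = (T r (w t) - w t) /\<^sub>R r"
        using w_T[OF t] by (auto simp: eventually_at_filter)
      ultimately have "((\<lambda>r. (T r (w t) - w t) /\<^sub>R r) \<longlongrightarrow> w' t) (at_right 0)"
        by (rule Lim_transform_eventually)
      moreover have "w' t \<in> X" unfolding w'_def using t h q by (intro X_closed T_in) auto
      ultimately show ?thesis using w_in[OF t] by (simp add: generator_on_def)
    qed
  qed
qed

end

section \<open>Compact sets of Lipschitz profiles\<close>

lemma eq_L1_class:
  assumes h: "set_integrable lebesgue {0<..<L} h" and p: "p \<in> L1_space L"
    and ae: "AE x in lebesgue. x \<in> {0<..<L} \<longrightarrow> rep_l1 p x = h x"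
  shows "p = L1_class L h"
proof -
  have "AE x in lebesgue. x \<notin> {0<..<L} \<longrightarrow> rep_l1 p x = 0" using p by (simp add: L1_space_def)
  with ae rep_abs_l1[OF L1_class_integrable[OF h]]
  have "AE x in lebesgue. rep_l1 p x = rep_l1 (L1_class L h) x"
    unfolding L1_class_def by eventually_elim auto
  then show ?thesis by (simp add: l1_eq_iff)
qed

lemma norm_L1_class_diff_le:
  assumes h: "set_integrable lebesgue {0<..<L} h1" "set_integrable lebesgue {0<..<L} h2"
    and e: "\<And>x. x \<in> {0<..<L} \<Longrightarrow> \<bar>h1 x - h2 x\<bar> \<le> e" and L: "0 < L"
  shows "norm (L1_class L h1 - L1_class L h2) \<le> e * L"
proof -
  let ?f = "\<lambda>h x. if x \<in> {0<..<L} then h x else (0::real)"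
  have int: "integrable lebesgue (\<lambda>x. ?f h1 x - ?f h2 x)"
    using h by (intro Bochner_Integration.integrable_diff L1_class_integrable)
  have "norm (L1_class L h1 - L1_class L h2) = (\<integral>x. \<bar>?f h1 x - ?f h2 x\<bar> \<partial>lebesgue)"
    unfolding L1_class_def abs_l1_minus[OF L1_class_integrable[OF h(1)] L1_class_integrable[OF h(2)]]
    by (rule norm_abs_l1[OF int])
  also have "\<dots> \<le> (\<integral>x. e * indicator {0<..<L} x \<partial>lebesgue)"
  proof (rule integral_mono)
    show "integrable lebesgue (\<lambda>x. e * indicat_real {0<..<L} x)"
      using L by (intro integrable_mult_right) (simp add: integrable_indicator_iff)
  qed (use int e in \<open>auto simp: indicator_def\<close>)
  also have "\<dots> = e * L" using L by simp
  finally show ?thesis .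
qed

text \<open>The Lipschitz condition is on \<open>\<phi>\<close> and not on the product, since
  \<open>E\<close> will only be known to be continuous and bounded on the open interval. One
  constant bounds both values and slopes.\<close>

definition lipschitz_profiles :: "real \<Rightarrow> (real \<Rightarrow> real) \<Rightarrow> real \<Rightarrow> l1 set" where
  "lipschitz_profiles L E C = {L1_class L (\<lambda>x. \<phi> x * E x) | \<phi>.
     (\<forall>x\<in>{0..L}. \<bar>\<phi> x\<bar> \<le> C) \<and> (\<forall>x\<in>{0..L}. \<forall>y\<in>{0..L}. \<bar>\<phi> x - \<phi> y\<bar> \<le> C * \<bar>x - y\<bar>)}"

lemma lipschitz_imp_continuous_on:
  fixes \<phi> :: "real \<Rightarrow> real"
  assumes "\<And>x y. x \<in> S \<Longrightarrow> y \<in> S \<Longrightarrow> \<bar>\<phi> x - \<phi> y\<bar> \<le> C * \<bar>x - y\<bar>"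
  shows "continuous_on S \<phi>"
proof (cases "S = {}")
  case False
  have "\<bar>\<phi> x - \<phi> y\<bar> \<le> \<bar>C\<bar> * \<bar>x - y\<bar>" if "x \<in> S" "y \<in> S" for x y
    using assms[OF that] order_trans mult_right_mono[OF abs_ge_self abs_ge_zero] by blast
  then have "\<bar>C\<bar>-lipschitz_on S \<phi>" by (auto simp: lipschitz_on_def dist_real_def)
  then show ?thesis by (rule lipschitz_on_continuous_on)
qed simp

lemma profile_integrable:
  fixes E \<phi> :: "real \<Rightarrow> real"
  assumes E: "continuous_on {0<..<L} E" "\<And>x. x \<in> {0<..<L} \<Longrightarrow> 0 \<le> E x \<and> E x \<le> 1"
    and \<phi>: "continuous_on {0..L} \<phi>" "\<And>x. x \<in> {0..L} \<Longrightarrow> \<bar>\<phi> x\<bar> \<le> C"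
  shows "set_integrable lebesgue {0<..<L} (\<lambda>x. \<phi> x * E x)"
  unfolding set_integrable_def
proof (rule Bochner_Integration.integrable_bound)
  show "integrable lebesgue (\<lambda>x. C * indicat_real {0<..<L} x)"
    by (intro integrable_mult_right) (simp flip: lmeasurable_iff_integrable add: bounded_set_imp_lmeasurable)
  have "continuous_on {0<..<L} (\<lambda>x. \<phi> x * E x)"
    by (intro continuous_on_mult E(1) continuous_on_subset[OF \<phi>(1)]) auto
  from borel_measurable_continuous_on_indicator[OF _ this]
  have "(\<lambda>x. indicat_real {0<..<L} x *\<^sub>R (\<phi> x * E x)) \<in> borel_measurable borel" by simp
  then show "(\<lambda>x. indicat_real {0<..<L} x *\<^sub>R (\<phi> x * E x)) \<in> borel_measurable lebesgue"
    by (intro measurable_completion) simp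
  show "AE x in lebesgue. norm (indicat_real {0<..<L} x *\<^sub>R (\<phi> x * E x)) \<le> norm (C * indicat_real {0<..<L} x)"
  proof (intro AE_I2)
    fix x
    show "norm (indicat_real {0<..<L} x *\<^sub>R (\<phi> x * E x)) \<le> norm (C * indicat_real {0<..<L} x)"
    proof (cases "x \<in> {0<..<L}")
      case True
      then have "\<bar>\<phi> x\<bar> * \<bar>E x\<bar> \<le> \<bar>C\<bar> * 1"
        using E(2)[OF True] \<phi>(2)[of x] by (intro mult_mono) auto
      then show ?thesis using True by (simp add: abs_mult)
    qed simp
  qed
qed

text \<open>Arzela-Ascoli makes a subsequence of the factors \<open>\<phi>\<close> converge
  uniformly; as \<open>0 \<le> E \<le> 1\<close> and the interval has finite length, the products
  converge in mean. Both bounds survive in the limit, so the set is compact and not just relatively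
  compact.\<close>

lemma compact_lipschitz_profiles:
  assumes L: "0 < L" and E: "continuous_on {0<..<L} E" "\<And>x. x \<in> {0<..<L} \<Longrightarrow> 0 \<le> E x \<and> E x \<le> 1"
    and C: "0 \<le> C"
  shows "compact (lipschitz_profiles L E C)"
  unfolding compact_eq_seq_compact_metric seq_compact_def
proof (intro allI impI)
  fix p :: "nat \<Rightarrow> l1"
  assume "\<forall>n. p n \<in> lipschitz_profiles L E C"
  then have "\<forall>n. \<exists>\<phi>. p n = L1_class L (\<lambda>x. \<phi> x * E x) \<and> (\<forall>x\<in>{0..L}. \<bar>\<phi> x\<bar> \<le> C) \<and>
      (\<forall>x\<in>{0..L}. \<forall>y\<in>{0..L}. \<bar>\<phi> x - \<phi> y\<bar> \<le> C * \<bar>x - y\<bar>)"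
    unfolding lipschitz_profiles_def by blast
  then obtain \<phi> where \<phi>: "\<And>n. p n = L1_class L (\<lambda>x. \<phi> n x * E x)"
    "\<And>n x. x \<in> {0..L} \<Longrightarrow> \<bar>\<phi> n x\<bar> \<le> C"
    "\<And>n x y. x \<in> {0..L} \<Longrightarrow> y \<in> {0..L} \<Longrightarrow> \<bar>\<phi> n x - \<phi> n y\<bar> \<le> C * \<bar>x - y\<bar>"
    by metis
  obtain \<psi> r where \<psi>: "continuous_on {0..L} \<psi>" and r: "strict_mono (r :: nat \<Rightarrow> nat)"
    and unif: "\<And>e. 0 < e \<Longrightarrow> \<exists>N. \<forall>n x. n \<ge> N \<and> x \<in> {0..L} \<longrightarrow> norm (\<phi> (r n) x - \<psi> x) < e"
  proof (rule Arzela_Ascoli[of "{0..L}" \<phi> C])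
    show "\<exists>d. 0 < d \<and> (\<forall>n y. y \<in> {0..L} \<and> norm (x - y) < d \<longrightarrow> norm (\<phi> n x - \<phi> n y) < e)"
      if x: "x \<in> {0..L}" and e: "0 < e" for x e
    proof (intro exI conjI allI impI)
      show "0 < e / (C + 1)" using e C by simp
      fix n y assume y: "y \<in> {0..L} \<and> norm (x - y) < e / (C + 1)"
      have "\<bar>\<phi> n x - \<phi> n y\<bar> \<le> C * \<bar>x - y\<bar>" using \<phi>(3) x y by blast
      also have "\<dots> \<le> C * (e / (C + 1))" using y C by (intro mult_left_mono) auto
      also have "\<dots> < e" using e C by (simp add: field_simps)
      finally show "norm (\<phi> n x - \<phi> n y) < e" by simp
    qed
  qed (use \<phi>(2) in auto)
  have lim: "(\<lambda>n. \<phi> (r n) x) \<longlonglongrightarrow> \<psi> x" if "x \<in> {0..L}" for x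
    using unif that by (intro LIMSEQ_I) blast
  have \<psi>_le: "\<bar>\<psi> x\<bar> \<le> C" if "x \<in> {0..L}" for x
    by (rule LIMSEQ_le_const2[OF tendsto_rabs[OF lim[OF that]]]) (use \<phi>(2) that in auto)
  have \<psi>_lip: "\<bar>\<psi> x - \<psi> y\<bar> \<le> C * \<bar>x - y\<bar>" if "x \<in> {0..L}" "y \<in> {0..L}" for x y
    by (rule LIMSEQ_le_const2[OF tendsto_rabs[OF tendsto_diff[OF lim[OF that(1)] lim[OF that(2)]]]])
       (use \<phi>(3) that in auto)
  let ?l = "L1_class L (\<lambda>x. \<psi> x * E x)"
  have "?l \<in> lipschitz_profiles L E C"
    unfolding lipschitz_profiles_def using \<psi>_le \<psi>_lip by blast
  moreover have "(p \<circ> r) \<longlonglongrightarrow> ?l"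
  proof (rule LIMSEQ_I)
    fix e :: real assume e: "0 < e"
    obtain N where N: "\<And>n x. n \<ge> N \<Longrightarrow> x \<in> {0..L} \<Longrightarrow> norm (\<phi> (r n) x - \<psi> x) < e / (2 * L)"
      using unif[of "e / (2 * L)"] e L by auto
    have "norm ((p \<circ> r) n - ?l) < e" if n: "n \<ge> N" for n
    proof -
      have "norm (L1_class L (\<lambda>x. \<phi> (r n) x * E x) - ?l) \<le> e / (2 * L) * L"
      proof (rule norm_L1_class_diff_le[OF profile_integrable[OF E] profile_integrable[OF E \<psi> \<psi>_le]])
        show "continuous_on {0..L} (\<phi> (r n))" using \<phi>(3) by (rule lipschitz_imp_continuous_on)
        show "\<bar>\<phi> (r n) x * E x - \<psi> x * E x\<bar> \<le> e / (2 * L)" if "x \<in> {0<..<L}" for x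
        proof -
          have "\<bar>\<phi> (r n) x - \<psi> x\<bar> * \<bar>E x\<bar> \<le> e / (2 * L) * 1"
            using N[OF n, of x] E(2)[OF that] that by (intro mult_mono) auto
          then show ?thesis by (simp add: abs_mult left_diff_distrib[symmetric])
        qed
      qed (use \<phi>(2) L in auto)
      then show ?thesis using L e by (simp add: \<phi>(1))
    qed
    then show "\<exists>N. \<forall>n\<ge>N. norm ((p \<circ> r) n - ?l) < e" by blast
  qed
  ultimately show "\<exists>l\<in>lipschitz_profiles L E C. \<exists>r. strict_mono r \<and> (p \<circ> r) \<longlonglongrightarrow> l"
    using r by blast
qed

section \<open>The projection onto the state space\<close>

definition restrict_l1 :: "real \<Rightarrow> l1 \<Rightarrow> l1" where
  "restrict_l1 L p = L1_class L (rep_l1 p)"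

lemma rep_restrict_l1: "AE x in lebesgue. rep_l1 (restrict_l1 L p) x = (if x \<in> {0<..<L} then rep_l1 p x else 0)"
  unfolding restrict_l1_def L1_class_def
  using integrable_mult_indicator[of "{0<..<L}" lebesgue "rep_l1 p"] integrable_rep_l1[of p]
  by (intro rep_abs_l1 L1_class_integrable) (simp add: set_integrable_def)

lemma restrict_l1_in: "restrict_l1 L p \<in> L1_space L"
  using rep_restrict_l1[of L p] unfolding L1_space_def by (auto elim: AE_mp)

lemma restrict_l1_fix: "p \<in> L1_space L \<Longrightarrow> restrict_l1 L p = p"
  unfolding l1_eq_iff L1_space_def mem_Collect_eq using rep_restrict_l1[of L p]
  by (elim AE_mp) auto

lemma bounded_linear_restrict_l1: "bounded_linear (restrict_l1 L)"
proof (rule bounded_linear_intro[of _ 1])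
  fix p q :: l1 and c :: real
  from rep_plus_l1[of p q] rep_plus_l1[of "restrict_l1 L p" "restrict_l1 L q"]
    rep_restrict_l1[of L p] rep_restrict_l1[of L q] rep_restrict_l1[of L "p + q"]
  show "restrict_l1 L (p + q) = restrict_l1 L p + restrict_l1 L q"
    unfolding l1_eq_iff by eventually_elim simp
  from rep_scaleR_l1[of c p] rep_scaleR_l1[of c "restrict_l1 L p"]
    rep_restrict_l1[of L p] rep_restrict_l1[of L "c *\<^sub>R p"]
  show "restrict_l1 L (c *\<^sub>R p) = c *\<^sub>R restrict_l1 L p"
    unfolding l1_eq_iff by eventually_elim simp
  have "(\<integral>x. \<bar>rep_l1 (restrict_l1 L p) x\<bar> \<partial>lebesgue) \<le> (\<integral>x. \<bar>rep_l1 p x\<bar> \<partial>lebesgue)"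
  proof (rule integral_mono_AE)
    show "AE x in lebesgue. \<bar>rep_l1 (restrict_l1 L p) x\<bar> \<le> \<bar>rep_l1 p x\<bar>"
      using rep_restrict_l1[of L p] by eventually_elim simp
  qed (auto simp: integrable_rep_l1)
  then show "norm (restrict_l1 L p) \<le> norm p * 1" by (simp add: norm_l1_eq)
qed

definition restrict_state :: "real \<Rightarrow> state \<Rightarrow> state" where
  "restrict_state L p = State (st0 p) (restrict_l1 L (st1 p)) (restrict_l1 L (st2 p))"

lemma bounded_linear_restrict_state: "bounded_linear (restrict_state L)"
proof -
  interpret R: bounded_linear "restrict_l1 L" by (rule bounded_linear_restrict_l1)
  obtain K where K: "\<And>p. norm (restrict_l1 L p) \<le> norm p * K" using R.bounded by blast
  show ?thesis
  proof (rule bounded_linear_intro[of _ "1 + \<bar>K\<bar> + \<bar>K\<bar>"])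
    fix p q :: state and c :: real
    show "restrict_state L (p + q) = restrict_state L p + restrict_state L q"
      by (simp add: restrict_state_def plus_state_def R.add)
    show "restrict_state L (c *\<^sub>R p) = c *\<^sub>R restrict_state L p"
      by (simp add: restrict_state_def scaleR_state_def R.scaleR)
    have le: "norm (restrict_l1 L f) \<le> norm p * \<bar>K\<bar>" if "norm f \<le> norm p" for f
    proof -
      have "norm f * K \<le> norm p * \<bar>K\<bar>"
        using that by (meson abs_ge_self abs_ge_zero mult_left_mono mult_right_mono norm_ge_zero order_trans)
      then show ?thesis using K[of f] by linarith
    qed
    have "norm (restrict_state L p) = \<bar>st0 p\<bar> + norm (restrict_l1 L (st1 p)) + norm (restrict_l1 L (st2 p))"
      by (simp add: norm_state_def restrict_state_def)
    also have "\<dots> \<le> norm p + norm p * \<bar>K\<bar> + norm p * \<bar>K\<bar>"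
      by (intro add_mono le norm_st_le)
    finally have "norm (restrict_state L p) \<le> norm p + norm p * \<bar>K\<bar> + norm p * \<bar>K\<bar>" .
    then show "norm (restrict_state L p) \<le> norm p * (1 + \<bar>K\<bar> + \<bar>K\<bar>)" by (simp add: algebra_simps)
  qed
qed

lemma restrict_state_in: "restrict_state L p \<in> X_space L"
  by (simp add: restrict_state_def X_space_def restrict_l1_in)

lemma restrict_state_fix: "p \<in> X_space L \<Longrightarrow> restrict_state L p = p"
  by (cases p) (simp add: restrict_state_def X_space_def restrict_l1_fix)

lemma closed_X_space: "closed (X_space L)"
proof -
  have "X_space L = {p. restrict_state L p - p = 0}"
    by (auto simp: restrict_state_fix) (metis restrict_state_in)
  then show ?thesis
    using closed_Collect_eq[of "\<lambda>p. restrict_state L p - p" "\<lambda>_. 0"] bounded_linear_restrict_state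
    by (simp add: continuous_on_diff linear_continuous_on)
qed

text \<open>Stated outside \<open>age_flow\<close>, so that the factors of the compact set are at
  hand before any orbit is chosen.\<close>

lemma survival_function:
  fixes mu :: "real \<Rightarrow> real"
  assumes k: "0 \<le> k" and mu: "\<And>x. x \<in> {0..L} \<Longrightarrow> 0 \<le> mu x"
    and int: "\<And>l. 0 < l \<Longrightarrow> l < L \<Longrightarrow> mu absolutely_integrable_on {0..l}"
  defines "E \<equiv> \<lambda>x. exp (- integral {0..x} (\<lambda>y. mu y + k))"
  shows "continuous_on {0<..<L} E" and "\<And>x. x \<in> {0<..<L} \<Longrightarrow> 0 \<le> E x \<and> E x \<le> 1"
proof -
  let ?M = "\<lambda>x. integral {0..x} (\<lambda>y. mu y + k)"
  have rate: "(\<lambda>y. mu y + k) absolutely_integrable_on {0..l}" if "0 < l" "l < L" for l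
    using that by (intro set_integral_add(1) int) auto
  have "isCont ?M x" if x: "x \<in> {0<..<L}" for x
  proof -
    have "continuous_on {0..(x + L) / 2} ?M" using x by (intro continuous_on_indefinite_integral rate) auto
    then show ?thesis using x by (intro continuous_on_interior[of "{0..(x + L) / 2}"]) auto
  qed
  then have "continuous_on {0<..<L} ?M" by (simp add: continuous_at_imp_continuous_on)
  then show "continuous_on {0<..<L} E" unfolding E_def by (intro continuous_intros)
  show "0 \<le> E x \<and> E x \<le> 1" if x: "x \<in> {0<..<L}" for x
  proof -
    have "0 \<le> ?M x"
      using rate[of x] x mu k by (intro integral_nonneg) (auto simp: absolutely_integrable_on_def)
    then show ?thesis by (simp add: E_def)
  qed
qed

text \<open>The Lipschitz factor is \<open>b (t - x)\<close>: ages in \<open>[0, L]\<close>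
  correspond to boundary times in \<open>[t - L, t]\<close>.\<close>

lemma (in age_flow) profile_in:
  assumes t: "L \<le> t" and C: "\<And>s. t - L \<le> s \<Longrightarrow> s \<le> t \<Longrightarrow> \<bar>b s\<bar> \<le> C"
    "\<And>r s. t - L \<le> r \<Longrightarrow> r \<le> t \<Longrightarrow> t - L \<le> s \<Longrightarrow> s \<le> t \<Longrightarrow> \<bar>b r - b s\<bar> \<le> C * \<bar>r - s\<bar>"
  shows "u t \<in> lipschitz_profiles L (\<lambda>x. exp (- M x)) C"
proof -
  have lip: "\<bar>b (t - x) - b (t - y)\<bar> \<le> C * \<bar>x - y\<bar>" if "x \<in> {0..L}" "y \<in> {0..L}" for x y
    using C(2)[of "t - x" "t - y"] that by (simp add: abs_minus_commute)
  have bd: "\<bar>b (t - x)\<bar> \<le> C" if "x \<in> {0..L}" for x using C(1)[of "t - x"] that by simp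
  have "continuous_on {0..L} (\<lambda>x. b (t - x))" using lip by (rule lipschitz_imp_continuous_on)
  then have "set_integrable lebesgue {0<..<L} (\<lambda>x. b (t - x) * exp (- M x))"
    unfolding M_def using bd by (intro profile_integrable survival_function k mu_nonneg mu_int) auto
  moreover have "u t \<in> L1_space L"
    using u_W11[of t] t L by (auto simp: W11_space_def has_weak_deriv_def)
  ultimately have "u t = L1_class L (\<lambda>x. b (t - x) * exp (- M x))"
    by (intro eq_L1_class rep_u_eq t)
  then show ?thesis
    unfolding lipschitz_profiles_def using lip bd by (intro CollectI exI[of _ "\<lambda>x. b (t - x)"]) auto
qed

section \<open>Compactness of the semigroup\<close>

lemma LINT_rep_l1_functional:
  shows bounded_linear_LINT_rep_l1: "bounded_linear (\<lambda>p. LINT x:{0<..<L}|lebesgue. rep_l1 p x)"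
    and LINT_rep_l1_le: "\<bar>LINT x:{0<..<L}|lebesgue. rep_l1 p x\<bar> \<le> norm p"
  unfolding set_lebesgue_integral_def real_scaleR_def
  using bounded_linear_weighted_integral(1,3)[of "indicat_real {0<..<L}" 1]
  by (auto simp: abs_indicator borel_measurable_indicator indicator_le_1)

lemma lipschitz_if_derivative_bounded:
  fixes f f' :: "real \<Rightarrow> real"
  assumes "\<And>s. 0 \<le> s \<Longrightarrow> (f has_vector_derivative f' s) (at s within {0..})"
    and "\<And>s. a \<le> s \<Longrightarrow> s \<le> t \<Longrightarrow> \<bar>f' s\<bar> \<le> D" and "0 \<le> a" "x \<in> {a..t}" "y \<in> {a..t}"
  shows "\<bar>f x - f y\<bar> \<le> D * \<bar>x - y\<bar>"
proof -
  have "norm (f x - f y) \<le> D * norm (x - y)"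
  proof (rule field_differentiable_bound[of "{a..t}" f f'])
    fix s assume "s \<in> {a..t}"
    then have "(f has_real_derivative f' s) (at s within {0..})"
      using assms(1)[of s] assms(3) by (simp add: has_real_derivative_iff_has_vector_derivative)
    then show "(f has_real_derivative f' s) (at s within {a..t})"
      by (rule DERIV_subset) (use assms(3) in auto)
  qed (use assms in auto)
  then show ?thesis by simp
qed

text \<open>For \<open>s \<ge> L\<close> the boundary data have bounded derivatives; the profiles at time \<open>t\<close> see them on
  \<open>[t - L, t]\<close>, whence the restriction \<open>t > 2 * L\<close>.\<close>

lemma smooth_orbit_profile:
  fixes w w' :: "real \<Rightarrow> state" and \<beta> :: real
  assumes L: "0 < L" and lam: "0 < lam1" "0 < lam2"
    and mu: "\<forall>x\<in>{0..L}. 0 \<le> mu1 x \<and> 0 \<le> mu2 x"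
    and mu_int: "\<forall>l. 0 < l \<and> l < L \<longrightarrow> set_integrable lebesgue {0..l} mu1 \<and> set_integrable lebesgue {0..l} mu2"
    and dom: "\<And>s. 0 \<le> s \<Longrightarrow> w s \<in> A_dom L lam1 lam2 mu1 mu2"
    and op: "\<And>s. 0 \<le> s \<Longrightarrow> w' s = A_op L lam1 lam2 mu1 mu2 (w s)"
    and deriv: "\<And>s. 0 \<le> s \<Longrightarrow> (w has_vector_derivative w' s) (at s within {0..})"
    and w'_cont: "continuous_on {0..} w'"
    and t: "2 * L < t" and bound: "\<And>s. 0 \<le> s \<Longrightarrow> s \<le> t \<Longrightarrow> norm (w s) \<le> \<beta>"
    and C: "C = \<beta> * (1 + lam1 + 2 * lam2 + (lam1 + lam2) * (2 * lam1 + 3 * lam2) + 3 * lam1 * lam2)"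
  shows "st0 (w t) \<in> {-C..C}"
    and "st1 (w t) \<in> lipschitz_profiles L (\<lambda>x. exp (- integral {0..x} (\<lambda>y. mu1 y + lam2))) C"
    and "st2 (w t) \<in> lipschitz_profiles L (\<lambda>x. exp (- integral {0..x} (\<lambda>y. mu2 y + 0))) C"
proof -
  define \<Lambda> where "\<Lambda> = (\<lambda>p. LINT x:{0<..<L}|lebesgue. rep_l1 p x)"
  have \<Lambda>: "bounded_linear \<Lambda>" "\<And>p. \<bar>\<Lambda> p\<bar> \<le> norm p"
    unfolding \<Lambda>_def by (rule LINT_rep_l1_functional)+
  define b1 where "b1 = (\<lambda>s. lam1 * st0 (w s))"
  define b2 where "b2 = (\<lambda>s. lam2 * st0 (w s) + lam2 * \<Lambda> (st1 (w s)))"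
  have w_cont: "continuous_on {0..} w"
    using deriv has_vector_derivative_continuous by (force simp: continuous_on_eq_continuous_within)
  note st_cont = bounded_linear.continuous_on[OF bounded_linear_st0]
    bounded_linear.continuous_on[OF bounded_linear_st1] bounded_linear.continuous_on[OF bounded_linear_st2]
  note st_deriv = bounded_linear.has_vector_derivative[OF bounded_linear_st0]
    bounded_linear.has_vector_derivative[OF bounded_linear_st1]
    bounded_linear.has_vector_derivative[OF bounded_linear_st2]
  \<comment> \<open>Besides repair with rate \<open>mu1\<close>, the first component is left with
    rate \<open>lam2\<close>.\<close>
  interpret F1: age_flow L lam2 mu1 "\<lambda>s. st1 (w s)" "\<lambda>s. st1 (w' s)" b1
  proof
    show "continuous_on {0..} b1" unfolding b1_def by (intro continuous_intros st_cont w_cont)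
    show "continuous_on {0..} (\<lambda>s. st1 (w' s))" by (intro st_cont w'_cont)
    fix s :: real assume s: "0 \<le> s"
    show "((\<lambda>s. st1 (w s)) has_vector_derivative st1 (w' s)) (at s within {0..})"
      by (rule st_deriv(2)[OF deriv[OF s]])
    show "st1 (w s) \<in> W11_space L" "value_at_0 L (st1 (w s)) = b1 s"
      "set_integrable lebesgue {0<..<L} (\<lambda>x. mu1 x * rep_l1 (st1 (w s)) x)"
      using dom[OF s] by (auto simp: A_dom_def b1_def)
    show "st1 (w' s) = - weak_deriv L (st1 (w s)) - L1_class L (\<lambda>x. (mu1 x + lam2) * rep_l1 (st1 (w s)) x)"
      by (simp add: op[OF s] A_op_def)
  qed (use L lam mu mu_int in auto)
  \<comment> \<open>The second component is left by repair only, so \<open>k = 0\<close>; hence the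
    \<open>+ 0\<close> in the exponent of the claim.\<close>
  interpret F2: age_flow L 0 mu2 "\<lambda>s. st2 (w s)" "\<lambda>s. st2 (w' s)" b2
  proof
    show "continuous_on {0..} b2"
      unfolding b2_def by (intro continuous_intros st_cont w_cont bounded_linear.continuous_on[OF \<Lambda>(1)])
    show "continuous_on {0..} (\<lambda>s. st2 (w' s))" by (intro st_cont w'_cont)
    fix s :: real assume s: "0 \<le> s"
    show "((\<lambda>s. st2 (w s)) has_vector_derivative st2 (w' s)) (at s within {0..})"
      by (rule st_deriv(3)[OF deriv[OF s]])
    show "st2 (w s) \<in> W11_space L" "value_at_0 L (st2 (w s)) = b2 s"
      "set_integrable lebesgue {0<..<L} (\<lambda>x. mu2 x * rep_l1 (st2 (w s)) x)"
      using dom[OF s] by (auto simp: A_dom_def b2_def \<Lambda>_def)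
    show "st2 (w' s) = - weak_deriv L (st2 (w s)) - L1_class L (\<lambda>x. (mu2 x + 0) * rep_l1 (st2 (w s)) x)"
      by (simp add: op[OF s] A_op_def)
  qed (use L lam mu mu_int in auto)
  have \<beta>: "0 \<le> \<beta>" using bound[of 0] t L norm_ge_zero[of "w 0"] by linarith
  have p0_le: "\<bar>st0 (w s)\<bar> \<le> \<beta>" and \<Lambda>_le: "\<bar>\<Lambda> (st1 (w s))\<bar> \<le> \<beta>" if "0 \<le> s" "s \<le> t" for s
    using bound[OF that] norm_st_le[of "w s"] \<Lambda>(2)[of "st1 (w s)"] by linarith+
  have b1_le: "\<bar>b1 s\<bar> \<le> lam1 * \<beta>" if "0 \<le> s" "s \<le> t" for s
    using mult_left_mono[OF p0_le[OF that], of lam1] lam by (simp add: b1_def abs_mult)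
  have b2_le: "\<bar>b2 s\<bar> \<le> 2 * lam2 * \<beta>" if "0 \<le> s" "s \<le> t" for s
  proof -
    have "\<bar>b2 s\<bar> \<le> \<bar>lam2 * st0 (w s)\<bar> + \<bar>lam2 * \<Lambda> (st1 (w s))\<bar>"
      unfolding b2_def by (rule abs_triangle_ineq)
    also have "\<dots> \<le> lam2 * \<beta> + lam2 * \<beta>"
      using p0_le[OF that] \<Lambda>_le[OF that] lam by (intro add_mono) (simp_all add: abs_mult)
    finally show ?thesis by linarith
  qed
  \<comment> \<open>Bounds for the three terms in the first row of the operator. The repair
    integrals are at most the bounds for \<open>b1\<close> and \<open>b2\<close>, whatever the
    repair rates.\<close>
  define D where "D = (lam1 + lam2) * \<beta> + lam1 * \<beta> + 2 * lam2 * \<beta>"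
  have D: "\<bar>st0 (w' s)\<bar> \<le> D" if s: "L \<le> s" "s \<le> t" for s
  proof -
    have eq: "st0 (w' s) = - ((lam1 + lam2) * st0 (w s))
        + (LINT x:{0<..<L}|lebesgue. mu1 x * rep_l1 (st1 (w s)) x)
        + (LINT x:{0<..<L}|lebesgue. mu2 x * rep_l1 (st2 (w s)) x)"
      using op[of s] s L by (simp add: A_op_def algebra_simps)
    have "\<bar>(lam1 + lam2) * st0 (w s)\<bar> \<le> (lam1 + lam2) * \<beta>"
      using mult_left_mono[OF p0_le[of s], of "lam1 + lam2"] s L lam by (simp add: abs_mult)
    moreover have "\<bar>LINT x:{0<..<L}|lebesgue. mu1 x * rep_l1 (st1 (w s)) x\<bar> \<le> lam1 * \<beta>"
      using s by (intro F1.LINT_mu_u_bound b1_le) auto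
    moreover have "\<bar>LINT x:{0<..<L}|lebesgue. mu2 x * rep_l1 (st2 (w s)) x\<bar> \<le> 2 * lam2 * \<beta>"
      using s by (intro F2.LINT_mu_u_bound b2_le) auto
    ultimately show ?thesis unfolding eq D_def by linarith
  qed
  have p0_lip: "\<bar>st0 (w r) - st0 (w s)\<bar> \<le> D * \<bar>r - s\<bar>" if "r \<in> {L..t}" "s \<in> {L..t}" for r s
    by (rule lipschitz_if_derivative_bounded[OF st_deriv(1)[OF deriv] D _ that]) (use L in auto)
  have \<Lambda>_lip: "\<bar>\<Lambda> (st1 (w r)) - \<Lambda> (st1 (w s))\<bar> \<le> (3 * (lam1 * \<beta>)) * \<bar>r - s\<bar>" if "r \<in> {L..t}" "s \<in> {L..t}" for r s
  proof (rule lipschitz_if_derivative_bounded[OF _ _ _ that])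
    show "((\<lambda>s. \<Lambda> (st1 (w s))) has_vector_derivative \<Lambda> (st1 (w' s))) (at s within {0..})" if "0 \<le> s" for s
      by (rule bounded_linear.has_vector_derivative[OF \<Lambda>(1) st_deriv(2)[OF deriv[OF that]]])
    show "\<bar>\<Lambda> (st1 (w' s))\<bar> \<le> 3 * (lam1 * \<beta>)" if "L \<le> s" "s \<le> t" for s
      unfolding \<Lambda>_def using that by (intro F1.LINT_u'_bound b1_le) auto
  qed (use L in simp)
  \<comment> \<open>\<open>C\<close> adds up all bounds that occur: \<open>\<beta>\<close>, the
    bounds for \<open>b1\<close> and \<open>b2\<close>, then \<open>z * \<beta>\<close>, which
    dominates \<open>lam1 * D\<close> and \<open>lam2 * D\<close>, and the contribution
    \<open>3 * (lam1 * lam2) * \<beta>\<close> of the mass of the first component to the slope of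
    \<open>b2\<close>.\<close>
  define z where "z = (lam1 + lam2) * (2 * lam1 + 3 * lam2)"
  have z: "0 \<le> z" "0 \<le> lam1 * lam2" using lam by (auto simp: z_def)
  have CE: "C = \<beta> + lam1 * \<beta> + 2 * lam2 * \<beta> + z * \<beta> + 3 * (lam1 * lam2) * \<beta>"
    unfolding C z_def[symmetric] by (simp add: algebra_simps)
  have nn: "0 \<le> lam1 * \<beta>" "0 \<le> 2 * lam2 * \<beta>" "0 \<le> z * \<beta>" "0 \<le> 3 * (lam1 * lam2) * \<beta>"
    using \<beta> lam z by simp_all
  have DE: "D = (2 * lam1 + 3 * lam2) * \<beta>" by (simp add: D_def algebra_simps)
  have le: "lam1 * D \<le> z * \<beta>" "lam2 * D \<le> z * \<beta>"
    unfolding DE z_def mult.assoc using lam \<beta> by (intro mult_right_mono; simp)+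
  have C_ge: "lam1 * D \<le> C" "lam2 * D + 3 * (lam1 * lam2) * \<beta> \<le> C"
    using le nn \<beta> unfolding CE by linarith+
  have "\<bar>st0 (w t)\<bar> \<le> C" using p0_le[of t] t L nn unfolding CE by linarith
  then show "st0 (w t) \<in> {-C..C}" by auto
  show "st1 (w t) \<in> lipschitz_profiles L (\<lambda>x. exp (- integral {0..x} (\<lambda>y. mu1 y + lam2))) C"
  proof (rule F1.profile_in[unfolded F1.M_def])
    show "\<bar>b1 s\<bar> \<le> C" if "t - L \<le> s" "s \<le> t" for s
      using b1_le[of s] that t L nn \<beta> unfolding CE by linarith
    fix r s assume rs: "t - L \<le> r" "r \<le> t" "t - L \<le> s" "s \<le> t"
    have "\<bar>b1 r - b1 s\<bar> = lam1 * \<bar>st0 (w r) - st0 (w s)\<bar>"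
      using lam by (simp add: b1_def abs_mult flip: right_diff_distrib)
    also have "\<dots> \<le> lam1 * (D * \<bar>r - s\<bar>)" using rs t lam by (intro mult_left_mono p0_lip) auto
    also have "\<dots> = (lam1 * D) * \<bar>r - s\<bar>" by simp
    also have "\<dots> \<le> C * \<bar>r - s\<bar>" using C_ge by (intro mult_right_mono) auto
    finally show "\<bar>b1 r - b1 s\<bar> \<le> C * \<bar>r - s\<bar>" .
  qed (use t L in simp)
  show "st2 (w t) \<in> lipschitz_profiles L (\<lambda>x. exp (- integral {0..x} (\<lambda>y. mu2 y + 0))) C"
  proof (rule F2.profile_in[unfolded F2.M_def])
    show "\<bar>b2 s\<bar> \<le> C" if "t - L \<le> s" "s \<le> t" for s
      using b2_le[of s] that t L nn \<beta> unfolding CE by linarith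
    fix r s assume rs: "t - L \<le> r" "r \<le> t" "t - L \<le> s" "s \<le> t"
    have "b2 r - b2 s = lam2 * (st0 (w r) - st0 (w s)) + lam2 * (\<Lambda> (st1 (w r)) - \<Lambda> (st1 (w s)))"
      by (simp add: b2_def algebra_simps)
    then have "\<bar>b2 r - b2 s\<bar> \<le> lam2 * \<bar>st0 (w r) - st0 (w s)\<bar> + lam2 * \<bar>\<Lambda> (st1 (w r)) - \<Lambda> (st1 (w s))\<bar>"
      using abs_triangle_ineq[of "lam2 * (st0 (w r) - st0 (w s))" "lam2 * (\<Lambda> (st1 (w r)) - \<Lambda> (st1 (w s)))"] lam
      by (simp only: abs_mult abs_of_pos)
    also have "\<dots> \<le> lam2 * (D * \<bar>r - s\<bar>) + lam2 * (3 * (lam1 * \<beta>) * \<bar>r - s\<bar>)"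
      using rs t lam by (intro add_mono mult_left_mono p0_lip \<Lambda>_lip) auto
    also have "\<dots> = (lam2 * D + 3 * (lam1 * lam2) * \<beta>) * \<bar>r - s\<bar>" by (simp add: algebra_simps)
    also have "\<dots> \<le> C * \<bar>r - s\<bar>" using C_ge by (intro mult_right_mono) auto
    finally show "\<bar>b2 r - b2 s\<bar> \<le> C * \<bar>r - s\<bar>" .
  qed (use t L in simp)
qed

theorem proposition2p2:
  fixes L lam1 lam2 t :: real
    and mu1 mu2 :: "real \<Rightarrow> real"
    and T :: "real \<Rightarrow> state \<Rightarrow> state"
  assumes "0 < L" and "0 < lam1" and "0 < lam2"
    and "\<forall>x\<in>{0..L}. 0 \<le> mu1 x \<and> 0 \<le> mu2 x"
    and "\<forall>l. 0 < l \<and> l < L \<longrightarrow>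
           set_integrable lebesgue {0..l} mu1 \<and> set_integrable lebesgue {0..l} mu2"
    and "(\<integral>\<^sup>+x\<in>{0..L}. ennreal (mu1 x) \<partial>lebesgue) = \<infinity>"
    and "(\<integral>\<^sup>+x\<in>{0..L}. ennreal (mu2 x) \<partial>lebesgue) = \<infinity>"
    and "\<exists>N::nat. 0 < N \<and>
           (\<exists>c. ((\<lambda>x. mu1 x * (L - x) ^ N) \<longlongrightarrow> c) (at_left L)) \<and>
           (\<exists>c. ((\<lambda>x. mu2 x * (L - x) ^ N) \<longlongrightarrow> c) (at_left L))"
    and "generates_on (X_space L) (A_dom L lam1 lam2 mu1 mu2) (A_op L lam1 lam2 mu1 mu2) T"
    and "t > 2 * L"
  shows "compact_operator_on (X_space L) (T t)"
proof -
  note L = \<open>0 < L\<close> and t = \<open>t > 2 * L\<close>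
  have t0: "0 \<le> t" using L t by simp
  interpret C0_semigroup_retract "X_space L" "restrict_state L" T
    using assms(9)
    by (intro C0_semigroup_retract.intro bounded_linear_restrict_state restrict_state_in restrict_state_fix)
       (auto simp: generates_on_def)
  have gen: "generator_on (X_space L) T = {(x, A_op L lam1 lam2 mu1 mu2 x) | x. x \<in> A_dom L lam1 lam2 mu1 mu2}"
    using assms(9) by (simp add: generates_on_def)
  obtain K where K: "0 \<le> K"
    "\<And>s x. 0 \<le> s \<Longrightarrow> s \<le> t \<Longrightarrow> x \<in> X_space L \<Longrightarrow> norm (T s x) \<le> K * norm x"
    using locally_bounded[OF t0] by blast
  define E1 where "E1 = (\<lambda>x. exp (- integral {0..x} (\<lambda>y. mu1 y + lam2)))"
  define E2 where "E2 = (\<lambda>x. exp (- integral {0..x} (\<lambda>y. mu2 y + 0)))"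
  have E: "continuous_on {0<..<L} E1" "\<And>x. x \<in> {0<..<L} \<Longrightarrow> 0 \<le> E1 x \<and> E1 x \<le> 1"
    "continuous_on {0<..<L} E2" "\<And>x. x \<in> {0<..<L} \<Longrightarrow> 0 \<le> E2 x \<and> E2 x \<le> 1"
    unfolding E1_def E2_def by (rule survival_function; use assms(2-5) in auto)+
  \<comment> \<open>The image of \<open>B\<close> lies in one compact set, which depends on
    \<open>B\<close> only through a norm bound \<open>R\<close>.\<close>
  have "compact (X_space L \<inter> closure (T t ` B))" if B: "B \<subseteq> X_space L" "bounded B" for B
  proof -
    obtain R where R: "0 < R" "\<And>q. q \<in> B \<Longrightarrow> norm q \<le> R" using B(2) by (auto simp: bounded_pos)
    \<comment> \<open>The approximating smooth orbits start within distance 1 of \<open>B\<close>,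
      hence \<open>R + 1\<close>; \<open>K\<close> bounds the operators up to time
      \<open>t\<close>.\<close>
    define \<beta> where "\<beta> = K * (R + 1)"
    define C where "C = \<beta> * (1 + lam1 + 2 * lam2 + (lam1 + lam2) * (2 * lam1 + 3 * lam2) + 3 * lam1 * lam2)"
    have C: "0 \<le> C" unfolding C_def \<beta>_def using K(1) R(1) assms(2,3) by simp
    define Q where "Q = (\<lambda>(a, p, q). State a p q) ` ({-C..C} \<times> lipschitz_profiles L E1 C \<times> lipschitz_profiles L E2 C)"
    have "compact Q"
      unfolding Q_def
    proof (rule compact_continuous_image)
      have "((\<lambda>z. State (fst z) (fst (snd z)) (snd (snd z))) \<longlongrightarrow> State (fst z) (fst (snd z)) (snd (snd z))) (at z within S)"
        for z :: "real \<times> l1 \<times> l1" and S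
        by (intro tendsto_State tendsto_intros)
      then show "continuous_on S (\<lambda>(a, p, q). State a p q)" for S :: "(real \<times> l1 \<times> l1) set"
        by (simp add: continuous_on_def case_prod_unfold)
      show "compact ({-C..C} \<times> lipschitz_profiles L E1 C \<times> lipschitz_profiles L E2 C)"
        using E by (intro compact_Times compact_Icc compact_lipschitz_profiles L C)
    qed
    have "T t q \<in> Q" if q: "q \<in> B" for q
    proof -
      \<comment> \<open>\<open>q\<close> itself need not lie in the domain of the generator; it is
        approximated by initial states of smooth orbits, all of which end in the same closed set
        \<open>Q\<close>.\<close>
      have "T t q \<in> closure Q"
        unfolding closure_approachable
      proof (intro allI impI)
        fix e :: real assume e: "0 < e"
        have qX: "q \<in> X_space L" using q B by blast
        \<comment> \<open>The 1 serves the norm bound \<open>R + 1\<close>; the quotient makes the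
          distance at time \<open>t\<close>, enlarged by at most the factor \<open>K\<close>, less
          than \<open>e\<close>.\<close>
        have "0 < min 1 (e / (K + 1))" using e K(1) by simp
        from smooth_orbit[OF qX this] obtain w w' where w: "w 0 \<in> X_space L" "norm (w 0 - q) < min 1 (e / (K + 1))"
          "\<And>s. 0 \<le> s \<Longrightarrow> w s = T s (w 0)" "\<And>s. 0 \<le> s \<Longrightarrow> (w s, w' s) \<in> generator_on (X_space L) T"
          "\<And>s. 0 \<le> s \<Longrightarrow> (w has_vector_derivative w' s) (at s within {0..})" "continuous_on {0..} w'"
          by metis
        have dom: "w s \<in> A_dom L lam1 lam2 mu1 mu2" "w' s = A_op L lam1 lam2 mu1 mu2 (w s)" if "0 \<le> s" for s
          using w(4)[OF that] unfolding gen by auto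
        have "norm (w 0) \<le> R + 1"
          using w(2) R(2)[OF q] norm_triangle_ineq[of "w 0 - q" q] by simp
        then have bound: "norm (w s) \<le> \<beta>" if "0 \<le> s" "s \<le> t" for s
          using K(2)[OF that w(1)] mult_left_mono[OF _ K(1)] w(3)[OF that(1)] unfolding \<beta>_def
          by (metis order_trans)
        note prof = smooth_orbit_profile[OF L assms(2-5) dom w(5,6) t bound C_def, folded E1_def E2_def]
        have "w t = (\<lambda>(a, p, q). State a p q) (st0 (w t), st1 (w t), st2 (w t))" by simp
        then have "w t \<in> Q" unfolding Q_def using prof by blast
        moreover have "dist (w t) (T t q) < e"
        proof -
          have "dist (w t) (T t q) = norm (T t (w 0 - q))"
            using w(3)[OF t0] T_diff[OF t0 w(1) qX] by (simp add: dist_norm)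
          also have "\<dots> \<le> K * norm (w 0 - q)" using t0 w(1) qX by (intro K(2)) auto
          also have "\<dots> \<le> K * (e / (K + 1))" using w(2) K(1) by (intro mult_left_mono) auto
          also have "\<dots> < e" using e K(1) by (simp add: field_simps)
          finally show ?thesis .
        qed
        ultimately show "\<exists>y\<in>Q. dist y (T t q) < e" by blast
      qed
      then show ?thesis using \<open>compact Q\<close> by (simp add: compact_imp_closed)
    qed
    then have "closure (T t ` B) \<subseteq> Q"
      using \<open>compact Q\<close> by (intro closure_minimal compact_imp_closed) auto
    then have "compact (closure (T t ` B))"
      using \<open>compact Q\<close> by (metis closed_closure compact_Int_closed inf.absorb_iff2)
    then show ?thesis using closed_X_space closed_Int_compact by blast
  qed
  then show ?thesis using T_bounded[OF t0] by (simp add: compact_operator_on_def)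
qed

end
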